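(* Let $s\in\mathbb N$ and let $Y=\{y_i\}_{i=1}^{2s}$ with $-\pi\le y_{2s}<\dots<y_1<\pi$, extended to all $i\in\mathbb Z$ by $y_i:=y_{i+2s}+2\pi$, and put $\Pi(x):=\prod_{i=1}^{2s}\sin\frac12(x-y_i)$. Let $r\ge 2$ be an integer. There is a constant $c=c(r,Y)$, depending only on $r$ and $Y$, such that for every $f\in\Delta^{(1)}(Y)\cap\mathbb W^r$ and every $n\in\mathbb N$, $$E_n^{(1)}(f;Y)\le \frac{c}{n^r}.$$
   Context: $\mathbb W^r$ ($r\in\mathbb N$) is the class of $2\pi$-periodic functions $f:\mathbb R\to\mathbb R$ whose derivative $f^{(r-1)}$ exists and is absolutely continuous and which satisfy $|f^{(r)}(x)|\le1$ for almost every $x\in\mathbb R$. $\mathbb T_n$ is the space of real trigonometric polynomials $a_0+\sum_{k=1}^n(a_k\cos kx+b_k\sin kx)$ of order $\le n$. For a continuously differentiable function $f$ one writes $f\in\Delta^{(1)}(Y)$ if $f'(x)\Pi(x)\ge0$ for all $x\in\mathbb R$ (i.e. $f$ is nondecreasing on $[y_i,y_{i-1}]$ for odd $i$ and nonincreasing for even $i$). $E_n^{(1)}(f;Y):=\inf_{\tau\in\Delta^{(1)}(Y)\cap\mathbb T_n}\|f-\tau\|$, where $\|\cdot\|$ is the uniform norm on $\mathbb R$. *)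

theory Defs
  imports "HOL-Analysis.Analysis"
begin

definition abs_cont_on :: "real \<Rightarrow> real \<Rightarrow> (real \<Rightarrow> real) \<Rightarrow> bool" where
  "abs_cont_on a b g \<longleftrightarrow>
     (\<forall>\<epsilon>>0. \<exists>\<delta>>0. \<forall>(m::nat) (u::nat \<Rightarrow> real) (v::nat \<Rightarrow> real).
        (\<forall>i<m. a \<le> u i \<and> u i \<le> v i \<and> v i \<le> b) \<and>
        (\<forall>i<m. \<forall>j<m. i \<noteq> j \<longrightarrow> v i \<le> u j \<or> v j \<le> u i) \<and>
        (\<Sum>i<m. v i - u i) < \<delta>
        \<longrightarrow> (\<Sum>i<m. \<bar>g (v i) - g (u i)\<bar>) < \<epsilon>)"

definition abs_cont :: "(real \<Rightarrow> real) \<Rightarrow> bool" where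
  "abs_cont g \<longleftrightarrow> (\<forall>a b. abs_cont_on a b g)"

definition Wr :: "nat \<Rightarrow> (real \<Rightarrow> real) \<Rightarrow> bool" where
  "Wr r f \<longleftrightarrow>
     (\<forall>x. f (x + 2 * pi) = f x) \<and>
     (\<exists>D :: nat \<Rightarrow> real \<Rightarrow> real.
        D 0 = f \<and>
        (\<forall>k. k + 1 < r \<longrightarrow> (\<forall>x. (D k has_real_derivative D (k + 1) x) (at x))) \<and>
        abs_cont (D (r - 1)) \<and>
        (AE x in lborel. \<exists>d. (D (r - 1) has_real_derivative d) (at x) \<and> \<bar>d\<bar> \<le> 1))"

definition trig_poly :: "nat \<Rightarrow> (real \<Rightarrow> real) \<Rightarrow> bool" where
  "trig_poly n \<tau> \<longleftrightarrow> (\<exists>a b :: nat \<Rightarrow> real.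
     \<tau> = (\<lambda>x. a 0 + (\<Sum>k=1..n. a k * cos (real k * x) + b k * sin (real k * x))))"

definition PiY :: "nat \<Rightarrow> (nat \<Rightarrow> real) \<Rightarrow> real \<Rightarrow> real" where
  "PiY s y x = (\<Prod>i\<in>{1 .. 2 * s}. sin ((x - y i) / 2))"

definition Delta1 :: "nat \<Rightarrow> (nat \<Rightarrow> real) \<Rightarrow> (real \<Rightarrow> real) \<Rightarrow> bool" where
  "Delta1 s y f \<longleftrightarrow> (\<exists>f'. (\<forall>x. (f has_real_derivative f' x) (at x)) \<and>
      continuous_on UNIV f' \<and> (\<forall>x. f' x * PiY s y x \<ge> 0))"

definition unorm :: "(real \<Rightarrow> real) \<Rightarrow> real" where
  "unorm g = (SUP x. \<bar>g x\<bar>)"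

definition En1 :: "nat \<Rightarrow> nat \<Rightarrow> (nat \<Rightarrow> real) \<Rightarrow> (real \<Rightarrow> real) \<Rightarrow> real" where
  "En1 n s y f = (INF \<tau>\<in>{\<tau>. Delta1 s y \<tau> \<and> trig_poly n \<tau>}. unorm (\<lambda>x. f x - \<tau> x))"

end

theory Submission
  imports Defs
begin

text \<open>
  Write \<open>g = f'\<close>, \<open>h = 1/m\<close> with \<open>m\<close> proportional to \<open>n\<close>. It suffices to find a trigonometric polynomial
  \<open>T = \<Pi> \<psi>\<close> with \<open>\<psi> \<ge> 0\<close> and \<open>\<bar>\<integral> (g - T)\<bar> \<le> C h^r\<close> over all intervals starting at \<open>y 1\<close>: the mean of \<open>T\<close>, which is
  \<open>O(h^r)\<close>, is removed by adding a small multiple of a fixed copositive polynomial. One takes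
  \<open>\<psi> = \<Sum>j. p j * q j\<close>, where the \<open>p j\<close> are translates of a Jackson kernel over an equidistant grid (a positive
  partition of unity localized at scale \<open>h\<close>) and \<open>q j \<ge> 0\<close> has bounded degree with
  \<open>g - \<Pi> q j = O(h^(r - 1))\<close> near the centre of \<open>p j\<close>. Pointwise errors of this size would accumulate to
  \<open>O(h^(r - 1))\<close> after integration, so \<open>q j\<close> is also required to make the integral of \<open>p j * (g - \<Pi> q j)\<close> vanish.
  To achieve this, add to a local approximation of \<open>g / \<Pi>\<close> its own error bound, which yields a nonnegative
  majorant, and scale the majorant down by the ratio of the masses.
\<close>

text \<open>The bound must gain one power of \<open>h\<close> over the accuracy
  \<open>h^(r - 1)\<close> available for \<open>g\<close>. It is gained centre by centre: a local
  error of that size lives on scale \<open>h\<close>, so its integral is \<open>O(h^r)\<close>, and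
  once its mass vanishes it no longer persists to the right of its centre. An additive mass
  correction could destroy \<open>q j \<ge> 0\<close>; a factor \<open>\<theta>\<close> in
  \<open>[0, 1]\<close> cannot. But it changes \<open>\<Pi> q\<close> by
  \<open>(1 - \<theta>) \<bar>\<Pi> q\<bar>\<close>, and \<open>1 - \<theta>\<close> need not be
  small. The way out is to bound \<open>\<Pi> q\<close> by its own mass \<open>M\<close>, because
  \<open>(1 - \<theta>) M\<close> is just the small difference of the two masses; this is possible
  for polynomials of bounded degree. Masses can be compared only where \<open>\<Pi>\<close> keeps
  its sign, that is, on a window of width proportional to \<open>\<bar>\<Pi>\<bar>\<close> at the
  centre. Centres with \<open>\<bar>\<Pi>\<bar> < h\<close> have no such window at scale
  \<open>h\<close>, but their number is bounded and each costs only \<open>O(h^r)\<close>.\<close>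

section \<open>Trigonometric polynomials in half angles\<close>

text \<open>
  Homogeneous polynomials of degree \<open>m\<close> in \<open>cos (x/2)\<close> and \<open>sin (x/2)\<close>. Degree \<open>2n\<close> gives exactly the
  trigonometric polynomials of order \<open>n\<close>; allowing odd degrees lets one divide out the zeros
  \<open>sin ((x - a)/2)\<close> one at a time.
\<close>

primrec htrig :: "nat \<Rightarrow> (real \<Rightarrow> real) \<Rightarrow> bool" where
  "htrig 0 P \<longleftrightarrow> (\<exists>c. P = (\<lambda>x. c))"
| "htrig (Suc m) P \<longleftrightarrow> (\<exists>A B. htrig m A \<and> htrig m B \<and> P = (\<lambda>x. A x * cos (x/2) + B x * sin (x/2)))"

lemma htrig_add: "htrig m P \<Longrightarrow> htrig m Q \<Longrightarrow> htrig m (\<lambda>x. P x + Q x)"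
proof (induction m arbitrary: P Q)
  case 0
  then show ?case by auto
next
  case (Suc m)
  obtain A B where AB: "htrig m A" "htrig m B" "P = (\<lambda>x. A x * cos (x/2) + B x * sin (x/2))"
    using Suc.prems by auto
  obtain A' B' where AB': "htrig m A'" "htrig m B'" "Q = (\<lambda>x. A' x * cos (x/2) + B' x * sin (x/2))"
    using Suc.prems by auto
  have "htrig m (\<lambda>x. A x + A' x)" "htrig m (\<lambda>x. B x + B' x)"
    using Suc.IH AB AB' by auto
  then show ?case unfolding htrig.simps
    by (intro exI[of _ "\<lambda>x. A x + A' x"] exI[of _ "\<lambda>x. B x + B' x"])
       (auto simp: AB AB' algebra_simps)
qed

lemma htrig_cmult: "htrig m P \<Longrightarrow> htrig m (\<lambda>x. c * P x)"
proof (induction m arbitrary: P)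
  case 0
  then show ?case by auto
next
  case (Suc m)
  obtain A B where AB: "htrig m A" "htrig m B" "P = (\<lambda>x. A x * cos (x/2) + B x * sin (x/2))"
    using Suc.prems by auto
  then show ?case unfolding htrig.simps
    by (intro exI[of _ "\<lambda>x. c * A x"] exI[of _ "\<lambda>x. c * B x"])
       (auto simp: Suc.IH algebra_simps)
qed

lemma htrig_diff: "htrig m P \<Longrightarrow> htrig m Q \<Longrightarrow> htrig m (\<lambda>x. P x - Q x)"
  using htrig_add[of m P "\<lambda>x. (-1) * Q x"] htrig_cmult[of m Q "-1"] by simp

lemma htrig_zero: "htrig m (\<lambda>x. 0)"
  by (induction m) force+

lemma htrig_sum: "(\<And>i. i \<in> I \<Longrightarrow> htrig m (P i)) \<Longrightarrow> htrig m (\<lambda>x. \<Sum>i\<in>I. P i x)"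
proof (induction I rule: infinite_finite_induct)
  case (insert i I)
  then show ?case using htrig_add[of m "P i"] by simp
qed (simp_all add: htrig_zero)

lemma htrig_Suc_cos: "htrig m P \<Longrightarrow> htrig (Suc m) (\<lambda>x. P x * cos (x/2))"
  unfolding htrig.simps by (rule exI[of _ P], rule exI[of _ "\<lambda>x. 0"]) (simp add: htrig_zero)

lemma htrig_Suc_sin: "htrig m P \<Longrightarrow> htrig (Suc m) (\<lambda>x. P x * sin (x/2))"
  unfolding htrig.simps by (rule exI[of _ "\<lambda>x. 0"], rule exI[of _ P]) (simp add: htrig_zero)

lemma htrig_mult: "htrig m P \<Longrightarrow> htrig n Q \<Longrightarrow> htrig (m + n) (\<lambda>x. P x * Q x)"
proof (induction m arbitrary: P)
  case 0
  then show ?case using htrig_cmult by auto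
next
  case (Suc m)
  obtain A B where AB: "htrig m A" "htrig m B" "P = (\<lambda>x. A x * cos (x/2) + B x * sin (x/2))"
    using Suc.prems by auto
  then have "htrig (m + n) (\<lambda>x. A x * Q x)" "htrig (m + n) (\<lambda>x. B x * Q x)"
    using Suc by auto
  from htrig_add[OF htrig_Suc_cos[OF this(1)] htrig_Suc_sin[OF this(2)]]
  show ?case by (simp add: AB algebra_simps)
qed

lemma htrig_power: "htrig m P \<Longrightarrow> htrig (m * k) (\<lambda>x. P x ^ k)"
proof (induction k)
  case (Suc k)
  then show ?case using htrig_mult[of m P "m * k" "\<lambda>x. P x ^ k"] by simp
qed auto

lemma htrig_prod:
  "finite I \<Longrightarrow> (\<And>i. i \<in> I \<Longrightarrow> htrig 1 (P i)) \<Longrightarrow> htrig (card I) (\<lambda>x. \<Prod>i\<in>I. P i x)"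
proof (induction I rule: finite_induct)
  case (insert i I)
  then show ?case using htrig_mult[of 1 "P i" "card I" "\<lambda>x. \<Prod>i\<in>I. P i x"]
    by (simp del: htrig.simps(2) One_nat_def add: plus_1_eq_Suc)
qed auto

lemma cos_half_shift: "cos ((x - a)/2) = cos (x/2) * cos (a/2) + sin (x/2) * sin (a/2 :: real)"
  by (simp add: diff_divide_distrib cos_diff)

lemma sin_half_shift: "sin ((x - a)/2) = sin (x/2) * cos (a/2) - cos (x/2) * sin (a/2 :: real)"
  by (simp add: diff_divide_distrib sin_diff)

lemma htrig_cos_shift: "htrig 1 (\<lambda>x. cos ((x - a)/2))"
  unfolding cos_half_shift One_nat_def htrig.simps
  by (rule exI[of _ "\<lambda>x. cos (a/2)"], rule exI[of _ "\<lambda>x. sin (a/2)"]) (auto simp: algebra_simps)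

lemma htrig_sin_shift: "htrig 1 (\<lambda>x. sin ((x - a)/2))"
  unfolding sin_half_shift One_nat_def htrig.simps
  by (rule exI[of _ "\<lambda>x. - sin (a/2)"], rule exI[of _ "\<lambda>x. cos (a/2)"]) (auto simp: algebra_simps)

text \<open>Multiplication by \<open>cos (x/2)^2 + sin (x/2)^2 = 1\<close>, which keeps the parity
  of the degree.\<close>

lemma htrig_raise: "htrig m P \<Longrightarrow> htrig (m + 2 * k) P"
proof (induction k)
  case (Suc k)
  then have *: "htrig (m + 2 * k) P" by simp
  from htrig_add[OF htrig_Suc_cos[OF htrig_Suc_cos[OF *]] htrig_Suc_sin[OF htrig_Suc_sin[OF *]]]
  have "htrig (Suc (Suc (m + 2 * k))) (\<lambda>x. P x * (cos (x/2) * cos (x/2) + sin (x/2) * sin (x/2)))"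
    by (simp only: distrib_left mult.assoc)
  then show ?case by (simp del: htrig.simps)
qed simp

lemma htrig_const: "htrig (2 * k) (\<lambda>x. c)"
  using htrig_raise[of 0 "\<lambda>x. c" k] by auto

lemma htrig_shift: "htrig m P \<Longrightarrow> htrig m (\<lambda>x. P (x - a))"
proof (induction m arbitrary: P)
  case (Suc m)
  obtain A B where AB: "htrig m A" "htrig m B" "P = (\<lambda>x. A x * cos (x/2) + B x * sin (x/2))"
    using Suc.prems by auto
  have "htrig (m + 1) (\<lambda>x. A (x - a) * cos ((x - a)/2))" "htrig (m + 1) (\<lambda>x. B (x - a) * sin ((x - a)/2))"
    by (rule htrig_mult[OF Suc.IH[OF AB(1)] htrig_cos_shift], rule htrig_mult[OF Suc.IH[OF AB(2)] htrig_sin_shift])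
  from htrig_add[OF this] show ?case by (simp add: AB)
qed auto

text \<open>Rotating the half angle by \<open>a/2\<close> makes \<open>P\<close> a form in
  \<open>cos ((x - a)/2)\<close> and \<open>sin ((x - a)/2)\<close>. Every monomial except the pure
  cosine power contains the sine, and at \<open>x = a\<close> only that power survives, so
  \<open>c = P a\<close>.\<close>

lemma htrig_divide:
  assumes "htrig (Suc m) P"
  obtains c Q where "htrig m Q"
    "P = (\<lambda>x. c * cos ((x - a)/2) ^ Suc m + sin ((x - a)/2) * Q x)"
proof -
  have sh: "cos (x/2) = cos ((x - a)/2) * cos (a/2) - sin ((x - a)/2) * sin (a/2)"
    "sin (x/2) = sin ((x - a)/2) * cos (a/2) + cos ((x - a)/2) * sin (a/2)" for x :: real
    using cos_add[of "(x - a)/2" "a/2"] sin_add[of "(x - a)/2" "a/2"]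
    by (simp_all add: diff_divide_distrib)
  have "\<exists>c Q. htrig m Q \<and> P = (\<lambda>x. c * cos ((x - a)/2) ^ Suc m + sin ((x - a)/2) * Q x)"
    using assms
  proof (induction m arbitrary: P)
    case 0
    then obtain \<alpha> \<beta> where P: "P = (\<lambda>x. \<alpha> * cos (x/2) + \<beta> * sin (x/2))"
      by auto
    have "P x = (\<alpha> * cos (a/2) + \<beta> * sin (a/2)) * cos ((x - a)/2) ^ Suc 0
        + sin ((x - a)/2) * (\<beta> * cos (a/2) - \<alpha> * sin (a/2))" for x
      unfolding P sh[of x] by (simp add: algebra_simps)
    then show ?case
      by (intro exI[of _ "\<alpha> * cos (a/2) + \<beta> * sin (a/2)"]
          exI[of _ "\<lambda>x. \<beta> * cos (a/2) - \<alpha> * sin (a/2)"]) auto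
  next
    case (Suc m)
    obtain A B where AB: "htrig (Suc m) A" "htrig (Suc m) B" "P = (\<lambda>x. A x * cos (x/2) + B x * sin (x/2))"
      using Suc.prems htrig.simps(2)[of "Suc m"] by blast
    \<comment> \<open>Coefficients after the rotation. Only \<open>A'\<close> needs the induction
      hypothesis, since \<open>B'\<close> already carries the sine.\<close>
    define A' where "A' = (\<lambda>x. cos (a/2) * A x + sin (a/2) * B x)"
    define B' where "B' = (\<lambda>x. cos (a/2) * B x - sin (a/2) * A x)"
    have A': "htrig (Suc m) A'" and B': "htrig (Suc m) B'" unfolding A'_def B'_def
      by (intro htrig_add htrig_diff htrig_cmult AB)+
    have P: "P = (\<lambda>x. A' x * cos ((x - a)/2) + B' x * sin ((x - a)/2))"
    proof
      show "P x = A' x * cos ((x - a)/2) + B' x * sin ((x - a)/2)" for x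
        unfolding AB(3) A'_def B'_def sh[of x] by (simp add: algebra_simps)
    qed
    obtain c Q where Q: "htrig m Q" "A' = (\<lambda>x. c * cos ((x - a)/2) ^ Suc m + sin ((x - a)/2) * Q x)"
      using Suc.IH[OF A'] by blast
    have "htrig (m + 1) (\<lambda>x. Q x * cos ((x - a)/2))"
      by (rule htrig_mult[OF Q(1) htrig_cos_shift])
    then have "htrig (Suc m) (\<lambda>x. Q x * cos ((x - a)/2) + B' x)"
      using B' htrig_add by (simp del: htrig.simps)
    then show ?case
      by (intro exI[of _ c] exI[of _ "\<lambda>x. Q x * cos ((x - a)/2) + B' x"])
         (auto simp: P Q(2) algebra_simps)
  qed
  then show ?thesis using that by blast
qed

text \<open>At a zero the cosine coefficient of \<open>htrig_divide\<close> is 0. The other points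
  remain zeros of the quotient because the sine divided out does not vanish there.\<close>

lemma htrig_divide_zeros:
  assumes "finite I" "htrig (card I + m) P" "\<And>i. i \<in> I \<Longrightarrow> P (y i) = 0"
    "\<And>i j. i \<in> I \<Longrightarrow> j \<in> I \<Longrightarrow> i \<noteq> j \<Longrightarrow> sin ((y i - y j)/2) \<noteq> 0"
  shows "\<exists>Q. htrig m Q \<and> P = (\<lambda>x. (\<Prod>i\<in>I. sin ((x - y i)/2)) * Q x)"
  using assms
proof (induction I arbitrary: P rule: finite_induct)
  case empty
  then show ?case by auto
next
  case (insert i I)
  have "htrig (Suc (card I + m)) P" using insert by (simp del: htrig.simps)
  then obtain c Q where Q: "htrig (card I + m) Q"
    "P = (\<lambda>x. c * cos ((x - y i)/2) ^ Suc (card I + m) + sin ((x - y i)/2) * Q x)"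
    by (rule htrig_divide[where a="y i"])
  have "c = 0" using insert.prems(2)[of i] by (auto simp: Q(2))
  then have P: "P = (\<lambda>x. sin ((x - y i)/2) * Q x)" using Q by auto
  have "Q (y j) = 0" if "j \<in> I" for j
    using insert.prems(2)[of j] insert.prems(3)[of j i] insert.hyps that by (auto simp: P)
  then obtain R where R: "htrig m R" "Q = (\<lambda>x. (\<Prod>i\<in>I. sin ((x - y i)/2)) * R x)"
    using insert.IH[OF Q(1)] insert.prems(3) by blast
  then show ?case using insert.hyps by (auto simp: P mult.assoc)
qed

lemma htrig_deriv: "htrig m P \<Longrightarrow> \<exists>P'. continuous_on UNIV P' \<and> (\<forall>x. (P has_real_derivative P' x) (at x))"
proof (induction m arbitrary: P)
  case 0
  then show ?case by (auto intro!: exI[of _ "\<lambda>x. 0"])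
next
  case (Suc m)
  obtain A B where AB: "htrig m A" "htrig m B" "P = (\<lambda>x. A x * cos (x/2) + B x * sin (x/2))"
    using Suc.prems by auto
  obtain A' where A': "continuous_on UNIV A'" "\<And>x. (A has_real_derivative A' x) (at x)"
    using Suc.IH AB by blast
  obtain B' where B': "continuous_on UNIV B'" "\<And>x. (B has_real_derivative B' x) (at x)"
    using Suc.IH AB by blast
  have c: "continuous_on UNIV A" "continuous_on UNIV B"
    using A'(2) B'(2) by (meson DERIV_isCont continuous_at_imp_continuous_on)+
  show ?case
  proof (intro exI conjI allI)
    show "continuous_on UNIV (\<lambda>x. A' x * cos (x/2) + A x * (- sin (x/2) / 2) + (B' x * sin (x/2) + B x * (cos (x/2) / 2)))"
      by (intro continuous_intros A' B' c) auto
    show "(P has_real_derivative A' x * cos (x/2) + A x * (- sin (x/2) / 2) + (B' x * sin (x/2) + B x * (cos (x/2) / 2))) (at x)" for x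
      unfolding AB by (auto intro!: derivative_eq_intros A' B' simp: algebra_simps)
  qed
qed

lemma htrig_continuous: "htrig m P \<Longrightarrow> continuous_on A P"
  using htrig_deriv by (metis DERIV_isCont continuous_at_imp_continuous_on)

lemma htrig_periodic: "htrig (2 * m) P \<Longrightarrow> P (x + 2 * pi) = P x"
proof -
  have "htrig m P \<Longrightarrow> P (x + 2 * pi) = (-1) ^ m * P x" for m
  proof (induction m arbitrary: P)
    case (Suc m)
    obtain A B where AB: "htrig m A" "htrig m B" "P = (\<lambda>x. A x * cos (x/2) + B x * sin (x/2))"
      using Suc.prems by auto
    show ?case using Suc.IH[OF AB(1)] Suc.IH[OF AB(2)]
      by (simp add: AB(3) add_divide_distrib distrib_left)
  qed auto
  from this[of "2 * m"] show "htrig (2 * m) P \<Longrightarrow> P (x + 2 * pi) = P x" by simp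
qed

section \<open>Half-angle forms of even degree versus trigonometric polynomials\<close>

lemma trig_poly_add: "trig_poly n P \<Longrightarrow> trig_poly n Q \<Longrightarrow> trig_poly n (\<lambda>x. P x + Q x)"
proof -
  assume "trig_poly n P" "trig_poly n Q"
  then obtain a b a' b' where
    "P = (\<lambda>x. a 0 + (\<Sum>k=1..n. a k * cos (real k * x) + b k * sin (real k * x)))"
    "Q = (\<lambda>x. a' 0 + (\<Sum>k=1..n. a' k * cos (real k * x) + b' k * sin (real k * x)))"
    unfolding trig_poly_def by blast
  then show ?thesis unfolding trig_poly_def
    by (intro exI[of _ "\<lambda>k. a k + a' k"] exI[of _ "\<lambda>k. b k + b' k"])
       (auto simp: sum.distrib algebra_simps)
qed

lemma trig_poly_cmult: "trig_poly n P \<Longrightarrow> trig_poly n (\<lambda>x. c * P x)"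
proof -
  assume "trig_poly n P"
  then obtain a b where
    "P = (\<lambda>x. a 0 + (\<Sum>k=1..n. a k * cos (real k * x) + b k * sin (real k * x)))"
    unfolding trig_poly_def by blast
  then show ?thesis unfolding trig_poly_def
    by (intro exI[of _ "\<lambda>k. c * a k"] exI[of _ "\<lambda>k. c * b k"])
       (auto simp: sum_distrib_left algebra_simps)
qed

lemma trig_poly_const: "trig_poly n (\<lambda>x. c)"
  unfolding trig_poly_def
  by (rule exI[of _ "\<lambda>k. if k = 0 then c else 0"], rule exI[of _ "\<lambda>k. 0"]) auto

lemma trig_poly_cos: "k \<le> n \<Longrightarrow> trig_poly n (\<lambda>x. cos (real k * x))"
proof (cases "k = 0")
  case True
  then show ?thesis using trig_poly_const[of n 1] by simp
next
  case False
  assume "k \<le> n"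
  then show ?thesis unfolding trig_poly_def using False
    by (intro exI[of _ "\<lambda>i. if i = k then 1 else 0"] exI[of _ "\<lambda>k. 0"])
       (auto simp: if_distrib[of "\<lambda>c. c * _"] cong: if_cong)
qed

lemma trig_poly_sin: "k \<le> n \<Longrightarrow> trig_poly n (\<lambda>x. sin (real k * x))"
proof (cases "k = 0")
  case True
  then show ?thesis using trig_poly_const[of n 0] by simp
next
  case False
  assume "k \<le> n"
  then show ?thesis unfolding trig_poly_def using False
    by (intro exI[of _ "\<lambda>k. 0"] exI[of _ "\<lambda>i. if i = k then 1 else 0"])
       (auto simp: if_distrib[of "\<lambda>c. c * _"] cong: if_cong)
qed

text \<open>Linear statements need checking only on the basis. The bound \<open>1 \<le> k\<close>
  lets later proofs use the frequency \<open>k - 1\<close> and divide by \<open>k\<close>.\<close>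

lemma trig_poly_induct [consumes 1, case_names const cos sin add cmult]:
  assumes "trig_poly n P"
    "\<And>c. R (\<lambda>x. c)" "\<And>k. 1 \<le> k \<Longrightarrow> k \<le> n \<Longrightarrow> R (\<lambda>x. cos (real k * x))"
    "\<And>k. 1 \<le> k \<Longrightarrow> k \<le> n \<Longrightarrow> R (\<lambda>x. sin (real k * x))"
    "\<And>P Q. R P \<Longrightarrow> R Q \<Longrightarrow> R (\<lambda>x. P x + Q x)"
    "\<And>P c. R P \<Longrightarrow> R (\<lambda>x. c * P x)"
  shows "R P"
proof -
  obtain a b where P: "P = (\<lambda>x. a 0 + (\<Sum>k\<in>{1..n}. a k * cos (real k * x) + b k * sin (real k * x)))"
    using assms(1) unfolding trig_poly_def by blast
  have S: "R (\<lambda>x. \<Sum>i\<in>I. T i x)" if "finite I" "\<And>i. i \<in> I \<Longrightarrow> R (T i)" for I :: "nat set" and T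
    using that by (induction I rule: finite_induct) (auto intro!: assms)
  show ?thesis unfolding P by (intro assms(2,5,6) S assms(3,4)) auto
qed

lemma trig_poly_mono: "trig_poly n P \<Longrightarrow> n \<le> n' \<Longrightarrow> trig_poly n' P"
  by (induction rule: trig_poly_induct)
     (auto intro: trig_poly_add trig_poly_cmult trig_poly_const trig_poly_cos trig_poly_sin)

lemma trig_poly_mult_cos: "trig_poly n P \<Longrightarrow> trig_poly (Suc n) (\<lambda>x. P x * cos x)"
proof (induction rule: trig_poly_induct)
  case (const c)
  show ?case using trig_poly_cmult[OF trig_poly_cos[of 1 "Suc n"], of c] by simp
next
  case (cos k)
  have e: "cos (real k * x) * cos x = (1/2) * cos (real (k - 1) * x) + (1/2) * cos (real (Suc k) * x)" for x
    using cos(1) by (simp add: of_nat_diff left_diff_distrib distrib_right cos_diff cos_add field_simps)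
  show ?case unfolding e using cos by (intro trig_poly_add trig_poly_cmult trig_poly_cos) auto
next
  case (sin k)
  have e: "sin (real k * x) * cos x = (1/2) * sin (real (k - 1) * x) + (1/2) * sin (real (Suc k) * x)" for x
    using sin(1) by (simp add: of_nat_diff left_diff_distrib distrib_right sin_diff sin_add cos_diff cos_add field_simps)
  show ?case unfolding e using sin by (intro trig_poly_add trig_poly_cmult trig_poly_sin) auto
next
  case (add P Q)
  then show ?case using trig_poly_add by (simp add: distrib_right)
next
  case (cmult P c)
  then show ?case using trig_poly_cmult by (simp add: mult.assoc)
qed

lemma trig_poly_mult_sin: "trig_poly n P \<Longrightarrow> trig_poly (Suc n) (\<lambda>x. P x * sin x)"
proof (induction rule: trig_poly_induct)
  case (const c)
  show ?case using trig_poly_cmult[OF trig_poly_sin[of 1 "Suc n"], of c] by simp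
next
  case (cos k)
  have e: "cos (real k * x) * sin x = (-1/2) * sin (real (k - 1) * x) + (1/2) * sin (real (Suc k) * x)" for x
    using cos(1) by (simp add: of_nat_diff left_diff_distrib distrib_right sin_diff sin_add cos_diff cos_add field_simps)
  show ?case unfolding e using cos by (intro trig_poly_add trig_poly_cmult trig_poly_sin) auto
next
  case (sin k)
  have e: "sin (real k * x) * sin x = (1/2) * cos (real (k - 1) * x) + (-1/2) * cos (real (Suc k) * x)" for x
    using sin(1) by (simp add: of_nat_diff left_diff_distrib distrib_right cos_diff cos_add field_simps)
  show ?case unfolding e using sin by (intro trig_poly_add trig_poly_cmult trig_poly_cos) auto
next
  case (add P Q)
  then show ?case using trig_poly_add by (simp add: distrib_right)
next
  case (cmult P c)
  then show ?case using trig_poly_cmult by (simp add: mult.assoc)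
qed

text \<open>Two half-angle factors combine into \<open>1\<close>, \<open>cos x\<close> and
  \<open>sin x\<close>, so peeling off two degrees costs one order.\<close>

lemma trig_poly_if_htrig: "htrig (2 * n) P \<Longrightarrow> trig_poly n P"
proof (induction n arbitrary: P)
  case 0
  then show ?case by (auto simp: trig_poly_const)
next
  case (Suc n)
  obtain A B where AB: "htrig (Suc (2 * n)) A" "htrig (Suc (2 * n)) B" "P = (\<lambda>x. A x * cos (x/2) + B x * sin (x/2))"
    using Suc.prems htrig.simps(2)[of "Suc (2 * n)"] by auto
  obtain A1 A2 where A: "htrig (2 * n) A1" "htrig (2 * n) A2" "A = (\<lambda>x. A1 x * cos (x/2) + A2 x * sin (x/2))"
    using AB(1) by auto
  obtain B1 B2 where B: "htrig (2 * n) B1" "htrig (2 * n) B2" "B = (\<lambda>x. B1 x * cos (x/2) + B2 x * sin (x/2))"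
    using AB(2) by auto
  have P: "P x = (1/2 * (A1 x + B2 x) + 1/2 * (A1 x + (-1) * B2 x) * cos x) + 1/2 * (A2 x + B1 x) * sin x" for x
  proof -
    have c: "cos (x/2) * cos (x/2) = (1 + cos x)/2" "sin (x/2) * sin (x/2) = (1 - cos x)/2"
      "sin (x/2) * cos (x/2) = sin x / 2"
      using cos_double_cos[of "x/2"] cos_double_sin[of "x/2"] sin_double[of "x/2"]
      by (simp_all add: power2_eq_square)
    have "P x = A1 x * (cos (x/2) * cos (x/2)) + (A2 x + B1 x) * (sin (x/2) * cos (x/2)) + B2 x * (sin (x/2) * sin (x/2))"
      by (simp add: AB(3) A(3) B(3) algebra_simps)
    then show ?thesis unfolding c by (simp add: field_simps)
  qed
  note t = Suc.IH[OF A(1)] Suc.IH[OF A(2)] Suc.IH[OF B(1)] Suc.IH[OF B(2)]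
  have "trig_poly (Suc n) (\<lambda>x. (1/2 * (A1 x + B2 x) + 1/2 * (A1 x + (-1) * B2 x) * cos x) + 1/2 * (A2 x + B1 x) * sin x)"
    by (intro trig_poly_add trig_poly_mult_cos trig_poly_mult_sin trig_poly_cmult
        t t[THEN trig_poly_mono]) auto
  then show ?case using P by presburger
qed

lemma htrig_cos_sin_nat: "htrig (2 * k) (\<lambda>x. cos (real k * x)) \<and> htrig (2 * k) (\<lambda>x. sin (real k * x))"
proof (induction k)
  case 0
  then show ?case by auto
next
  case (Suc k)
  have c: "htrig (1 * 2) (\<lambda>x. cos ((x-0)/2) ^ 2)" "htrig (1 * 2) (\<lambda>x. sin ((x-0)/2) ^ 2)" "htrig (1 + 1) (\<lambda>x. sin ((x-0)/2) * cos ((x-0)/2))"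
    by (intro htrig_power htrig_mult htrig_cos_shift htrig_sin_shift)+
  have "htrig 2 (\<lambda>x. cos ((x-0)/2) ^ 2 - sin ((x-0)/2) ^ 2)"
    using c htrig_diff by (simp del: htrig.simps)
  moreover have "cos ((x-0)/2) ^ 2 - sin ((x-0)/2) ^ 2 = cos x" for x :: real
    using cos_double[of "x/2"] by simp
  ultimately have C: "htrig 2 cos" by (simp del: htrig.simps)
  have "htrig 2 (\<lambda>x. 2 * (sin ((x-0)/2) * cos ((x-0)/2)))"
    using htrig_cmult[OF c(3), of 2] by (simp del: htrig.simps add: numeral_2_eq_2)
  moreover have "2 * (sin ((x-0)/2) * cos ((x-0)/2)) = sin x" for x :: real
    using sin_double[of "x/2"] by simp
  ultimately have S: "htrig 2 sin" by (simp del: htrig.simps)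
  have e: "2 * k + 2 = 2 * Suc k" by simp
  note k = Suc[THEN conjunct1] Suc[THEN conjunct2]
  have "htrig (2 * k + 2) (\<lambda>x. cos (real k * x) * cos x - sin (real k * x) * sin x)"
    "htrig (2 * k + 2) (\<lambda>x. sin (real k * x) * cos x + cos (real k * x) * sin x)"
    by (intro htrig_diff htrig_add htrig_mult k C S)+
  moreover have "real (Suc k) * x = real k * x + x" for x
    by (simp add: distrib_right)
  ultimately show ?case unfolding e by (simp add: cos_add sin_add del: htrig.simps mult_Suc_right of_nat_Suc)
qed

lemma htrig_mono_even: "htrig (2 * k) P \<Longrightarrow> k \<le> n \<Longrightarrow> htrig (2 * n) P"
  using htrig_raise[of "2 * k" P "n - k"] by (simp add: algebra_simps del: htrig.simps)

lemma htrig_if_trig_poly: "trig_poly n P \<Longrightarrow> htrig (2 * n) P"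
  by (induction rule: trig_poly_induct)
     (auto intro: htrig_add htrig_cmult htrig_const htrig_mono_even htrig_cos_sin_nat[THEN conjunct1]
       htrig_cos_sin_nat[THEN conjunct2])

text \<open>The constant \<open>a0\<close> is the mean of \<open>P\<close>, the only obstruction to
  a periodic antiderivative.\<close>

lemma trig_poly_antiderivative:
  assumes "trig_poly n P"
  obtains a0 Q where "trig_poly n Q" "\<And>x. (Q has_real_derivative P x - a0) (at x)"
proof -
  have "\<exists>a0 Q. trig_poly n Q \<and> (\<forall>x. (Q has_real_derivative P x - a0) (at x))"
    using assms
  proof (induction rule: trig_poly_induct)
    case (const c)
    show ?case by (rule exI[of _ c], rule exI[of _ "\<lambda>x. 0"]) (auto simp: trig_poly_const)
  next
    case (cos k)
    have "((\<lambda>x. (1 / real k) * sin (real k * x)) has_real_derivative cos (real k * x) - 0) (at x)" for x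
      using cos by (auto intro!: derivative_eq_intros simp: field_simps)
    then show ?case using cos by (blast intro: trig_poly_cmult trig_poly_sin)
  next
    case (sin k)
    have "((\<lambda>x. (- 1 / real k) * cos (real k * x)) has_real_derivative sin (real k * x) - 0) (at x)" for x
      using sin by (auto intro!: derivative_eq_intros simp: field_simps)
    then show ?case using sin by (blast intro: trig_poly_cmult trig_poly_cos)
  next
    case (add P Q)
    then obtain a A b B where "trig_poly n A" "\<And>x. (A has_real_derivative P x - a) (at x)"
      "trig_poly n B" "\<And>x. (B has_real_derivative Q x - b) (at x)" by blast
    then show ?case
      by (intro exI[of _ "a + b"] exI[of _ "\<lambda>x. A x + B x"])
         (auto intro!: trig_poly_add derivative_eq_intros)
  next
    case (cmult P c)
    then obtain a A where "trig_poly n A" "\<And>x. (A has_real_derivative P x - a) (at x)" by blast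
    then show ?case
      by (intro exI[of _ "c * a"] exI[of _ "\<lambda>x. c * A x"])
         (auto intro!: trig_poly_cmult derivative_eq_intros simp: algebra_simps)
  qed
  then show ?thesis using that by blast
qed

section \<open>Lipschitz bounds for the derivatives\<close>

lemma deriv_le_one_local:
  fixes g :: "real \<Rightarrow> real"
  assumes "(g has_real_derivative d) (at x)" "\<bar>d\<bar> \<le> 1" "\<epsilon> > 0"
  shows "\<exists>\<eta>>0. \<forall>y. \<bar>y - x\<bar> < \<eta> \<longrightarrow> \<bar>g y - g x\<bar> \<le> (1 + \<epsilon>) * \<bar>y - x\<bar>"
proof -
  have "(g has_derivative (\<lambda>h. d * h)) (at x)"
    using assms(1) by (simp add: has_field_derivative_def)
  then obtain \<eta> where \<eta>: "\<eta> > 0" "\<And>y. norm (y - x) < \<eta> \<Longrightarrow> norm (g y - g x - d * (y - x)) \<le> \<epsilon> * norm (y - x)"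
    using assms(3) unfolding has_derivative_within_alt by auto
  have "\<bar>g y - g x\<bar> \<le> (1 + \<epsilon>) * \<bar>y - x\<bar>" if "\<bar>y - x\<bar> < \<eta>" for y
  proof -
    have "\<bar>d * (y - x)\<bar> \<le> 1 * \<bar>y - x\<bar>"
      unfolding abs_mult by (rule mult_right_mono) (use assms in auto)
    then show ?thesis using \<eta>(2)[of y] that by (simp add: algebra_simps)
  qed
  then show ?thesis using \<eta>(1) by blast
qed

text \<open>
  Cousin's lemma: tags outside the exceptional null set give increments bounded by the derivative,
  tags inside it are confined to an open set of small measure, where absolute continuity applies.
\<close>

lemma abs_cont_imp_lipschitz_le:
  assumes ac: "abs_cont g"
    and ae: "AE x in lborel. \<exists>d. (g has_real_derivative d) (at x) \<and> \<bar>d\<bar> \<le> 1"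
    and uv: "u \<le> v"
  shows "\<bar>g v - g u\<bar> \<le> v - u"
proof -
  have main: "\<bar>g v - g u\<bar> \<le> (1 + \<epsilon>) * (v - u) + \<epsilon>" if "\<epsilon> > 0" for \<epsilon>
  proof -
    have "abs_cont_on u v g" using ac by (simp add: abs_cont_def)
    from this[unfolded abs_cont_on_def, THEN spec, THEN mp, OF that]
    have "\<exists>\<delta>>0. \<forall>(m::nat) a b. (\<forall>i<m. u \<le> a i \<and> a i \<le> b i \<and> b i \<le> v) \<and>
        (\<forall>i<m. \<forall>j<m. i \<noteq> j \<longrightarrow> b i \<le> a j \<or> b j \<le> a i) \<and> (\<Sum>i<m. b i - a i) < \<delta>
        \<longrightarrow> (\<Sum>i<m. \<bar>g (b i) - g (a i)\<bar>) < \<epsilon>"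
      .
    then obtain \<delta> where \<delta>: "\<delta> > 0" and \<delta>_imp: "\<forall>(m::nat) a b. (\<forall>i<m. u \<le> a i \<and> a i \<le> b i \<and> b i \<le> v) \<and>
        (\<forall>i<m. \<forall>j<m. i \<noteq> j \<longrightarrow> b i \<le> a j \<or> b j \<le> a i) \<and> (\<Sum>i<m. b i - a i) < \<delta>
        \<longrightarrow> (\<Sum>i<m. \<bar>g (b i) - g (a i)\<bar>) < \<epsilon>"
      by (elim exE conjE) (rule that)
    obtain N where N2: "{x \<in> space lborel. \<not> (\<exists>d. (g has_real_derivative d) (at x) \<and> \<bar>d\<bar> \<le> 1)} \<subseteq> N"
      and eN: "emeasure lborel N = 0" and mN: "N \<in> sets lborel"
      by (rule AE_E[OF ae])
    have N1: "N \<in> null_sets lborel" using eN mN by (rule null_setsI)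
    have N0: "N \<in> null_sets lebesgue"
      using N1 by (simp add: null_sets_completionI)
    then obtain T where T: "open T" "N \<subseteq> T" "(T - N) \<in> lmeasurable" "emeasure lebesgue (T - N) < ennreal \<delta>"
      using sets_lebesgue_outer_open[of N \<delta>] \<delta> by blast
    have TT: "emeasure lebesgue T < ennreal \<delta>"
      using T emeasure_Diff_null_set[OF N0, of T] by (simp add: borel_open)
    have "\<forall>x. \<exists>\<eta>. x \<notin> N \<longrightarrow> \<eta> > 0 \<and> (\<forall>y. \<bar>y - x\<bar> < \<eta> \<longrightarrow> \<bar>g y - g x\<bar> \<le> (1 + \<epsilon>) * \<bar>y - x\<bar>)"
    proof
      fix x
      have "x \<notin> N \<Longrightarrow> \<exists>d. (g has_real_derivative d) (at x) \<and> \<bar>d\<bar> \<le> 1"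
        using N2 by auto
      then show "\<exists>\<eta>. x \<notin> N \<longrightarrow> \<eta> > 0 \<and> (\<forall>y. \<bar>y - x\<bar> < \<eta> \<longrightarrow> \<bar>g y - g x\<bar> \<le> (1 + \<epsilon>) * \<bar>y - x\<bar>)"
        using deriv_le_one_local[OF _ _ that] by blast
    qed
    then obtain \<eta> where \<eta>: "\<And>x. x \<notin> N \<Longrightarrow> \<eta> x > 0"
      "\<And>x y. x \<notin> N \<Longrightarrow> \<bar>y - x\<bar> < \<eta> x \<Longrightarrow> \<bar>g y - g x\<bar> \<le> (1 + \<epsilon>) * \<bar>y - x\<bar>"
      by metis
    have "gauge (\<lambda>x. if x \<in> N then T else ball x (\<eta> x))"
      unfolding gauge_def using T \<eta>(1) by auto
    then obtain p where p: "p tagged_division_of {u..v}" "(\<lambda>x. if x \<in> N then T else ball x (\<eta> x)) fine p"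
      by (rule fine_division_exists_real)
    note pD = tagged_division_ofD[OF p(1)]
    have K: "K = {Inf K..Sup K} \<and> u \<le> Inf K \<and> Inf K \<le> x \<and> x \<le> Sup K \<and> Sup K \<le> v" if in_p: "(x, K) \<in> p" for x K
    proof -
      obtain a b where ab: "K = {a..b}" using pD(4)[OF in_p] by auto
      moreover have "x \<in> K" "K \<subseteq> {u..v}" using pD that by blast+
      ultimately show ?thesis by auto
    qed
    \<comment> \<open>Degenerate pieces are left out: a single point may sit inside another piece,
      which would violate the ordering condition of absolute continuity. Their increments are 0
      anyway.\<close>
    define B where "B = {(x, K) \<in> p. x \<in> N \<and> Inf K < Sup K}"
    have Bp: "B \<subseteq> p" "finite B" using pD(1) by (auto simp: B_def intro: finite_subset)
    have good: "\<bar>g (Sup K) - g (Inf K)\<bar> \<le> (1 + \<epsilon>) * (Sup K - Inf K)" if "(x, K) \<in> p - B" for x K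
    proof (cases "x \<in> N")
      case True
      then have "Inf K = Sup K" using that K[of x K] by (auto simp: B_def)
      then show ?thesis by simp
    next
      case False
      have KK: "K = {Inf K..Sup K}" "Inf K \<le> x" "x \<le> Sup K" using K that by auto
      have "K \<subseteq> (if x \<in> N then T else ball x (\<eta> x))" using p(2) that unfolding fine_def by blast
      then have "K \<subseteq> ball x (\<eta> x)" using False by simp
      moreover have "Inf K \<in> K" "Sup K \<in> K" using KK by (metis atLeastAtMost_iff order_trans order_refl)+
      ultimately have "\<bar>Inf K - x\<bar> < \<eta> x" "\<bar>Sup K - x\<bar> < \<eta> x" by (auto simp: dist_real_def)
      \<comment> \<open>The tag lies between the endpoints, so the two one-sided estimates add up to
        the length of the piece.\<close>
      from \<eta>(2)[OF False this(1)] \<eta>(2)[OF False this(2)] KK show ?thesis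
        by (simp add: algebra_simps abs_real_def split: if_splits)
    qed
    have bad: "(\<Sum>(x, K)\<in>B. \<bar>g (Sup K) - g (Inf K)\<bar>) < \<epsilon>"
    proof -
      obtain h where h: "bij_betw h {..<card B} B"
        using ex_bij_betw_nat_finite[OF Bp(2)] by (auto simp: lessThan_atLeast0)
      define a where "a = (\<lambda>i. Inf (snd (h i)))"
      define b where "b = (\<lambda>i. Sup (snd (h i)))"
      have hB: "h i \<in> B" if "i < card B" for i
        using h that by (auto simp: bij_betw_def)
      have ab: "u \<le> a i \<and> a i < b i \<and> b i \<le> v \<and> {a i..b i} = snd (h i) \<and> {a i..b i} \<subseteq> T" if "i < card B" for i
      proof -
        obtain x K where xK: "h i = (x, K)" by fastforce
        have *: "(x, K) \<in> p" "x \<in> N" "Inf K < Sup K" using hB[OF that] by (auto simp: xK B_def)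
        have "K \<subseteq> (if x \<in> N then T else ball x (\<eta> x))" using p(2) *(1) unfolding fine_def by blast
        then have "K \<subseteq> T" using *(2) by simp
        then show ?thesis using K[OF *(1)] * by (auto simp: a_def b_def xK)
      qed
      have disj: "{a i<..<b i} \<inter> {a j<..<b j} = {}" if "i < card B" "j < card B" "i \<noteq> j" for i j
      proof -
        have "h i \<noteq> h j" using h that by (auto simp: bij_betw_def inj_on_def)
        then have "interior (snd (h i)) \<inter> interior (snd (h j)) = {}"
          using pD(5)[of "fst (h i)" "snd (h i)" "fst (h j)" "snd (h j)"] hB that Bp by auto
        then show ?thesis using ab that by (metis interior_atLeastAtMost_real)
      qed
      have "(\<Sum>i<card B. b i - a i) = (\<Sum>i<card B. measure lebesgue {a i<..<b i})"
        using ab by (intro sum.cong) (auto simp: less_imp_le)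
      also have "\<dots> = measure lebesgue (\<Union>i<card B. {a i<..<b i})"
      proof (rule measure_finite_Union[symmetric])
        show "disjoint_family_on (\<lambda>i. {a i<..<b i}) {..<card B}"
          unfolding disjoint_family_on_def using disj by blast
        show "emeasure lebesgue {a i<..<b i} \<noteq> \<infinity>" if "i \<in> {..<card B}" for i
          using ab[of i] that by (simp add: emeasure_lborel_Ioo)
      qed auto
      also have "\<dots> \<le> measure lebesgue T"
        using TT ab T(1) by (intro measure_mono_fmeasurable)
          (fastforce simp: fmeasurable_def borel_open less_top[symmetric] intro!: order.strict_trans[of _ "ennreal \<delta>"])+
      also have "\<dots> < \<delta>"
        using TT \<delta> unfolding measure_def
        by (metis enn2real_ennreal enn2real_nonneg ennreal_enn2real ennreal_less_iff order.strict_trans ennreal_less_top infinity_ennreal_def top.not_eq_extremum)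
      finally have "(\<Sum>i<card B. b i - a i) < \<delta>" .
      moreover have "b i \<le> a j \<or> b j \<le> a i" if "i < card B" "j < card B" "i \<noteq> j" for i j
      proof (rule ccontr)
        assume "\<not> ?thesis"
        then have "max (a i) (a j) < min (b i) (b j)" using ab that by auto
        then obtain z where "max (a i) (a j) < z" "z < min (b i) (b j)" using dense by blast
        then have "z \<in> {a i<..<b i} \<inter> {a j<..<b j}" by auto
        then show False using disj[OF that] by auto
      qed
      ultimately have "(\<Sum>i<card B. \<bar>g (b i) - g (a i)\<bar>) < \<epsilon>"
        using ab by (intro \<delta>_imp[rule_format]) (auto simp: less_imp_le)
      moreover have "(\<Sum>i<card B. \<bar>g (b i) - g (a i)\<bar>) = (\<Sum>(x, K)\<in>B. \<bar>g (Sup K) - g (Inf K)\<bar>)"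
        unfolding a_def b_def case_prod_unfold
        using sum.reindex_bij_betw[OF h, of "\<lambda>z. \<bar>g (Sup (snd z)) - g (Inf (snd z))\<bar>"] by simp
      ultimately show ?thesis by simp
    qed
    have "\<bar>g v - g u\<bar> = \<bar>\<Sum>(x, K)\<in>p. g (Sup K) - g (Inf K)\<bar>"
      using additive_tagged_division_1[OF uv p(1), of g] by simp
    also have "\<dots> \<le> (\<Sum>(x, K)\<in>p. \<bar>g (Sup K) - g (Inf K)\<bar>)"
      using sum_abs[of "\<lambda>(x, K). g (Sup K) - g (Inf K)" p] by (simp add: case_prod_unfold)
    also have "\<dots> = (\<Sum>(x, K)\<in>p - B. \<bar>g (Sup K) - g (Inf K)\<bar>) + (\<Sum>(x, K)\<in>B. \<bar>g (Sup K) - g (Inf K)\<bar>)"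
      by (rule sum.subset_diff[OF Bp(1) pD(1)])
    also have "(\<Sum>(x, K)\<in>p - B. \<bar>g (Sup K) - g (Inf K)\<bar>) \<le> (\<Sum>(x, K)\<in>p - B. (1 + \<epsilon>) * (Sup K - Inf K))"
      by (rule sum_mono) (use good in auto)
    also have "\<dots> \<le> (\<Sum>(x, K)\<in>p. (1 + \<epsilon>) * (Sup K - Inf K))"
      using K that pD(1) by (intro sum_mono2) (auto intro!: mult_nonneg_nonneg, force)
    also have "\<dots> = (1 + \<epsilon>) * (v - u)"
      using additive_tagged_division_1[OF uv p(1), of "\<lambda>x. x"]
      by (simp add: case_prod_unfold flip: sum_distrib_left)
    finally show ?thesis using bad by linarith
  qed
  show ?thesis
  proof (rule field_le_epsilon)
    fix e :: real assume "e > 0"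
    define \<epsilon> where "\<epsilon> = e / (v - u + 1)"
    have "\<epsilon> > 0" using \<open>e > 0\<close> uv by (simp add: \<epsilon>_def)
    moreover have "(1 + \<epsilon>) * (v - u) + \<epsilon> = v - u + e"
    proof -
      have "\<epsilon> * (v - u + 1) = e" using uv by (simp add: \<epsilon>_def)
      then show ?thesis by (simp add: algebra_simps)
    qed
    ultimately show "\<bar>g v - g u\<bar> \<le> v - u + e" using main by metis
  qed
qed

lemma abs_cont_imp_lipschitz:
  assumes "abs_cont g" "AE x in lborel. \<exists>d. (g has_real_derivative d) (at x) \<and> \<bar>d\<bar> \<le> 1"
  shows "\<bar>g v - g u\<bar> \<le> \<bar>v - u\<bar>"
  using abs_cont_imp_lipschitz_le[OF assms, of u v] abs_cont_imp_lipschitz_le[OF assms, of v u]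
  by (cases "u \<le> v") (auto simp: abs_minus_commute)

section \<open>Periodic functions and bounds for their derivatives\<close>

lemma reduce_mod_2pi:
  obtains k :: int where "\<bar>x - a - 2 * pi * of_int k\<bar> \<le> pi"
proof -
  define k where "k = \<lfloor>(x - a + pi) / (2 * pi)\<rfloor>"
  have "of_int k \<le> (x - a + pi) / (2 * pi)" "(x - a + pi) / (2 * pi) < of_int k + 1"
    unfolding k_def by linarith+
  then have "2 * pi * of_int k \<le> x - a + pi" "x - a + pi < 2 * pi * (of_int k + 1)"
    by (auto simp: field_simps)
  then show ?thesis by (intro that[of k]) (auto simp: algebra_simps abs_real_def)
qed

lemma periodic_int:
  fixes f :: "real \<Rightarrow> 'b"
  assumes per: "\<And>x. f (x + 2 * pi) = f x"
  shows "f (x + 2 * pi * of_int k) = f x"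
proof -
  have n: "f (x + 2 * pi * real n) = f x" for n x
  proof (induction n)
    case (Suc n)
    have "f (x + 2 * pi * real (Suc n)) = f (x + 2 * pi * real n + 2 * pi)" by (simp add: algebra_simps)
    then show ?case using per Suc by simp
  qed simp
  show ?thesis
  proof (cases "k \<ge> 0")
    case True
    then show ?thesis using n[of x "nat k"] by simp
  next
    case False
    then show ?thesis using n[of "x + 2 * pi * of_int k" "nat (- k)"] by simp
  qed
qed

lemma periodic_deriv:
  fixes f :: "real \<Rightarrow> real"
  assumes per: "\<And>x. f (x + 2 * pi) = f x" and d: "\<And>x. (f has_real_derivative f' x) (at x)"
  shows "f' (x + 2 * pi) = f' x"
proof -
  have "((\<lambda>x. f (x + 2 * pi)) has_real_derivative f' (x + 2 * pi)) (at x)"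
    using DERIV_shift[of f "f' (x + 2 * pi)" x "2 * pi"] d by blast
  then have "(f has_real_derivative f' (x + 2 * pi)) (at x)" unfolding per .
  then show ?thesis using d[of x] DERIV_unique by blast
qed

text \<open>Rolle's theorem over one period provides a zero of \<open>f'\<close> within
  \<open>2 * pi\<close> of \<open>x\<close>.\<close>

lemma periodic_deriv_bound:
  fixes f :: "real \<Rightarrow> real"
  assumes per: "\<And>x. f (x + 2 * pi) = f x" and d: "\<And>x. (f has_real_derivative f' x) (at x)"
    and lip: "\<And>x y. \<bar>f' x - f' y\<bar> \<le> L * \<bar>x - y\<bar>" and "L \<ge> 0"
  shows "\<bar>f' x\<bar> \<le> 2 * pi * L"
proof -
  have "\<exists>z>x. z < x + 2 * pi \<and> f (x + 2 * pi) - f x = (x + 2 * pi - x) * f' z"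
    by (rule MVT2) (use d in auto)
  then obtain z where z: "x < z" "z < x + 2 * pi" "f' z = 0" using per by auto
  have "\<bar>f' x - f' z\<bar> \<le> L * \<bar>x - z\<bar>" by (rule lip)
  also have "\<dots> \<le> L * (2 * pi)" by (rule mult_left_mono) (use z \<open>L \<ge> 0\<close> in auto)
  finally show ?thesis using z by (simp add: mult.commute)
qed

lemma lipschitz_if_deriv_bound:
  fixes f :: "real \<Rightarrow> real"
  assumes "\<And>x. (f has_real_derivative f' x) (at x)" "\<And>x. \<bar>f' x\<bar> \<le> B"
  shows "\<bar>f x - f y\<bar> \<le> B * \<bar>x - y\<bar>"
proof -
  have "norm (f x - f y) \<le> B * norm (x - y)"
  proof (rule field_differentiable_bound[of UNIV f f'])
    show "(f has_field_derivative f' z) (at z within UNIV)" for z by (simp add: assms(1))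
    show "norm (f' z) \<le> B" for z using assms(2) by simp
  qed simp_all
  then show ?thesis by simp
qed

text \<open>Descent from the top: a Lipschitz constant of \<open>D i\<close> bounds
  \<open>D i\<close> itself by \<open>periodic_deriv_bound\<close>, and this bound is a Lipschitz
  constant of \<open>D (i - 1)\<close>. Each step costs a factor \<open>2 * pi\<close>.
  \<open>D 0\<close> is excluded from the bound because additive constants are free.\<close>

lemma Wr_chain_bounds:
  assumes per: "\<And>x. D 0 (x + 2 * pi) = D 0 x"
    and ch: "\<And>k x. k + 1 < r \<Longrightarrow> (D k has_real_derivative D (k + 1) x) (at x)"
    and lip: "\<And>x y. \<bar>D (r - 1) x - D (r - 1) y\<bar> \<le> \<bar>x - y\<bar>"
    and r: "r \<ge> 2"
  shows "i < r \<Longrightarrow> D i (x + 2 * pi) = D i x"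
    and "1 \<le> i \<Longrightarrow> i < r \<Longrightarrow> \<bar>D i x\<bar> \<le> (2 * pi) ^ r"
proof -
  have P: "D i (x + 2 * pi) = D i x" if "i < r" for i x
    using that
  proof (induction i arbitrary: x)
    case (Suc i)
    then show ?case
      using periodic_deriv[of "D i" "D (Suc i)"] ch[of i] by simp
  qed (simp add: per)
  then show "i < r \<Longrightarrow> D i (x + 2 * pi) = D i x" .
  have L: "\<bar>D (r - 1 - j) x - D (r - 1 - j) y\<bar> \<le> (2 * pi) ^ j * \<bar>x - y\<bar>" if "j < r" for j x y
    using that
  proof (induction j arbitrary: x y)
    case (Suc j)
    have e: "r - 1 - Suc j + 1 = r - 1 - j" using Suc by simp
    have d: "(D (r - 1 - Suc j) has_real_derivative D (r - 1 - j) x) (at x)" for x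
      using ch[of "r - 1 - Suc j" x] unfolding e using Suc.prems by simp
    have "\<bar>D (r - 1 - j) x\<bar> \<le> 2 * pi * (2 * pi) ^ j" for x
      by (rule periodic_deriv_bound[OF P d]) (use Suc in auto)
    from lipschitz_if_deriv_bound[OF d this] show ?case by simp
  qed (use lip in simp)
  show "1 \<le> i \<Longrightarrow> i < r \<Longrightarrow> \<bar>D i x\<bar> \<le> (2 * pi) ^ r"
  proof -
    assume i: "1 \<le> i" "i < r"
    have e: "r - 1 - (r - 1 - i) = i" using i by simp
    have d: "(D (i - 1) has_real_derivative D i x) (at x)" for x
      using ch[of "i - 1"] i by simp
    have "\<bar>D i x\<bar> \<le> 2 * pi * (2 * pi) ^ (r - 1 - i)"
      by (rule periodic_deriv_bound[OF P d]) (use L[of "r - 1 - i"] i in \<open>auto simp: e\<close>)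
    also have "\<dots> = (2 * pi) ^ Suc (r - 1 - i)" by simp
    also have "\<dots> \<le> (2 * pi) ^ r"
      by (rule power_increasing) (use i pi_gt3 in auto)
    finally show ?thesis .
  qed
qed

section \<open>Trigonometric Taylor approximation\<close>

text \<open>
  Vanishing to order \<open>k + 1\<close> at \<open>\<xi>\<close>, stated as a Lipschitz estimate so that functions which are merely
  Lipschitz (\<open>k = 0\<close>) are included. The radius \<open>7 > 2 * pi\<close> leaves room for a point within \<open>pi\<close> of \<open>\<xi>\<close> and
  a zero of \<open>\<Pi>\<close> within \<open>pi\<close> of that point.
\<close>

definition flat :: "nat \<Rightarrow> real \<Rightarrow> real \<Rightarrow> (real \<Rightarrow> real) \<Rightarrow> bool" where
  "flat k \<xi> C e \<longleftrightarrow> e \<xi> = 0 \<and> 0 \<le> C \<and>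
     (\<forall>a b M. \<bar>a - \<xi>\<bar> \<le> M \<longrightarrow> \<bar>b - \<xi>\<bar> \<le> M \<longrightarrow> M \<le> 7 \<longrightarrow> \<bar>e a - e b\<bar> \<le> C * M ^ k * \<bar>a - b\<bar>)"

lemma flatD:
  assumes "flat k \<xi> C e"
  shows "e \<xi> = 0" "0 \<le> C"
    "\<bar>a - \<xi>\<bar> \<le> M \<Longrightarrow> \<bar>b - \<xi>\<bar> \<le> M \<Longrightarrow> M \<le> 7 \<Longrightarrow> \<bar>e a - e b\<bar> \<le> C * M ^ k * \<bar>a - b\<bar>"
  using assms unfolding flat_def by auto

lemma flat_value:
  assumes "flat k \<xi> C e" "\<bar>a - \<xi>\<bar> \<le> 7"
  shows "\<bar>e a\<bar> \<le> C * \<bar>a - \<xi>\<bar> ^ Suc k"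
  using flatD(3)[OF assms(1), of a "\<bar>a - \<xi>\<bar>" \<xi>] flatD(1)[OF assms(1)] assms(2)
  by (simp add: mult_ac)

lemma flat_zero: "flat k \<xi> 0 (\<lambda>x. 0)"
  by (simp add: flat_def)

lemma flat_add:
  assumes "flat k \<xi> C e" "flat k \<xi> C' e'"
  shows "flat k \<xi> (C + C') (\<lambda>x. e x + e' x)"
  unfolding flat_def
proof (intro conjI allI impI)
  fix a b M :: real assume *: "\<bar>a - \<xi>\<bar> \<le> M" "\<bar>b - \<xi>\<bar> \<le> M" "M \<le> 7"
  have "\<bar>e a + e' a - (e b + e' b)\<bar> \<le> \<bar>e a - e b\<bar> + \<bar>e' a - e' b\<bar>" by linarith
  also have "\<dots> \<le> C * M ^ k * \<bar>a - b\<bar> + C' * M ^ k * \<bar>a - b\<bar>"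
    using flatD(3)[OF assms(1) *] flatD(3)[OF assms(2) *] by simp
  finally show "\<bar>e a + e' a - (e b + e' b)\<bar> \<le> (C + C') * M ^ k * \<bar>a - b\<bar>"
    by (simp add: algebra_simps)
qed (use flatD[OF assms(1)] flatD[OF assms(2)] in auto)

lemma flat_cmult:
  assumes "flat k \<xi> C e" "\<bar>c\<bar> \<le> B"
  shows "flat k \<xi> (B * C) (\<lambda>x. c * e x)"
  unfolding flat_def
proof (intro conjI allI impI)
  fix a b M :: real assume *: "\<bar>a - \<xi>\<bar> \<le> M" "\<bar>b - \<xi>\<bar> \<le> M" "M \<le> 7"
  have "\<bar>c * e a - c * e b\<bar> = \<bar>c\<bar> * \<bar>e a - e b\<bar>"
    by (simp add: abs_mult flip: right_diff_distrib)
  also have "\<dots> \<le> B * (C * M ^ k * \<bar>a - b\<bar>)"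
    using flatD(3)[OF assms(1) *] assms(2) by (intro mult_mono) auto
  finally show "\<bar>c * e a - c * e b\<bar> \<le> B * C * M ^ k * \<bar>a - b\<bar>"
    by (simp add: algebra_simps)
qed (use flatD[OF assms(1)] assms(2) in auto)

lemma flat_sum:
  "finite I \<Longrightarrow> (\<And>i. i \<in> I \<Longrightarrow> flat k \<xi> (C i) (e i)) \<Longrightarrow> flat k \<xi> (\<Sum>i\<in>I. C i) (\<lambda>x. \<Sum>i\<in>I. e i x)"
  by (induction I rule: finite_induct) (simp_all add: flat_zero flat_add)

lemma flat_shift: "flat k 0 C e \<Longrightarrow> flat k \<xi> C (\<lambda>x. e (x - \<xi>))"
proof -
  assume f: "flat k 0 C e"
  have "\<bar>e (a - \<xi>) - e (b - \<xi>)\<bar> \<le> C * M ^ k * \<bar>a - b\<bar>"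
    if "\<bar>a - \<xi>\<bar> \<le> M" "\<bar>b - \<xi>\<bar> \<le> M" "M \<le> 7" for a b M
    using flatD(3)[OF f, of "a - \<xi>" M "b - \<xi>"] that by simp
  then show ?thesis unfolding flat_def using flatD[OF f] by simp
qed

text \<open>The mean value inequality on the interval of radius \<open>M\<close> around
  \<open>\<xi>\<close>, where the derivative is at most \<open>C * M ^ k\<close>.\<close>

lemma flat_if_deriv_bound:
  assumes d: "\<And>x. (e has_real_derivative e' x) (at x)" and "e \<xi> = 0" "0 \<le> C"
    and b: "\<And>x. \<bar>x - \<xi>\<bar> \<le> 7 \<Longrightarrow> \<bar>e' x\<bar> \<le> C * \<bar>x - \<xi>\<bar> ^ k"
  shows "flat k \<xi> C e"
  unfolding flat_def
proof (intro conjI allI impI)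
  fix a b' M :: real assume *: "\<bar>a - \<xi>\<bar> \<le> M" "\<bar>b' - \<xi>\<bar> \<le> M" "M \<le> 7"
  have "norm (e a - e b') \<le> C * M ^ k * norm (a - b')"
  proof (rule field_differentiable_bound[of "{\<xi> - M..\<xi> + M}" e e'])
    show "(e has_field_derivative e' z) (at z within {\<xi> - M..\<xi> + M})" for z
      using d has_field_derivative_at_within by blast
    show "norm (e' z) \<le> C * M ^ k" if "z \<in> {\<xi> - M..\<xi> + M}" for z
    proof -
      have z: "\<bar>z - \<xi>\<bar> \<le> M" using that by auto
      have "\<bar>e' z\<bar> \<le> C * \<bar>z - \<xi>\<bar> ^ k" using b z * by simp
      also have "\<dots> \<le> C * M ^ k" using z \<open>0 \<le> C\<close> by (intro mult_left_mono power_mono) auto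
      finally show ?thesis by simp
    qed
  qed (use * in \<open>auto simp: abs_le_iff\<close>)
  then show "\<bar>e a - e b'\<bar> \<le> C * M ^ k * \<bar>a - b'\<bar>" by simp
qed (use assms in auto)

lemma flat_sin_power: "flat k \<xi> (real (Suc k)) (\<lambda>x. sin ((x - \<xi>)/2) ^ Suc k)"
proof (rule flat_if_deriv_bound)
  show "((\<lambda>x. sin ((x - \<xi>)/2) ^ Suc k) has_real_derivative
     real (Suc k) * (cos ((x - \<xi>)/2) / 2 * sin ((x - \<xi>)/2) ^ k)) (at x)" for x
    by (auto intro!: derivative_eq_intros simp del: power_Suc)
  show "\<bar>real (Suc k) * (cos ((x - \<xi>)/2) / 2 * sin ((x - \<xi>)/2) ^ k)\<bar> \<le> real (Suc k) * \<bar>x - \<xi>\<bar> ^ k" for x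
  proof -
    have "\<bar>sin ((x - \<xi>)/2)\<bar> \<le> \<bar>x - \<xi>\<bar>" using abs_sin_x_le_abs_x[of "(x - \<xi>)/2"] by simp
    then have "\<bar>sin ((x - \<xi>)/2)\<bar> ^ k \<le> \<bar>x - \<xi>\<bar> ^ k" by (intro power_mono) auto
    moreover have "\<bar>cos ((x - \<xi>)/2) / 2\<bar> \<le> 1" using abs_cos_le_one[of "(x - \<xi>)/2"] by (simp del: abs_cos_le_one)
    ultimately have "\<bar>cos ((x - \<xi>)/2) / 2\<bar> * \<bar>sin ((x - \<xi>)/2)\<bar> ^ k \<le> 1 * \<bar>x - \<xi>\<bar> ^ k"
      by (intro mult_mono) auto
    then show ?thesis unfolding abs_mult power_abs by (intro mult_mono) auto
  qed
qed auto

text \<open>The functions by which \<open>flat\<close> can be multiplied at the cost of a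
  constant.\<close>

definition lip7 :: "real \<Rightarrow> real \<Rightarrow> (real \<Rightarrow> real) \<Rightarrow> bool" where
  "lip7 \<xi> U u \<longleftrightarrow> 0 \<le> U \<and> (\<forall>a b. \<bar>a - \<xi>\<bar> \<le> 7 \<longrightarrow> \<bar>b - \<xi>\<bar> \<le> 7 \<longrightarrow> \<bar>u a\<bar> \<le> U \<and> \<bar>u a - u b\<bar> \<le> U * \<bar>a - b\<bar>)"

lemma abs_mult_diff_le:
  fixes a b c d :: real
  assumes "\<bar>a - b\<bar> \<le> X" "\<bar>c\<bar> \<le> U" "\<bar>b\<bar> \<le> Z" "\<bar>c - d\<bar> \<le> W"
  shows "\<bar>a * c - b * d\<bar> \<le> X * U + Z * W"
proof -
  have "\<bar>a * c - b * d\<bar> = \<bar>(a - b) * c + b * (c - d)\<bar>" by (simp add: algebra_simps)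
  also have "\<dots> \<le> \<bar>a - b\<bar> * \<bar>c\<bar> + \<bar>b\<bar> * \<bar>c - d\<bar>" by (metis abs_mult abs_triangle_ineq)
  also have "\<dots> \<le> X * U + Z * W" using assms by (intro add_mono mult_mono) auto
  finally show ?thesis .
qed

text \<open>The constant is \<open>8 = 1 + 7\<close>: the increment of \<open>u\<close> is
  multiplied by \<open>\<bar>e b\<bar> \<le> C * M ^ Suc k\<close>, where one factor
  \<open>M\<close> is at most 7.\<close>

lemma flat_mult:
  assumes f: "flat k \<xi> C e" and u: "lip7 \<xi> U u"
  shows "flat k \<xi> (8 * C * U) (\<lambda>x. e x * u x)"
  unfolding flat_def
proof (intro conjI allI impI)
  fix a b M :: real assume *: "\<bar>a - \<xi>\<bar> \<le> M" "\<bar>b - \<xi>\<bar> \<le> M" "M \<le> 7"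
  have u': "0 \<le> U" "\<bar>u a\<bar> \<le> U" "\<bar>u a - u b\<bar> \<le> U * \<bar>a - b\<bar>"
    using u * order.trans[OF *(1) *(3)] order.trans[OF *(2) *(3)] unfolding lip7_def by blast+
  have "\<bar>e b\<bar> \<le> C * \<bar>b - \<xi>\<bar> ^ Suc k" by (rule flat_value[OF f]) (use * in auto)
  also have "\<dots> \<le> C * (M ^ k * 7)"
    unfolding power_Suc2 using * flatD(2)[OF f] by (intro mult_left_mono mult_mono power_mono) auto
  finally have eb: "\<bar>e b\<bar> \<le> C * (M ^ k * 7)" .
  have "\<bar>e a * u a - e b * u b\<bar> \<le> (C * M ^ k * \<bar>a - b\<bar>) * U + (C * (M ^ k * 7)) * (U * \<bar>a - b\<bar>)"
    by (rule abs_mult_diff_le) (use flatD(3)[OF f *] u' eb in auto)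
  then show "\<bar>e a * u a - e b * u b\<bar> \<le> 8 * C * U * M ^ k * \<bar>a - b\<bar>"
    by (simp add: algebra_simps)
qed (use flatD[OF f] u in \<open>auto simp: lip7_def\<close>)

lemma htrig_lipschitz:
  "htrig m P \<Longrightarrow> \<exists>U\<ge>0. \<forall>a b. \<bar>P a\<bar> \<le> U \<and> \<bar>P a - P b\<bar> \<le> U * \<bar>a - b\<bar>"
proof (induction m arbitrary: P)
  case 0
  then obtain c where "P = (\<lambda>x. c)" by auto
  then show ?case by (intro exI[of _ "\<bar>c\<bar>"]) auto
next
  case (Suc m)
  obtain A B where AB: "htrig m A" "htrig m B" "P = (\<lambda>x. A x * cos (x/2) + B x * sin (x/2))"
    using Suc.prems by auto
  obtain U where U: "U \<ge> 0" "\<And>a b. \<bar>A a\<bar> \<le> U \<and> \<bar>A a - A b\<bar> \<le> U * \<bar>a - b\<bar>"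
    using Suc.IH[OF AB(1)] by auto
  obtain V where V: "V \<ge> 0" "\<And>a b. \<bar>B a\<bar> \<le> V \<and> \<bar>B a - B b\<bar> \<le> V * \<bar>a - b\<bar>"
    using Suc.IH[OF AB(2)] by auto
  have c: "\<bar>cos (a/2) - cos (b/2)\<bar> \<le> 1 * \<bar>a - b\<bar>" for a b :: real
    by (rule lipschitz_if_deriv_bound[of _ "\<lambda>x. - sin (x/2) / 2"])
       (auto intro!: derivative_eq_intros order.trans[OF abs_sin_le_one])
  have s: "\<bar>sin (a/2) - sin (b/2)\<bar> \<le> 1 * \<bar>a - b\<bar>" for a b :: real
    by (rule lipschitz_if_deriv_bound[of _ "\<lambda>x. cos (x/2) / 2"])
       (auto intro!: derivative_eq_intros order.trans[OF abs_cos_le_one])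
  have "\<bar>P a\<bar> \<le> 2 * U + 2 * V" for a
  proof -
    have "\<bar>A a * cos (a/2)\<bar> \<le> U * 1" unfolding abs_mult
      using U by (intro mult_mono) auto
    moreover have "\<bar>B a * sin (a/2)\<bar> \<le> V * 1" unfolding abs_mult
      using V by (intro mult_mono) auto
    ultimately show ?thesis using U(1) V(1) unfolding AB(3) by linarith
  qed
  moreover have "\<bar>P a - P b\<bar> \<le> (2 * U + 2 * V) * \<bar>a - b\<bar>" for a b
  proof -
    have "\<bar>A a * cos (a/2) - A b * cos (b/2)\<bar> \<le> (U * \<bar>a - b\<bar>) * 1 + U * (1 * \<bar>a - b\<bar>)"
      by (rule abs_mult_diff_le) (use U c in auto)
    moreover have "\<bar>B a * sin (a/2) - B b * sin (b/2)\<bar> \<le> (V * \<bar>a - b\<bar>) * 1 + V * (1 * \<bar>a - b\<bar>)"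
      by (rule abs_mult_diff_le) (use V s in auto)
    ultimately show ?thesis unfolding AB(3) distrib_right by linarith
  qed
  ultimately show ?case using U(1) V(1) by (intro exI[of _ "2 * U + 2 * V"]) auto
qed

lemma htrig_lip7: "htrig m P \<Longrightarrow> \<exists>U. \<forall>\<xi>. lip7 \<xi> U P"
  using htrig_lipschitz[of m P] unfolding lip7_def by blast

text \<open>The derivative of the Taylor remainder of \<open>D 0\<close> is the remainder of
  \<open>D 1\<close> of one degree less. Its values, one order better than its flatness index, feed
  \<open>flat_if_deriv_bound\<close>. The base case is the Lipschitz condition itself.\<close>

lemma taylor_flat:
  assumes "\<And>i x. i < k \<Longrightarrow> (D i has_real_derivative D (Suc i) x) (at x)"
    and "\<And>x y. \<bar>D k x - D k y\<bar> \<le> \<bar>x - y\<bar>"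
  shows "flat k \<xi> 1 (\<lambda>x. D 0 x - (\<Sum>i\<le>k. D i \<xi> / fact i * (x - \<xi>) ^ i))"
  using assms
proof (induction k arbitrary: D)
  case 0
  then show ?case by (simp add: flat_def)
next
  case (Suc k)
  define e1 where "e1 = (\<lambda>x. D (Suc 0) x - (\<Sum>i\<le>k. D (Suc i) \<xi> / fact i * (x - \<xi>) ^ i))"
  have "flat k \<xi> 1 (\<lambda>x. (D \<circ> Suc) 0 x - (\<Sum>i\<le>k. (D \<circ> Suc) i \<xi> / fact i * (x - \<xi>) ^ i))"
    by (rule Suc.IH) (use Suc.prems in auto)
  then have f1: "flat k \<xi> 1 e1" by (simp add: e1_def)
  show ?case
  proof (rule flat_if_deriv_bound)
    show "((\<lambda>x. D 0 x - (\<Sum>i\<le>Suc k. D i \<xi> / fact i * (x - \<xi>) ^ i)) has_real_derivative e1 x) (at x)" for x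
    proof -
      have "((\<lambda>x. D 0 x - (D 0 \<xi> + (\<Sum>i\<le>k. D (Suc i) \<xi> / fact (Suc i) * (x - \<xi>) ^ Suc i))) has_real_derivative
         D (Suc 0) x - (0 + (\<Sum>i\<le>k. D (Suc i) \<xi> / fact (Suc i) * (real (Suc i) * (x - \<xi>) ^ i)))) (at x)"
        by (intro DERIV_diff DERIV_add DERIV_sum DERIV_const DERIV_cmult Suc.prems)
           (auto intro!: derivative_eq_intros simp del: power_Suc fact_Suc of_nat_Suc)
      moreover have "D (Suc i) \<xi> / fact (Suc i) * (real (Suc i) * (x - \<xi>) ^ i) = D (Suc i) \<xi> / fact i * (x - \<xi>) ^ i" for i
        by (simp add: fact_Suc del: of_nat_Suc)
      ultimately show ?thesis
        unfolding e1_def by (simp only: sum.atMost_Suc_shift) (simp del: sum.atMost_Suc)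
    qed
    show "\<bar>e1 x\<bar> \<le> 1 * \<bar>x - \<xi>\<bar> ^ Suc k" if "\<bar>x - \<xi>\<bar> \<le> 7" for x
      using flat_value[OF f1 that] by simp
  qed (simp_all add: sum.atMost_Suc_shift del: sum.atMost_Suc)
qed

text \<open>\<open>S\<close> is the primitive of \<open>1 - c (1 - cos x)^(k + 1)\<close>, with \<open>c\<close> making the mean zero.\<close>

lemma trig_identity_approx:
  "\<exists>n S C. htrig (2 * n) S \<and> flat k 0 C (\<lambda>t. t - S t)"
proof -
  define w where "w = (\<lambda>x::real. (2 * sin ((x - 0)/2) ^ 2) ^ Suc k)"
  have "htrig (1 * 2 * Suc k) w" unfolding w_def
    by (intro htrig_power htrig_cmult htrig_sin_shift)
  then have "htrig (2 * Suc k) w" by simp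
  then obtain a0 Q where Q: "trig_poly (Suc k) Q" "\<And>x. (Q has_real_derivative w x - a0) (at x)"
    using trig_poly_antiderivative[OF trig_poly_if_htrig] by blast
  have w0: "0 \<le> w x" for x unfolding w_def by simp
  have Qper: "Q (x + 2 * pi) = Q x" for x using htrig_periodic[OF htrig_if_trig_poly[OF Q(1)]] .
  have a0: "a0 > 0"
  \<comment> \<open>Otherwise \<open>Q\<close> would be nondecreasing and periodic, hence constant
    on a period, although its derivative at \<open>pi\<close> is positive.\<close>
  proof (rule ccontr)
    assume "\<not> a0 > 0"
    then have pos: "0 \<le> w x - a0" for x using w0[of x] by simp
    have mono: "Q x \<le> Q z" if "x \<le> z" for x z
      by (rule DERIV_nonneg_imp_nondecreasing[OF that]) (use Q(2) pos in blast)
    have const: "Q x = Q 0" if "x \<in> {0<..<2*pi}" for x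
    proof -
      have "Q 0 \<le> Q x" "Q x \<le> Q (0 + 2 * pi)" using mono that by auto
      then show ?thesis using Qper[of 0] by linarith
    qed
    have "\<forall>\<^sub>F x in nhds pi. Q x = Q 0"
      by (rule eventually_mono[OF eventually_nhds_in_open[of "{0<..<2*pi}"]]) (use const in auto)
    then have "((\<lambda>x. Q 0) has_real_derivative w pi - a0) (at pi)"
      using Q(2)[of pi] DERIV_cong_ev[of pi pi Q "\<lambda>x. Q 0"] by blast
    then have "w pi - a0 = 0" using DERIV_const DERIV_unique by blast
    moreover have "w pi > 0" unfolding w_def by simp
    ultimately show False using \<open>\<not> a0 > 0\<close> by simp
  qed
  define S where "S = (\<lambda>x. (1/a0) * (Q 0 - Q x))"
  have "htrig (2 * Suc k) S" unfolding S_def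
    by (intro htrig_cmult htrig_diff htrig_const htrig_if_trig_poly Q)
  moreover have "flat k 0 ((4 ^ Suc k * 7) / a0) (\<lambda>t. t - S t)"
  proof (rule flat_if_deriv_bound)
    show "((\<lambda>t. t - S t) has_real_derivative w t / a0) (at t)" for t
      unfolding S_def using a0 by (auto intro!: derivative_eq_intros Q simp: field_simps)
    show "\<bar>w t / a0\<bar> \<le> 4 ^ Suc k * 7 / a0 * \<bar>t - 0\<bar> ^ k" if "\<bar>t - 0\<bar> \<le> 7" for t
    proof -
      \<comment> \<open>\<open>w\<close> vanishes even to order \<open>2 * k + 2\<close>; the
        surplus factors \<open>\<bar>t\<bar>\<close> are bounded by the radius 7.\<close>
      have "\<bar>sin (t/2)\<bar> \<le> \<bar>t/2\<bar>" by (rule abs_sin_x_le_abs_x)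
      then have "sin (t/2) ^ 2 \<le> (t/2) ^ 2" by (simp only: abs_le_square_iff)
      also have "\<dots> = \<bar>t\<bar> * \<bar>t\<bar> / 4" by (simp add: power2_eq_square)
      also have "\<dots> \<le> 7 * \<bar>t\<bar> / 4" using that by (intro divide_right_mono mult_right_mono) auto
      finally have "2 * sin (t/2) ^ 2 \<le> 4 * \<bar>t\<bar>" by simp
      then have "w t \<le> (4 * \<bar>t\<bar>) ^ Suc k" unfolding w_def by (intro power_mono) auto
      also have "\<dots> = 4 ^ Suc k * (\<bar>t\<bar> * \<bar>t\<bar> ^ k)" by (simp add: power_mult_distrib)
      also have "\<dots> \<le> 4 ^ Suc k * (7 * \<bar>t\<bar> ^ k)"
        using that by (intro mult_left_mono mult_right_mono) auto
      finally have "w t / a0 \<le> 4 ^ Suc k * (7 * \<bar>t\<bar> ^ k) / a0" using a0 by (simp add: divide_right_mono)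
      then show ?thesis using w0[of t] a0 by (simp add: mult.assoc)
    qed
  qed (use a0 in \<open>auto simp: S_def\<close>)
  ultimately show ?thesis by blast
qed

text \<open>Induction by \<open>t^(i+1) - S^(i+1) = (t^i - S^i) * t + (t - S) * S^i\<close>, with
  the same \<open>S\<close> for all exponents.\<close>

lemma trig_powers_approx:
  "\<exists>n S C. htrig (2 * n) S \<and> (\<forall>i. flat k 0 (C i) (\<lambda>t. t ^ i - S t ^ i))"
proof -
  obtain n S C where S: "htrig (2 * n) S" "flat k 0 C (\<lambda>t. t - S t)"
    using trig_identity_approx by blast
  have "\<exists>C. flat k 0 C (\<lambda>t. t ^ i - S t ^ i)" for i
  proof (induction i)
    case 0
    then show ?case using flat_zero by auto
  next
    case (Suc i)
    then obtain C' where C': "flat k 0 C' (\<lambda>t. t ^ i - S t ^ i)" by blast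
    obtain U where U: "lip7 0 U (\<lambda>t. S t ^ i)" using htrig_lip7[OF htrig_power[OF S(1)]] by blast
    have "lip7 0 7 (\<lambda>t. t)" unfolding lip7_def by auto
    from flat_add[OF flat_mult[OF C' this] flat_mult[OF S(2) U]]
    have "flat k 0 (8 * C' * 7 + 8 * C * U) (\<lambda>t. (t ^ i - S t ^ i) * t + (t - S t) * S t ^ i)" .
    moreover have "(t ^ i - S t ^ i) * t + (t - S t) * S t ^ i = t ^ Suc i - S t ^ Suc i" for t
      by (simp add: algebra_simps)
    ultimately show ?case by auto
  qed
  then show ?thesis using S(1) by metis
qed

text \<open>In the Taylor polynomial each power of \<open>x - \<xi>\<close> is replaced by the same
  power of \<open>S (x - \<xi>)\<close>. The quantifiers matter: \<open>n\<close> and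
  \<open>C\<close> are uniform in the function and in \<open>\<xi>\<close>.\<close>

lemma trig_taylor:
  fixes k :: nat and B :: real
  assumes "B \<ge> 0"
  shows "\<exists>n C. \<forall>D \<xi>. (\<forall>i<k. \<forall>x. (D i has_real_derivative D (Suc i) x) (at x)) \<longrightarrow>
     (\<forall>x y. \<bar>D k x - D k y\<bar> \<le> \<bar>x - y\<bar>) \<longrightarrow> (\<forall>i\<le>k. \<bar>D i \<xi>\<bar> \<le> B) \<longrightarrow>
     (\<exists>P. htrig (2 * n) P \<and> flat k \<xi> C (\<lambda>x. D 0 x - P x))"
proof -
  obtain n S C where S: "htrig (2 * n) S" "\<And>i. flat k 0 (C i) (\<lambda>t. t ^ i - S t ^ i)"
    using trig_powers_approx by blast
  show ?thesis
  proof (rule exI[of _ "n * k"], rule exI[of _ "1 + (\<Sum>i\<le>k. B * C i)"], intro allI impI)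
    fix D :: "nat \<Rightarrow> real \<Rightarrow> real" and \<xi>
    assume D: "\<forall>i<k. \<forall>x. (D i has_real_derivative D (Suc i) x) (at x)"
      "\<forall>x y. \<bar>D k x - D k y\<bar> \<le> \<bar>x - y\<bar>" "\<forall>i\<le>k. \<bar>D i \<xi>\<bar> \<le> B"
    define P where "P = (\<lambda>x. \<Sum>i\<le>k. (D i \<xi> / fact i) * S (x - \<xi>) ^ i)"
    have "htrig (2 * (n * k)) (\<lambda>x. S (x - \<xi>) ^ i)" if "i \<le> k" for i
    proof -
      have "htrig (2 * n * i) (\<lambda>x. S (x - \<xi>) ^ i)" by (intro htrig_power htrig_shift S)
      then show ?thesis using htrig_mono_even[of "n * i" _ "n * k"] that by (simp add: mult.assoc)
    qed
    then have "htrig (2 * (n * k)) P" unfolding P_def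
      by (intro htrig_sum htrig_cmult) auto
    moreover have "flat k \<xi> (1 + (\<Sum>i\<le>k. B * C i))
      (\<lambda>x. (D 0 x - (\<Sum>i\<le>k. D i \<xi> / fact i * (x - \<xi>) ^ i)) +
        (\<Sum>i\<le>k. (D i \<xi> / fact i) * ((x - \<xi>) ^ i - S (x - \<xi>) ^ i)))"
    proof (intro flat_add taylor_flat flat_sum flat_cmult flat_shift[of k _ "\<lambda>t. t ^ _ - S t ^ _"] S)
      show "\<bar>D i \<xi> / fact i\<bar> \<le> B" if "i \<in> {..k}" for i
      proof -
        have "\<bar>D i \<xi>\<bar> / fact i \<le> \<bar>D i \<xi>\<bar> / 1" by (rule divide_left_mono) (auto simp: fact_ge_1)
        then show ?thesis using D(3) that by fastforce
      qed
    qed (use D in auto)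
    moreover have "(D 0 x - (\<Sum>i\<le>k. D i \<xi> / fact i * (x - \<xi>) ^ i)) +
        (\<Sum>i\<le>k. (D i \<xi> / fact i) * ((x - \<xi>) ^ i - S (x - \<xi>) ^ i)) = D 0 x - P x" for x
      unfolding P_def by (simp add: right_diff_distrib sum_subtractf)
    ultimately show "\<exists>P. htrig (2 * (n * k)) P \<and> flat k \<xi> (1 + (\<Sum>i\<le>k. B * C i)) (\<lambda>x. D 0 x - P x)"
      by (simp only:) blast
  qed
qed

section \<open>The zeros of \<open>\<Pi>\<close>\<close>

text \<open>Half the chord of the unit circle over the angle \<open>z\<close>:
  \<open>rho (a - b)\<close> is a periodic distance comparable with the distance modulo
  \<open>2 * pi\<close>.\<close>

definition rho :: "real \<Rightarrow> real" where "rho z = \<bar>sin (z/2)\<bar>"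

lemma rho_nonneg [simp]: "0 \<le> rho z" and rho_le_one [simp]: "rho z \<le> 1" and rho_zero [simp]: "rho 0 = 0"
  and rho_minus [simp]: "rho (- z) = rho z"
  by (simp_all add: rho_def)

lemma rho_commute: "rho (a - b) = rho (b - a)"
  using rho_minus[of "a - b"] by simp

lemma rho_le_abs: "rho z \<le> \<bar>z\<bar> / 2"
  using abs_sin_x_le_abs_x[of "z/2"] by (simp add: rho_def)

lemma rho_add: "rho (a + b) \<le> rho a + rho b"
proof -
  have "rho (a + b) = \<bar>sin (a/2) * cos (b/2) + cos (a/2) * sin (b/2)\<bar>"
    by (simp add: rho_def add_divide_distrib sin_add)
  also have "\<dots> \<le> \<bar>sin (a/2)\<bar> * \<bar>cos (b/2)\<bar> + \<bar>cos (a/2)\<bar> * \<bar>sin (b/2)\<bar>"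
    by (metis abs_mult abs_triangle_ineq)
  also have "\<dots> \<le> \<bar>sin (a/2)\<bar> * 1 + 1 * \<bar>sin (b/2)\<bar>"
    by (intro add_mono mult_mono) auto
  finally show ?thesis by (simp add: rho_def)
qed

lemma rho_triangle: "rho (a - c) \<le> rho (a - b) + rho (b - c)"
  using rho_add[of "a - b" "b - c"] by simp

lemma rho_periodic: "rho (z + 2 * pi) = rho z"
  by (simp add: rho_def add_divide_distrib)

lemma rho_periodic_int: "rho (z + 2 * pi * of_int k) = rho z" "rho (z - 2 * pi * of_int k) = rho z"
  using periodic_int[of rho, OF rho_periodic, of z k] periodic_int[of rho, OF rho_periodic, of z "- k"]
  by (auto simp del: of_int_minus simp add: of_int_minus)

text \<open>Jordan's inequality with \<open>1/3\<close> in place of \<open>2/pi\<close>. Up to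
  \<open>pi/3\<close> the cosine exceeds \<open>1/3\<close>; beyond,
  \<open>sin x \<ge> sqrt 3 / 2\<close> already suffices.\<close>

lemma sin_ge_third:
  assumes "0 \<le> x" "x \<le> pi/2"
  shows "x / 3 \<le> sin x"
proof (cases "x \<le> pi/3")
  case True
  have "sin 0 - 0/3 \<le> sin x - x/3"
  proof (rule DERIV_nonneg_imp_nondecreasing[OF assms(1)])
    fix t assume t: "0 \<le> t" "t \<le> x"
    have "cos (pi/3) \<le> cos t" by (rule cos_monotone_0_pi_le) (use t True in auto)
    then show "\<exists>d. ((\<lambda>t. sin t - t/3) has_real_derivative d) (at t) \<and> 0 \<le> d"
      by (intro exI[of _ "cos t - 1/3"]) (auto intro!: derivative_eq_intros simp: cos_60)
  qed
  then show ?thesis by simp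
next
  case False
  have "sin (pi/3) \<le> sin x" by (rule sin_monotone_2pi_le) (use False assms in auto)
  moreover have "sin (pi/3) \<ge> 4/6"
  proof -
    have "sqrt ((4/3)^2) \<le> sqrt 3" by (rule real_sqrt_le_mono) (simp add: power2_eq_square)
    then show ?thesis by (simp add: sin_60)
  qed
  moreover have "x / 3 \<le> 4/6" using assms pi_less_4 by simp
  ultimately show ?thesis by linarith
qed

lemma abs_le_rho: assumes "\<bar>z\<bar> \<le> pi" shows "\<bar>z\<bar> \<le> 6 * rho z"
proof -
  have "\<bar>z\<bar>/2/3 \<le> sin (\<bar>z\<bar>/2)" by (rule sin_ge_third) (use assms in auto)
  also have "\<dots> \<le> rho z" by (auto simp: rho_def abs_real_def)
  finally show ?thesis by simp
qed

text \<open>Transfers estimates in terms of \<open>\<bar>x - a\<bar>\<close>, valid near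
  \<open>a\<close>, to periodic functions in terms of \<open>rho\<close>.\<close>

lemma near_representative:
  obtains l :: int where "\<bar>x + 2 * pi * of_int l - a\<bar> \<le> pi"
    "\<bar>x + 2 * pi * of_int l - a\<bar> \<le> 6 * rho (x - a)"
proof -
  obtain l :: int where l: "\<bar>x - a - 2 * pi * of_int l\<bar> \<le> pi" by (rule reduce_mod_2pi)
  then have "\<bar>x - a - 2 * pi * of_int l\<bar> \<le> 6 * rho (x - a)"
    using abs_le_rho[OF l] by (simp add: rho_periodic_int)
  with l show ?thesis by (intro that[of "- l"]) (simp_all add: algebra_simps)
qed

lemma abs_sin_half_diff: "\<bar>sin (a/2) - sin (b/2)\<bar> \<le> 1/2 * \<bar>a - b\<bar>" for a b :: real
  by (rule lipschitz_if_deriv_bound[of _ "\<lambda>x. cos (x/2) / 2"])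
     (auto intro!: derivative_eq_intros)

locale knots =
  fixes s :: nat and y :: "nat \<Rightarrow> real"
  assumes s1: "s \<ge> 1" and y_ge: "- pi \<le> y (2 * s)" and y_less: "y 1 < pi"
    and y_decr: "\<And>i. 1 \<le> i \<Longrightarrow> i < 2 * s \<Longrightarrow> y (i + 1) < y i"
begin

abbreviation "J \<equiv> {1..2 * s}"
abbreviation "PY \<equiv> PiY s y"
abbreviation "per \<equiv> {y 1..y 1 + 2 * pi}"

lemma one_in_J: "1 \<in> J" using s1 by auto

lemma y_strict_decr: "1 \<le> i \<Longrightarrow> i < j \<Longrightarrow> j \<le> 2 * s \<Longrightarrow> y j < y i"
proof (induction j)
  case (Suc j)
  show ?case
  proof (cases "i = j")
    case True
    then show ?thesis using y_decr[of i] Suc by simp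
  next
    case False
    then show ?thesis using Suc y_decr[of j] by fastforce
  qed
qed simp

lemma y_range: assumes "i \<in> J" shows "- pi \<le> y i" "y i < pi"
proof -
  show "- pi \<le> y i" using y_ge y_strict_decr[of i "2 * s"] assms by (cases "i = 2 * s") auto
  show "y i < pi" using y_less y_strict_decr[of 1 i] assms by (cases "i = 1") auto
qed

lemma y_sin_nonzero: assumes "i \<in> J" "j \<in> J" "i \<noteq> j" shows "sin ((y i - y j)/2) \<noteq> 0"
proof -
  have "y i \<noteq> y j" using y_strict_decr[of i j] y_strict_decr[of j i] assms
    by (cases "i < j") auto
  moreover have "\<bar>y i - y j\<bar> < 2 * pi" using y_range[OF assms(1)] y_range[OF assms(2)] by auto
  ultimately have "(y i - y j)/2 \<noteq> 0" "\<bar>(y i - y j)/2\<bar> < pi" by auto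
  moreover have "sin u \<noteq> 0" if "u \<noteq> 0" "\<bar>u\<bar> < pi" for u
    using that sin_gt_zero[of u] sin_gt_zero[of "- u"] by (cases "u > 0") auto
  ultimately show ?thesis by blast
qed

lemma PY_htrig: "htrig (2 * s) PY"
  unfolding PiY_def using htrig_prod[of J "\<lambda>i x. sin ((x - y i)/2)"] htrig_sin_shift by simp

lemma PY_periodic: "PY (x + 2 * pi) = PY x"
  by (rule htrig_periodic[OF PY_htrig])

lemma PY_le_one: "\<bar>PY x\<bar> \<le> 1"
  unfolding PiY_def abs_prod by (rule prod_le_1) auto

text \<open>Each of the \<open>2 * s\<close> factors is bounded by 1 and has Lipschitz constant
  \<open>1/2\<close>.\<close>

lemma PY_lipschitz: "\<bar>PY a - PY b\<bar> \<le> real s * \<bar>a - b\<bar>"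
proof -
  have "norm (PY a - PY b) \<le> (\<Sum>i\<in>J. norm (sin ((a - y i)/2) - sin ((b - y i)/2)))"
    unfolding PiY_def by (rule norm_prod_diff) auto
  also have "\<dots> \<le> (\<Sum>i\<in>J. 1/2 * \<bar>a - b\<bar>)"
  proof (rule sum_mono)
    fix i
    show "norm (sin ((a - y i)/2) - sin ((b - y i)/2)) \<le> 1/2 * \<bar>a - b\<bar>"
      using abs_sin_half_diff[of "a - y i" "b - y i"] by simp
  qed
  also have "\<dots> = real s * \<bar>a - b\<bar>" by simp
  finally show ?thesis by simp
qed

lemma PY_lipschitz_rho: "\<bar>PY a - PY b\<bar> \<le> 6 * real s * rho (a - b)"
proof -
  obtain l :: int where l: "\<bar>a + 2 * pi * of_int l - b\<bar> \<le> 6 * rho (a - b)"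
    by (rule near_representative)
  have "\<bar>PY a - PY b\<bar> \<le> real s * \<bar>a + 2 * pi * of_int l - b\<bar>"
    using PY_lipschitz[of "a + 2 * pi * of_int l" b] by (simp only: periodic_int[of PY, OF PY_periodic])
  also have "\<dots> \<le> real s * (6 * rho (a - b))" by (rule mult_left_mono[OF l]) simp
  finally show ?thesis by (simp add: mult_ac)
qed

lemma PY_zero: "i \<in> J \<Longrightarrow> PY (y i) = 0"
  unfolding PiY_def by (rule prod_zero) (auto intro: bexI[of _ i])

text \<open>The zeros are simple and separated: all factors but the one of the nearest zero stay
  above a constant \<open>d\<close>, so \<open>\<bar>PY z\<bar>\<close> dominates the distance to
  that zero.\<close>

lemma PY_near_zero:
  "\<exists>A\<ge>1. \<forall>z. \<exists>i\<in>J. \<exists>l::int. \<bar>z - y i - 2 * pi * of_int l\<bar> \<le> pi \<and>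
      \<bar>z - y i - 2 * pi * of_int l\<bar> \<le> A * \<bar>PY z\<bar>"
proof -
  \<comment> \<open>The element 2 forces \<open>d \<le> 1\<close> and makes \<open>Min R\<close>
    meaningful without further argument.\<close>
  define R where "R = insert 2 ((\<lambda>(i, j). rho (y i - y j)) ` (J \<times> J \<inter> {(i, j). i \<noteq> j}))"
  have fin: "finite R" unfolding R_def by simp
  have Rne: "R \<noteq> {}" by (auto simp: R_def)
  define d where "d = Min R / 2"
  have "r > 0" if "r \<in> R" for r
    using that y_sin_nonzero unfolding R_def rho_def by auto
  then have d0: "d > 0" unfolding d_def using Min_in[OF fin Rne] by simp
  have d1: "d \<le> 1" unfolding d_def using Min_le[OF fin, of 2] by (simp add: R_def)
  have dm: "2 * d \<le> rho (y i - y j)" if "i \<in> J" "j \<in> J" "i \<noteq> j" for i j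
  proof -
    have "rho (y i - y j) \<in> R" unfolding R_def using that by (intro insertI2 image_eqI[of _ _ "(i, j)"]) auto
    then show ?thesis unfolding d_def using Min_le[OF fin] by simp
  qed
  have main: "\<exists>i\<in>J. \<exists>l::int. \<bar>z - y i - 2 * pi * of_int l\<bar> \<le> pi \<and>
      \<bar>z - y i - 2 * pi * of_int l\<bar> \<le> (6 / d ^ (2 * s)) * \<bar>PY z\<bar>" for z
  proof -
    have J: "finite J" "J \<noteq> {}" using one_in_J by auto
    define i where "i = arg_min_on (\<lambda>i. rho (z - y i)) J"
    have i: "i \<in> J" and imin: "\<And>j. j \<in> J \<Longrightarrow> rho (z - y i) \<le> rho (z - y j)"
      unfolding i_def using arg_min_if_finite[OF J, of "\<lambda>i. rho (z - y i)"] by (auto simp: not_less)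
    have far: "d \<le> rho (z - y j)" if "j \<in> J - {i}" for j
    proof -
      have "2 * d \<le> rho (y i - y j)" using dm i that by auto
      also have "\<dots> \<le> rho (y i - z) + rho (z - y j)" by (rule rho_triangle)
      also have "\<dots> \<le> 2 * rho (z - y j)" using imin[of j] that rho_commute[of z "y i"] by simp
      finally show ?thesis by simp
    qed
    have "d ^ (2 * s) \<le> d ^ (2 * s - 1)" using d0 d1 by (intro power_decreasing) auto
    also have "\<dots> = (\<Prod>j\<in>J - {i}. d)" using i by simp
    also have "\<dots> \<le> (\<Prod>j\<in>J - {i}. rho (z - y j))" using far d0 by (intro prod_mono) auto
    finally have p: "d ^ (2 * s) \<le> (\<Prod>j\<in>J - {i}. rho (z - y j))" .
    have "\<bar>PY z\<bar> = (\<Prod>j\<in>J. rho (z - y j))" by (simp add: PiY_def rho_def abs_prod)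
    also have "\<dots> = rho (z - y i) * (\<Prod>j\<in>J - {i}. rho (z - y j))"
      using i by (simp add: prod.remove)
    also have "\<dots> \<ge> rho (z - y i) * d ^ (2 * s)" using p by (intro mult_left_mono) auto
    finally have r: "rho (z - y i) \<le> \<bar>PY z\<bar> / d ^ (2 * s)" using d0 by (simp add: field_simps)
    obtain l :: int where l: "\<bar>z - y i - 2 * pi * of_int l\<bar> \<le> pi" by (rule reduce_mod_2pi)
    have "\<bar>z - y i - 2 * pi * of_int l\<bar> \<le> 6 * rho (z - y i - 2 * pi * of_int l)"
      by (rule abs_le_rho[OF l])
    also have "\<dots> = 6 * rho (z - y i)" by (simp add: rho_periodic_int)
    also have "\<dots> \<le> (6 / d ^ (2 * s)) * \<bar>PY z\<bar>" using r by simp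
    finally show ?thesis using i l by blast
  qed
  have "d ^ (2 * s) \<le> 1" using d0 d1 by (intro power_le_one) auto
  then have "6 / d ^ (2 * s) \<ge> 1" using d0 by (simp add: field_simps)
  then show ?thesis using main by blast
qed

text \<open>\<open>PY\<close> changes sign at its simple zero \<open>y i\<close>, whereas
  \<open>g\<close> would keep its sign nearby if \<open>g (y i)\<close> were nonzero.\<close>

lemma copositive_zero:
  assumes g: "continuous_on UNIV g" "\<And>x. g x * PY x \<ge> 0" and i: "i \<in> J"
  shows "g (y i) = 0"
proof -
  define R where "R = (\<lambda>x. \<Prod>j\<in>J - {i}. sin ((x - y j)/2))"
  have R: "PY x = sin ((x - y i)/2) * R x" for x
    unfolding PiY_def R_def using i by (simp add: prod.remove)
  have Ri: "R (y i) \<noteq> 0" unfolding R_def using i y_sin_nonzero by (auto simp: prod_zero_iff)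
  have key: "\<not> c * (g (y i) * R (y i)) > 0" if "\<bar>c\<bar> = 1" for c
  proof
    assume pos: "c * (g (y i) * R (y i)) > 0"
    have "isCont (\<lambda>x. c * (g x * R x)) (y i)" unfolding R_def
      using g(1) by (auto intro!: continuous_intros simp: continuous_on_eq_continuous_at)
    then have "\<forall>\<^sub>F x in at (y i). c * (g x * R x) > 0"
      using pos by (auto simp: isCont_def dest: order_tendstoD(1))
    then obtain d where d: "d > 0" "\<And>x. x \<noteq> y i \<Longrightarrow> dist x (y i) < d \<Longrightarrow> c * (g x * R x) > 0"
      unfolding eventually_at by auto
    define t where "t = min (d/2) 1"
    have t: "0 < t" "t < d" "t \<le> 1" using d by (auto simp: t_def)
    have st: "sin (t/2) > 0" using t pi_gt3 by (intro sin_gt_zero) auto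
    \<comment> \<open>The side of \<open>y i\<close> on which \<open>g\<close> and \<open>PY\<close>
      then have opposite signs.\<close>
    define x where "x = y i - c * t"
    have "c * c = 1" using that by (metis abs_mult_self_eq mult_1)
    have "sin ((x - y i)/2) = - c * sin (t/2)"
      using that by (auto simp: x_def abs_real_def split: if_splits)
    then have "g x * PY x = - (c * (g x * R x)) * sin (t/2)" unfolding R by simp
    moreover have "c * (g x * R x) > 0"
      by (rule d(2)) (use t that in \<open>auto simp: x_def dist_real_def abs_mult\<close>)
    ultimately have "g x * PY x < 0" using st by (simp add: mult_neg_pos)
    then show False using g(2)[of x] by simp
  qed
  have "g (y i) * R (y i) = 0" using key[of 1] key[of "-1"] by (simp add: not_less)
  then show ?thesis using Ri by simp
qed

end

declare htrig.simps(2) [simp del]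

section \<open>Local copositive approximation\<close>

text \<open>
  A Remez type bound. Induction on the degree: choose \<open>a\<close> in the first third of the interval where
  \<open>\<bar>q\<bar>\<close> is at most three times its mean, split off \<open>q a * cos ((x - a)/2)^N\<close>, divide by \<open>sin ((x - a)/2)\<close>
  and apply the induction hypothesis on the last third.
\<close>

lemma htrig_L1_bound:
  "\<exists>C\<ge>0. \<forall>q \<alpha> l x. htrig N q \<longrightarrow> 0 < l \<longrightarrow> l \<le> 1 \<longrightarrow>
     \<bar>q x\<bar> \<le> C * (1 + rho (x - \<alpha>) / l) ^ N * (integral {\<alpha>..\<alpha> + l} (\<lambda>t. \<bar>q t\<bar>) / l)"
proof (induction N)
  case 0
  show ?case by (intro exI[of _ 1]) auto
next
  case (Suc N)
  obtain C where C: "C \<ge> 0" and IH: "\<And>q \<alpha> l x. htrig N q \<Longrightarrow> 0 < l \<Longrightarrow> l \<le> 1 \<Longrightarrow>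
     \<bar>q x\<bar> \<le> C * (1 + rho (x - \<alpha>) / l) ^ N * (integral {\<alpha>..\<alpha> + l} (\<lambda>t. \<bar>q t\<bar>) / l)"
    using Suc by blast
  have main: "\<bar>q x\<bar> \<le> (3 + 108 * 3 ^ N * C) * (1 + rho (x - \<alpha>) / l) ^ Suc N * (integral {\<alpha>..\<alpha> + l} (\<lambda>t. \<bar>q t\<bar>) / l)"
    if q: "htrig (Suc N) q" and l: "0 < l" "l \<le> 1" for q \<alpha> l x
  proof -
    define A where "A = integral {\<alpha>..\<alpha> + l} (\<lambda>t. \<bar>q t\<bar>) / l"
    define u where "u = rho (x - \<alpha>) / l"
    have u0: "u \<ge> 0" using l by (simp add: u_def)
    have cq: "continuous_on S (\<lambda>t. \<bar>q t\<bar>)" for S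
      using htrig_continuous[OF q] by (intro continuous_intros) auto
    have int: "(\<lambda>t. \<bar>q t\<bar>) integrable_on {a..b}" for a b
      by (rule integrable_continuous_real[OF cq])
    have sub: "integral {a..b} (\<lambda>t. \<bar>q t\<bar>) \<le> A * l" if "\<alpha> \<le> a" "b \<le> \<alpha> + l" for a b
      using integral_subset_le[OF _ int int, of a b \<alpha> "\<alpha> + l"] that l by (simp add: A_def)
    have A0: "A \<ge> 0" unfolding A_def using l by (intro divide_nonneg_pos integral_nonneg int) auto
    obtain a where a: "a \<in> {\<alpha>..\<alpha> + l/3}" "\<And>t. t \<in> {\<alpha>..\<alpha> + l/3} \<Longrightarrow> \<bar>q a\<bar> \<le> \<bar>q t\<bar>"
      using continuous_attains_inf[OF compact_Icc _ cq, of \<alpha> "\<alpha> + l/3"] l by auto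
    have "\<bar>q a\<bar> * (l/3) = integral {\<alpha>..\<alpha> + l/3} (\<lambda>t. \<bar>q a\<bar>)" using l by simp
    also have "\<dots> \<le> integral {\<alpha>..\<alpha> + l/3} (\<lambda>t. \<bar>q t\<bar>)"
      by (rule integral_le) (use a int in auto)
    also have "\<dots> \<le> A * l" using l by (intro sub) auto
    finally have qa: "\<bar>q a\<bar> \<le> 3 * A" using l by (simp add: field_simps)
    obtain c Q where Q: "htrig N Q" and qQ: "q = (\<lambda>x. c * cos ((x - a)/2) ^ Suc N + sin ((x - a)/2) * Q x)"
      using htrig_divide[OF q] by blast
    have "q a = c" by (subst qQ) simp
    then have c: "\<bar>c\<bar> \<le> 3 * A" using qa by simp
    have ccos: "\<bar>c * cos ((t - a)/2) ^ Suc N\<bar> \<le> 3 * A" for t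
    proof -
      have "\<bar>cos ((t - a)/2)\<bar> ^ Suc N \<le> 1" by (intro power_le_one) auto
      then have "\<bar>c\<bar> * \<bar>cos ((t - a)/2)\<bar> ^ Suc N \<le> (3 * A) * 1" using c A0 by (intro mult_mono) auto
      then show ?thesis unfolding abs_mult power_abs by simp
    qed
    \<comment> \<open>The points are at least \<open>l/3\<close> apart and \<open>abs_le_rho\<close>
      loses a factor 6, hence \<open>18\<close>.\<close>
    have Qt: "\<bar>Q t\<bar> \<le> 18 / l * (\<bar>q t\<bar> + 3 * A)" if "t \<in> {\<alpha> + 2/3*l..\<alpha> + l}" for t
    proof -
      have "l/3 \<le> \<bar>t - a\<bar>" using that a(1) by auto
      also have "\<bar>t - a\<bar> \<le> pi" using that a(1) l pi_gt3 by auto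
      then have "\<bar>t - a\<bar> \<le> 6 * rho (t - a)" by (rule abs_le_rho)
      finally have "l/18 \<le> \<bar>sin ((t - a)/2)\<bar>" by (simp add: rho_def)
      then have "l/18 * \<bar>Q t\<bar> \<le> \<bar>sin ((t - a)/2) * Q t\<bar>" unfolding abs_mult by (intro mult_right_mono) auto
      also have "sin ((t - a)/2) * Q t = q t - c * cos ((t - a)/2) ^ Suc N" by (subst qQ) simp
      also have "\<bar>\<dots>\<bar> \<le> \<bar>q t\<bar> + 3 * A" using ccos[of t] by linarith
      finally show ?thesis using l by (simp add: field_simps)
    qed
    have cQ: "(\<lambda>t. \<bar>Q t\<bar>) integrable_on {a..b}" for a b
      using htrig_continuous[OF Q] by (intro integrable_continuous_real continuous_intros) auto
    have "integral {\<alpha> + 2/3*l..\<alpha> + l} (\<lambda>t. \<bar>Q t\<bar>) \<le> integral {\<alpha> + 2/3*l..\<alpha> + l} (\<lambda>t. 18 / l * (\<bar>q t\<bar> + 3 * A))"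
      by (rule integral_le[OF cQ integrable_continuous_real Qt]) (intro continuous_intros cq)
    also have "\<dots> = 18 / l * (integral {\<alpha> + 2/3*l..\<alpha> + l} (\<lambda>t. \<bar>q t\<bar>) + integral {\<alpha> + 2/3*l..\<alpha> + l} (\<lambda>t. 3 * A))"
      by (simp add: integral_add int integrable_const_ivl)
    also have "\<dots> \<le> 18 / l * (A * l + A * l)"
      using sub[of "\<alpha> + 2/3*l" "\<alpha> + l"] l by (intro mult_left_mono add_mono) auto
    also have "\<dots> = 36 * A" using l by simp
    finally have IQ: "integral {\<alpha> + 2/3*l..\<alpha> + l} (\<lambda>t. \<bar>Q t\<bar>) \<le> 36 * A" .
    have "\<bar>Q x\<bar> \<le> C * (1 + rho (x - (\<alpha> + 2/3*l)) / (l/3)) ^ N * (integral {\<alpha> + 2/3*l..\<alpha> + 2/3*l + l/3} (\<lambda>t. \<bar>Q t\<bar>) / (l/3))"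
      by (rule IH[OF Q]) (use l in auto)
    also have "\<alpha> + 2/3*l + l/3 = \<alpha> + l" by simp
    also have "C * (1 + rho (x - (\<alpha> + 2/3*l)) / (l/3)) ^ N * (integral {\<alpha> + 2/3*l..\<alpha> + l} (\<lambda>t. \<bar>Q t\<bar>) / (l/3))
        \<le> C * (3 * (1 + u)) ^ N * (36 * A / (l/3))"
    proof (intro mult_mono power_mono divide_right_mono IQ)
      have "rho (x - (\<alpha> + 2/3*l)) \<le> rho (x - \<alpha>) + rho (\<alpha> - (\<alpha> + 2/3*l))" by (rule rho_triangle)
      also have "rho (\<alpha> - (\<alpha> + 2/3*l)) \<le> l/3" using rho_le_abs[of "\<alpha> - (\<alpha> + 2/3*l)"] l by simp
      finally have "rho (x - (\<alpha> + 2/3*l)) / (l/3) \<le> (u * l + l/3) / (l/3)"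
        using l by (intro divide_right_mono) (auto simp: u_def)
      also have "\<dots> = 3 * u + 1" using l by (simp add: field_simps)
      finally show "1 + rho (x - (\<alpha> + 2/3*l)) / (l/3) \<le> 3 * (1 + u)" by simp
    qed (use l C A0 u0 cQ in \<open>auto intro!: divide_nonneg_pos integral_nonneg mult_nonneg_nonneg add_nonneg_nonneg\<close>)
    finally have "\<bar>Q x\<bar> \<le> C * (3 ^ N * (1 + u) ^ N) * (36 * A / (l/3))"
      unfolding power_mult_distrib .
    then have Qx: "\<bar>Q x\<bar> \<le> 108 * 3 ^ N * C * (1 + u) ^ N * A / l"
      by (simp add: mult_ac)
    \<comment> \<open>The factor \<open>1 / l\<close> in the bound for \<open>Q\<close> is
      compensated by \<open>sin ((x - a)/2)\<close>, which is at most
      \<open>l * (1 + u)\<close>.\<close>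
    have "rho (x - a) \<le> rho (x - \<alpha>) + rho (\<alpha> - a)" by (rule rho_triangle)
    also have "rho (\<alpha> - a) \<le> l" using rho_le_abs[of "\<alpha> - a"] a(1) l by auto
    also have "rho (x - \<alpha>) + l = l * (1 + u)" using l by (simp add: u_def distrib_left)
    finally have rxa: "rho (x - a) \<le> l * (1 + u)" by simp
    have "\<bar>q x\<bar> \<le> 3 * A + \<bar>sin ((x - a)/2)\<bar> * \<bar>Q x\<bar>"
      using ccos[of x] abs_mult[of "sin ((x - a)/2)" "Q x"] unfolding fun_cong[OF qQ, of x] by linarith
    also have "\<bar>sin ((x - a)/2)\<bar> * \<bar>Q x\<bar> \<le> (l * (1 + u)) * (108 * 3 ^ N * C * (1 + u) ^ N * A / l)"
      using rxa Qx u0 l by (intro mult_mono) (auto simp: rho_def)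
    also have "\<dots> = 108 * 3 ^ N * C * (1 + u) ^ Suc N * A" using l by simp
    also have "3 * A \<le> 3 * (1 + u) ^ Suc N * A"
      using u0 A0 one_le_power[of "1 + u" "Suc N"] by (intro mult_right_mono) auto
    finally show ?thesis by (simp add: A_def u_def algebra_simps)
  qed
  have "0 \<le> 3 + 108 * 3 ^ N * C" using C by simp
  then show ?case using main by blast
qed

section \<open>Jackson kernels\<close>

lemma htrig_cos_sin_half_nat: "htrig k (\<lambda>x. cos (real k * (x/2))) \<and> htrig k (\<lambda>x. sin (real k * (x/2)))"
proof (induction k)
  case 0
  then show ?case by auto
next
  case (Suc k)
  note k = Suc[THEN conjunct1] Suc[THEN conjunct2]
  have "htrig (Suc k) (\<lambda>x. cos (real k * (x/2)) * cos (x/2) - sin (real k * (x/2)) * sin (x/2))"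
    "htrig (Suc k) (\<lambda>x. sin (real k * (x/2)) * cos (x/2) + cos (real k * (x/2)) * sin (x/2))"
    by (intro htrig_diff htrig_add htrig_Suc_cos htrig_Suc_sin k)+
  moreover have "real (Suc k) * (x/2) = real k * (x/2) + x/2" for x
    by (simp add: distrib_right)
  ultimately show ?case by (simp only: cos_add sin_add)
qed

text \<open>\<open>u z\<close> is the quotient of \<open>sin ((m + 1) * z/2)\<close> by
  \<open>sin (z/2)\<close>. Building it by the addition theorem shows its degree and avoids the
  removable singularities.\<close>

lemma dirichlet_kernel:
  "\<exists>u. htrig m u \<and> (\<forall>z. u z * sin (z/2) = sin (real (Suc m) * (z/2)) \<and> \<bar>u z\<bar> \<le> real (Suc m)) \<and> u 0 = real (Suc m)"
proof (induction m)
  case 0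
  show ?case by (rule exI[of _ "\<lambda>x. 1"]) auto
next
  case (Suc m)
  then obtain u where u: "htrig m u" "\<And>z. u z * sin (z/2) = sin (real (Suc m) * (z/2))"
    "\<And>z. \<bar>u z\<bar> \<le> real (Suc m)" "u 0 = real (Suc m)" by blast
  define v where "v = (\<lambda>z. u z * cos (z/2) + cos (real (Suc m) * (z/2)))"
  have "htrig (Suc m) v" unfolding v_def
    using htrig_cos_sin_half_nat by (intro htrig_add htrig_Suc_cos u) blast
  moreover have "v z * sin (z/2) = sin (real (Suc (Suc m)) * (z/2))" for z
  proof -
    have e: "real (Suc (Suc m)) * (z/2) = real (Suc m) * (z/2) + z/2" by (simp add: distrib_right)
    have "v z * sin (z/2) = (u z * sin (z/2)) * cos (z/2) + cos (real (Suc m) * (z/2)) * sin (z/2)"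
      unfolding v_def by (simp add: algebra_simps)
    then show ?thesis unfolding e sin_add u(2) .
  qed
  moreover have "\<bar>v z\<bar> \<le> real (Suc (Suc m))" for z
  proof -
    have "\<bar>u z * cos (z/2)\<bar> \<le> real (Suc m) * 1" unfolding abs_mult using u(3) by (intro mult_mono) auto
    moreover have "\<bar>cos (real (Suc m) * (z/2))\<bar> \<le> 1" by (rule abs_cos_le_one)
    ultimately have "\<bar>u z * cos (z/2)\<bar> + \<bar>cos (real (Suc m) * (z/2))\<bar> \<le> real (Suc m) * 1 + 1"
      by (rule add_mono)
    from order.trans[OF abs_triangle_ineq this] show ?thesis unfolding v_def by simp
  qed
  ultimately show ?case using u(4) by (intro exI[of _ v]) (auto simp: v_def)
qed

text \<open>An interface for the power \<open>2 * L\<close> of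
  \<open>sin (m * z/2) / (m * sin (z/2))\<close>. The upper bound localizes at scale
  \<open>1/m\<close>; the lower bound to the right of 0 serves the comparison of masses.\<close>

definition jackson :: "nat \<Rightarrow> nat \<Rightarrow> (real \<Rightarrow> real) \<Rightarrow> bool" where
  "jackson L m F \<longleftrightarrow> htrig (2 * (L * (m - 1))) F \<and> (\<forall>z. 0 \<le> F z) \<and> F 0 = 1 \<and>
     (\<forall>z. F z * (1 + real m * rho z) ^ (2 * L) \<le> 4 ^ L) \<and> (\<forall>z. 0 \<le> z \<longrightarrow> real m * z \<le> 1 \<longrightarrow> (1/9) ^ L \<le> F z)"

lemma jackson_exists:
  assumes "m \<ge> 1"
  shows "\<exists>F. jackson L m F"
proof -
  have Sm: "Suc (m - 1) = m" using assms by simp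
  obtain u where u: "htrig (m - 1) u" "\<And>z. u z * sin (z/2) = sin (real m * (z/2))"
    "\<And>z. \<bar>u z\<bar> \<le> real m" "u 0 = real m" using dirichlet_kernel[of "m - 1"] unfolding Sm by blast
  define F where "F = (\<lambda>z. (1 / real m * u z) ^ (2 * L))"
  have m0: "real m > 0" using assms by simp
  have "htrig ((m - 1) * (2 * L)) F" unfolding F_def by (intro htrig_power htrig_cmult u)
  then have 1: "htrig (2 * (L * (m - 1))) F" by (simp add: mult_ac)
  have 2: "F z * (1 + real m * rho z) ^ (2 * L) \<le> 4 ^ L" for z
  proof -
    have "\<bar>u z * sin (z/2)\<bar> \<le> 1" unfolding u(2) by simp
    then have "\<bar>u z\<bar> * rho z \<le> 1" unfolding abs_mult rho_def .
    then have "real m * (\<bar>u z\<bar> * rho z) \<le> real m * 1" using m0 by (intro mult_left_mono) auto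
    moreover have "\<bar>u z\<bar> * (1 + real m * rho z) = \<bar>u z\<bar> + real m * (\<bar>u z\<bar> * rho z)"
      by (simp add: algebra_simps)
    \<comment> \<open>Adds the two bounds \<open>\<bar>u z\<bar> \<le> m\<close> and
      \<open>\<bar>u z\<bar> * rho z \<le> 1\<close>, one good near 0 and one good away from
      it.\<close>
    ultimately have "\<bar>u z\<bar> * (1 + real m * rho z) \<le> real m * 2" using u(3)[of z] by linarith
    then have "\<bar>1 / real m * u z\<bar> * (1 + real m * rho z) \<le> 2" using m0 by (simp add: abs_mult field_simps)
    then have "(\<bar>1 / real m * u z\<bar> * (1 + real m * rho z)) ^ (2 * L) \<le> 2 ^ (2 * L)" using m0 by (intro power_mono) auto
    then show ?thesis unfolding F_def power_mult_distrib power_even_abs[OF even_mult_iff[THEN iffD2], OF disjI1, OF even_numeral]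
      by (simp add: power_mult)
  qed
  have 3: "(1/9) ^ L \<le> F z" if z: "0 \<le> z" "real m * z \<le> 1" for z
  proof -
    have "1/3 \<le> 1 / real m * u z"
    proof (cases "z = 0")
      case True
      then show ?thesis using u(4) m0 by simp
    next
      case False
      have "z \<le> real m * z" using z assms by (simp add: mult_le_cancel_right1)
      then have z1: "z \<le> 1" using z by linarith
      have s0: "sin (z/2) > 0" using z z1 False pi_gt3 by (intro sin_gt_zero) auto
      have "real m / 3 * sin (z/2) \<le> real m / 3 * (z/2)"
        using z by (intro mult_left_mono sin_x_le_x) auto
      also have "\<dots> = real m * (z/2) / 3" by simp
      also have "\<dots> \<le> sin (real m * (z/2))"
        using z m0 pi_gt3 by (intro sin_ge_third) auto
      also have "\<dots> = u z * sin (z/2)" by (rule u(2)[symmetric])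
      finally have "real m / 3 \<le> u z" using s0 by (simp add: mult_le_cancel_right)
      then show ?thesis using m0 by (simp add: field_simps)
    qed
    then have "(1/3) ^ (2 * L) \<le> F z" unfolding F_def by (intro power_mono) auto
    then show ?thesis by (simp add: power_mult power_divide)
  qed
  have "0 \<le> F z" for z unfolding F_def by (simp add: power_mult)
  moreover have "F 0 = 1" unfolding F_def using u(4) m0 by simp
  ultimately show ?thesis unfolding jackson_def using 1 2 3 by blast
qed

context knots
begin

text \<open>Here \<open>D 0\<close> is \<open>g = f'\<close> and \<open>D i\<close> its derivative
  of order \<open>i\<close>, with \<open>k = r - 2\<close>. For \<open>k = 0\<close> the function is
  merely Lipschitz.\<close>

definition admissible :: "nat \<Rightarrow> real \<Rightarrow> (nat \<Rightarrow> real \<Rightarrow> real) \<Rightarrow> bool" where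
  "admissible k B D \<longleftrightarrow> (\<forall>i<k. \<forall>x. (D i has_real_derivative D (Suc i) x) (at x)) \<and>
     (\<forall>x z. \<bar>D k x - D k z\<bar> \<le> \<bar>x - z\<bar>) \<and> (\<forall>i\<le>k. \<forall>x. \<bar>D i x\<bar> \<le> B) \<and>
     (\<forall>x. D 0 (x + 2 * pi) = D 0 x) \<and> (\<forall>i\<in>J. D 0 (y i) = 0) \<and> (\<forall>x. D 0 x * PY x \<ge> 0)"

text \<open>
  The Taylor approximation is corrected at the zeros of \<open>\<Pi>\<close> by Lagrange terms carrying the factor
  \<open>sin ((x - \<xi>)/2)^(k + 1)\<close>; their coefficients stay bounded because the Taylor error at \<open>y i\<close> is of
  the same order. The result is divisible by \<open>\<Pi>\<close>.
\<close>

lemma local_interpolation: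
  assumes "B \<ge> 0"
  shows "\<exists>n C. 0 \<le> C \<and> (\<forall>D \<xi>. admissible k B D \<longrightarrow> (\<exists>q. htrig (2 * n) q \<and>
     (\<forall>z. \<bar>D 0 z - PY z * q z\<bar> \<le> C * rho (z - \<xi>) ^ Suc k) \<and>
     (\<forall>z. \<bar>D 0 z - PY z * q z\<bar> \<le> C * \<bar>PY z\<bar> * (rho (z - \<xi>) + \<bar>PY z\<bar>) ^ k)))"
proof -
  obtain n0 C0 where T: "\<And>D \<xi>. admissible k B D \<Longrightarrow>
     \<exists>P. htrig (2 * n0) P \<and> flat k \<xi> C0 (\<lambda>x. D 0 x - P x)"
    using trig_taylor[OF assms, of k] unfolding admissible_def by meson
  obtain A where A: "A \<ge> 1" "\<And>z. \<exists>i\<in>J. \<exists>l::int. \<bar>z - y i - 2 * pi * of_int l\<bar> \<le> pi \<and>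
      \<bar>z - y i - 2 * pi * of_int l\<bar> \<le> A * \<bar>PY z\<bar>" using PY_near_zero by blast
  \<comment> \<open>Lagrange functions for the zeros. The cosine is 1 at \<open>y i\<close>, and its
    exponent makes the degree of \<open>S * V i\<close> equal to the even number
    \<open>2 * (Suc k + s)\<close>.\<close>
  define V where "V = (\<lambda>i x. cos ((x - y i)/2) ^ (k + 2) *
     (\<Prod>j\<in>J - {i}. 1 / sin ((y i - y j)/2) * sin ((x - y j)/2)))"
  have V: "htrig (k + 2 + (2 * s - 1)) (V i)" if "i \<in> J" for i
  proof -
    have "htrig (1 * (k + 2)) (\<lambda>x. cos ((x - y i)/2) ^ (k + 2))"
      by (intro htrig_power htrig_cos_shift)
    moreover have "htrig (card (J - {i})) (\<lambda>x. \<Prod>j\<in>J - {i}. 1 / sin ((y i - y j)/2) * sin ((x - y j)/2))"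
      by (intro htrig_prod htrig_cmult htrig_sin_shift) auto
    ultimately have "htrig (1 * (k + 2) + card (J - {i})) (V i)" unfolding V_def by (rule htrig_mult)
    then show ?thesis using that by simp
  qed
  have "\<forall>i\<in>J. \<exists>U. \<forall>\<xi>. lip7 \<xi> U (V i)" using V htrig_lip7 by blast
  then obtain U where U: "\<And>i \<xi>. i \<in> J \<Longrightarrow> lip7 \<xi> (U i) (V i)" by metis
  define C where "C = C0 + (\<Sum>i\<in>J. (C0 * 6 ^ Suc k) * (8 * real (Suc k) * U i))"
  define C' where "C' = max 0 C * 6 ^ Suc k + max 0 C * A * (6 * A) ^ k"
  show ?thesis
  proof (intro exI[of _ "n0 + Suc k"] exI[of _ C'] conjI allI impI)
    show "0 \<le> C'" using A(1) by (simp add: C'_def)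
    fix D \<xi> assume D: "admissible k B D"
    obtain P0 where P0: "htrig (2 * n0) P0" "flat k \<xi> C0 (\<lambda>x. D 0 x - P0 x)" using T[OF D] by blast
    have Dz: "D 0 (y i) = 0" if "i \<in> J" for i using D that by (simp add: admissible_def)
    have Dper: "D 0 (x + 2 * pi) = D 0 x" for x using D by (simp add: admissible_def)
    define S where "S = (\<lambda>x. sin ((x - \<xi>)/2) ^ Suc k)"
    \<comment> \<open>If \<open>S (y i) = 0\<close>, the quotient is 0 by default; this is the right
      value, since \<open>P0y\<close> then gives \<open>P0 (y i) = 0\<close>.\<close>
    define c where "c = (\<lambda>i. P0 (y i) / S (y i))"
    have e0per: "D 0 (x + 2 * pi) - P0 (x + 2 * pi) = D 0 x - P0 x" for x
      using Dper htrig_periodic[OF P0(1)] by simp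
    have P0y: "\<bar>P0 (y i)\<bar> \<le> C0 * 6 ^ Suc k * \<bar>S (y i)\<bar>" if "i \<in> J" for i
    proof -
      obtain l :: int where l: "\<bar>y i + 2 * pi * of_int l - \<xi>\<bar> \<le> pi"
        "\<bar>y i + 2 * pi * of_int l - \<xi>\<bar> \<le> 6 * rho (y i - \<xi>)" by (rule near_representative)
      define x where "x = y i + 2 * pi * of_int l"
      have "D 0 x - P0 x = D 0 (y i) - P0 (y i)"
        unfolding x_def by (rule periodic_int[of "\<lambda>x. D 0 x - P0 x", OF e0per])
      then have "\<bar>P0 (y i)\<bar> = \<bar>D 0 x - P0 x\<bar>" using Dz[OF that] by simp
      also have "\<dots> \<le> C0 * \<bar>x - \<xi>\<bar> ^ Suc k"
        by (rule flat_value[OF P0(2)]) (use l(1) pi_less_4 in \<open>simp add: x_def\<close>)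
      also have "\<dots> \<le> C0 * (6 * rho (y i - \<xi>)) ^ Suc k"
        using l(2) unfolding x_def by (intro mult_left_mono power_mono flatD(2)[OF P0(2)]) auto
      finally show ?thesis
        by (simp add: S_def rho_def power_mult_distrib power_abs mult_ac abs_mult)
    qed
    have c: "\<bar>c i\<bar> \<le> C0 * 6 ^ Suc k" if "i \<in> J" for i
      using P0y[OF that] flatD(2)[OF P0(2)] by (cases "S (y i) = 0") (auto simp: c_def abs_divide field_simps)
    define P where "P = (\<lambda>x. P0 x - (\<Sum>i\<in>J. c i * (S x * V i x)))"
    have eP: "D 0 x - P x = (D 0 x - P0 x) + (\<Sum>i\<in>J. c i * (S x * V i x))" for x
      by (simp add: P_def)
    have flat: "flat k \<xi> C (\<lambda>x. D 0 x - P x)"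
      unfolding eP C_def S_def
      by (intro flat_add flat_sum flat_cmult flat_mult flat_sin_power U P0 c) auto
    have C0: "C \<ge> 0" by (rule flatD(2)[OF flat])
    have htS: "htrig (Suc k) S" unfolding S_def
      using htrig_power[OF htrig_sin_shift, of "Suc k" \<xi>] by (simp del: htrig.simps)
    have "htrig (2 * (Suc k + s)) (\<lambda>x. S x * V i x)" if "i \<in> J" for i
    proof -
      have e: "Suc k + (k + 2 + (2 * s - 1)) = 2 * (Suc k + s)" using s1 by simp
      from htrig_mult[OF htS V[OF that]] show ?thesis unfolding e .
    qed
    then have "htrig (2 * (n0 + Suc k + s)) (\<lambda>x. S x * V i x)" if "i \<in> J" for i
      by (rule htrig_mono_even[of "Suc k + s"]) (use that in auto)
    moreover have "htrig (2 * (n0 + Suc k + s)) P0" using P0(1) by (rule htrig_mono_even) simp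
    ultimately have "htrig (2 * (n0 + Suc k + s)) P" unfolding P_def
      by (intro htrig_diff htrig_sum htrig_cmult)
    then have HP: "htrig (card J + 2 * (n0 + Suc k)) P" by (simp add: algebra_simps)
    have Vij: "V j (y i) = (if i = j then 1 else 0)" if "i \<in> J" "j \<in> J" for i j
    proof (cases "i = j")
      case True
      have "(\<Prod>l\<in>J - {i}. 1 / sin ((y i - y l)/2) * sin ((y i - y l)/2)) = 1"
        using y_sin_nonzero that by (intro prod.neutral) auto
      then show ?thesis using True by (simp add: V_def)
    next
      case False
      have "(\<Prod>l\<in>J - {j}. 1 / sin ((y j - y l)/2) * sin ((y i - y l)/2)) = 0"
        by (rule prod_zero) (use that False in \<open>auto intro!: bexI[of _ i]\<close>)
      then show ?thesis using False by (simp add: V_def)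
    qed
    have Py: "P (y i) = 0" if "i \<in> J" for i
    proof -
      have "(\<Sum>j\<in>J. c j * (S (y i) * V j (y i))) = (\<Sum>j\<in>J. if j = i then c i * S (y i) else 0)"
        by (rule sum.cong) (use Vij that in auto)
      also have "\<dots> = c i * S (y i)" using that by simp
      also have "\<dots> = P0 (y i)" using P0y[OF that] by (auto simp: c_def)
      finally show ?thesis by (simp add: P_def)
    qed
    obtain q where q: "htrig (2 * (n0 + Suc k)) q" "P = (\<lambda>x. (\<Prod>i\<in>J. sin ((x - y i)/2)) * q x)"
      using htrig_divide_zeros[OF _ HP, of y] Py y_sin_nonzero by blast
    have Pq: "P x = PY x * q x" for x unfolding PiY_def by (subst q(2)) simp
    define e where "e = (\<lambda>x. D 0 x - PY x * q x)"
    have fe: "flat k \<xi> C e" using flat unfolding e_def Pq .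
    have eper: "e (x + 2 * pi) = e x" for x
      unfolding e_def using Dper PY_periodic htrig_periodic[OF q(1)] by simp
    have ey: "e (y i + 2 * pi * of_int l) = 0" if "i \<in> J" for i l
      using periodic_int[of e, OF eper] Dz[OF that] PY_zero[OF that] by (simp add: e_def)
    have b1: "\<bar>e z\<bar> \<le> C * 6 ^ Suc k * rho (z - \<xi>) ^ Suc k" for z
    proof -
      obtain l :: int where l: "\<bar>z + 2 * pi * of_int l - \<xi>\<bar> \<le> pi"
        "\<bar>z + 2 * pi * of_int l - \<xi>\<bar> \<le> 6 * rho (z - \<xi>)" by (rule near_representative)
      define x where "x = z + 2 * pi * of_int l"
      have "\<bar>e z\<bar> = \<bar>e x\<bar>" unfolding x_def by (simp only: periodic_int[of e, OF eper])
      also have "\<dots> \<le> C * \<bar>x - \<xi>\<bar> ^ Suc k"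
        by (rule flat_value[OF fe]) (use l(1) pi_less_4 in \<open>simp add: x_def\<close>)
      also have "\<dots> \<le> C * (6 * rho (z - \<xi>)) ^ Suc k"
        using l(2) unfolding x_def by (intro mult_left_mono power_mono C0) auto
      finally show ?thesis unfolding power_mult_distrib by (simp only: mult_ac)
    qed
    \<comment> \<open>The error vanishes at the zero \<open>v\<close> of \<open>PY\<close> nearest
      to \<open>x\<close>. The Lipschitz form of \<open>flat\<close>, applied between
      \<open>x\<close> and \<open>v\<close>, turns the distance to \<open>v\<close> into the factor
      \<open>\<bar>PY z\<bar>\<close>.\<close>
    have b2: "\<bar>e z\<bar> \<le> C * A * (6 * A) ^ k * (\<bar>PY z\<bar> * (rho (z - \<xi>) + \<bar>PY z\<bar>) ^ k)" for z
    proof -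
      obtain l :: int where l: "\<bar>z + 2 * pi * of_int l - \<xi>\<bar> \<le> pi"
        "\<bar>z + 2 * pi * of_int l - \<xi>\<bar> \<le> 6 * rho (z - \<xi>)" by (rule near_representative)
      define x where "x = z + 2 * pi * of_int l"
      have ex: "e z = e x" unfolding x_def by (simp only: periodic_int[of e, OF eper])
      have px: "PY x = PY z" unfolding x_def by (rule periodic_int[of PY, OF PY_periodic])
      obtain i l' where i: "i \<in> J" "\<bar>x - y i - 2 * pi * of_int l'\<bar> \<le> pi"
        "\<bar>x - y i - 2 * pi * of_int l'\<bar> \<le> A * \<bar>PY x\<bar>" using A(2) by blast
      define v where "v = y i + 2 * pi * of_int l'"
      have xv: "\<bar>x - v\<bar> \<le> pi" "\<bar>x - v\<bar> \<le> A * \<bar>PY z\<bar>" using i px by (auto simp: v_def diff_diff_eq)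
      have xxi: "\<bar>x - \<xi>\<bar> \<le> pi" using l(1) by (simp add: x_def)
      have ev: "e v = 0" unfolding v_def by (rule ey[OF i(1)])
      \<comment> \<open>Both distances are at most \<open>pi\<close>, so their sum stays within the
        radius 7.\<close>
      have "pi \<le> 7/2"
        using pi_approx by simp
      then have "\<bar>e x - e v\<bar> \<le> C * (\<bar>x - \<xi>\<bar> + \<bar>x - v\<bar>) ^ k * \<bar>x - v\<bar>"
        using xv xxi by (intro flatD(3)[OF fe]) auto
      also have "\<dots> \<le> C * (6 * A * (rho (z - \<xi>) + \<bar>PY z\<bar>)) ^ k * (A * \<bar>PY z\<bar>)"
      proof (intro mult_mono power_mono xv)
        have "\<bar>x - \<xi>\<bar> \<le> 6 * rho (z - \<xi>)" using l(2) by (simp add: x_def)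
        also have "6 * rho (z - \<xi>) \<le> 6 * A * rho (z - \<xi>)" using A(1) by (simp add: mult_le_cancel_right1 mult_right_mono)
        finally have "\<bar>x - \<xi>\<bar> \<le> 6 * A * rho (z - \<xi>)" .
        moreover have "A * \<bar>PY z\<bar> \<le> 6 * A * \<bar>PY z\<bar>" using A(1) by (intro mult_right_mono) auto
        ultimately show "\<bar>x - \<xi>\<bar> + \<bar>x - v\<bar> \<le> 6 * A * (rho (z - \<xi>) + \<bar>PY z\<bar>)"
          using xv(2) by (simp add: distrib_left)
      qed (use C0 A(1) in \<open>auto intro!: mult_nonneg_nonneg\<close>)
      finally show ?thesis unfolding ex ev power_mult_distrib by (simp only: mult_ac diff_0_right)
    qed
    show "\<exists>q. htrig (2 * (n0 + Suc k)) q \<and>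
     (\<forall>z. \<bar>D 0 z - PY z * q z\<bar> \<le> C' * rho (z - \<xi>) ^ Suc k) \<and>
     (\<forall>z. \<bar>D 0 z - PY z * q z\<bar> \<le> C' * \<bar>PY z\<bar> * (rho (z - \<xi>) + \<bar>PY z\<bar>) ^ k)"
    proof (intro exI[of _ q] conjI allI q)
      fix z
      have "\<bar>e z\<bar> \<le> C * 6 ^ Suc k * rho (z - \<xi>) ^ Suc k" by (rule b1)
      also have "\<dots> \<le> C' * rho (z - \<xi>) ^ Suc k"
        using C0 A(1) unfolding C'_def by (intro mult_right_mono) auto
      finally show "\<bar>D 0 z - PY z * q z\<bar> \<le> \<dots>" by (simp only: e_def)
      have "\<bar>e z\<bar> \<le> C * A * (6 * A) ^ k * (\<bar>PY z\<bar> * (rho (z - \<xi>) + \<bar>PY z\<bar>) ^ k)" by (rule b2)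
      also have "\<dots> \<le> C' * (\<bar>PY z\<bar> * (rho (z - \<xi>) + \<bar>PY z\<bar>) ^ k)"
        using C0 A(1) unfolding C'_def by (intro mult_right_mono) auto
      finally show "\<bar>D 0 z - PY z * q z\<bar> \<le> C' * \<bar>PY z\<bar> * (rho (z - \<xi>) + \<bar>PY z\<bar>) ^ k"
        by (simp only: e_def mult.assoc)
    qed
  qed
qed

end

section \<open>Integrals of the localization weight\<close>

lemma integral_inverse_square_le:
  fixes p :: real
  assumes "p > 0"
  shows "integral {a..b} (\<lambda>z. 1 / (1 + ((z - c)/p)^2)) \<le> 4 * p"
proof (cases "a \<le> b")
  case True
  have "((\<lambda>z. 1 / (1 + ((z - c)/p)^2)) has_integral p * arctan ((b - c)/p) - p * arctan ((a - c)/p)) {a..b}"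
  proof (rule fundamental_theorem_of_calculus[OF True])
    fix x
    have "((\<lambda>z. p * arctan ((z - c)/p)) has_real_derivative 1 / (1 + ((x - c)/p)^2)) (at x within {a..b})"
      using assms by (auto intro!: derivative_eq_intros simp: inverse_eq_divide)
    then show "((\<lambda>z. p * arctan ((z - c)/p)) has_vector_derivative 1 / (1 + ((x - c)/p)^2)) (at x within {a..b})"
      by (simp add: has_real_derivative_iff_has_vector_derivative)
  qed
  then have "integral {a..b} (\<lambda>z. 1 / (1 + ((z - c)/p)^2)) = p * (arctan ((b - c)/p) - arctan ((a - c)/p))"
    by (simp add: integral_unique right_diff_distrib)
  also have "\<dots> \<le> p * 4"
    using assms arctan_bounded[of "(b - c)/p"] arctan_bounded[of "(a - c)/p"] pi_less_4
    by (intro mult_left_mono) linarith+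
  finally show ?thesis by simp
qed (use assms in simp)

lemma rho_continuous [continuous_intros]:
  fixes f :: "real \<Rightarrow> real"
  shows "continuous_on S f \<Longrightarrow> continuous_on S (\<lambda>x. rho (f x))"
  unfolding rho_def by (auto intro!: continuous_on_rabs continuous_on_sin continuous_on_divide)

abbreviation wt :: "nat \<Rightarrow> real \<Rightarrow> real" where
  "wt m z \<equiv> 1 + real m * rho z"

lemma rho_weight_continuous: "continuous_on S (\<lambda>t. 1 / wt m (t - c) ^ 2)"
proof -
  have "1 + real m * rho z \<noteq> 0" for z
    using mult_nonneg_nonneg[OF of_nat_0_le_iff[of m] rho_nonneg[of z]] by linarith
  then show ?thesis by (intro continuous_intros) auto
qed

text \<open>On \<open>\<bar>t - c\<bar> \<le> 2 * pi\<close> the periodic weight is dominated by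
  three translates of an arctangent density of width \<open>p = 6 / m\<close>; each has integral at
  most \<open>4 * p\<close>, so \<open>72 = 3 * 4 * 6\<close>.\<close>

lemma rho_weight_integral:
  assumes m: "m \<ge> 1" and ab: "\<And>t. t \<in> {a..b} \<Longrightarrow> \<bar>t - c\<bar> \<le> 2 * pi"
  shows "integral {a..b} (\<lambda>t. 1 / wt m (t - c) ^ 2) \<le> 72 / real m"
proof -
  define p where "p = 6 / real m"
  have p0: "p > 0" using m by (simp add: p_def)
  define \<tau> where "\<tau> = (\<lambda>z. 1 / (1 + (z/p)^2))"
  have \<tau>0: "\<tau> z \<ge> 0" for z by (simp add: \<tau>_def add_nonneg_nonneg)
  have ct: "continuous_on S (\<lambda>t. \<tau> (t - d))" for S d
  proof -
    have "1 + (z/p)^2 \<noteq> 0" for z by (metis add_pos_nonneg less_irrefl zero_le_power2 zero_less_one)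
    then show ?thesis unfolding \<tau>_def by (intro continuous_intros) (use p0 in auto)
  qed
  have it: "(\<lambda>t. \<tau> (t - d)) integrable_on {a..b}" for d
    by (rule integrable_continuous_real[OF ct])
  have iw: "(\<lambda>t. 1 / wt m (t - c) ^ 2) integrable_on {a..b}"
    by (rule integrable_continuous_real[OF rho_weight_continuous])
  have step: "1 / wt m z ^ 2 \<le> \<tau> z" if "\<bar>z\<bar> \<le> pi" for z
  proof -
    have "\<bar>z\<bar> \<le> 6 * rho z" by (rule abs_le_rho[OF that])
    then have "\<bar>z/p\<bar> \<le> real m * rho z" using m by (simp add: p_def abs_mult field_simps)
    then have "(z/p)^2 \<le> (real m * rho z)^2" by (metis abs_ge_zero power2_abs power_mono)
    also have "1 + \<dots> \<le> wt m z^2" by (simp add: power2_sum)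
    finally have "1 + (z/p)^2 \<le> wt m z^2" by simp
    then show ?thesis unfolding \<tau>_def by (intro divide_left_mono) (auto simp: add_pos_nonneg zero_less_power2 intro!: mult_pos_pos zero_less_power add_pos_nonneg)
  qed
  have "1 / wt m (t - c) ^ 2 \<le> \<tau> (t - c) + (\<tau> (t - (c + 2 * pi)) + \<tau> (t - (c - 2 * pi)))"
    if t: "t \<in> {a..b}" for t
  proof -
    have "\<bar>t - c\<bar> \<le> 2 * pi" by (rule ab[OF t])
    then consider "\<bar>t - c\<bar> \<le> pi" | "\<bar>t - (c + 2 * pi)\<bar> \<le> pi" | "\<bar>t - (c - 2 * pi)\<bar> \<le> pi" by linarith
    then show ?thesis
    proof cases
      case 1
      then show ?thesis using step[of "t - c"] \<tau>0[of "t - (c + 2 * pi)"] \<tau>0[of "t - (c - 2 * pi)"] by linarith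
    next
      case 2
      have "rho (t - (c + 2 * pi)) = rho (t - c)" using rho_periodic[of "t - (c + 2 * pi)"] by simp
      then show ?thesis using step[OF 2] \<tau>0[of "t - c"] \<tau>0[of "t - (c - 2 * pi)"] by simp
    next
      case 3
      have "rho (t - (c - 2 * pi)) = rho (t - c)" using rho_periodic[of "t - c"] by (simp add: algebra_simps)
      then show ?thesis using step[OF 3] \<tau>0[of "t - c"] \<tau>0[of "t - (c + 2 * pi)"] by simp
    qed
  qed
  then have "integral {a..b} (\<lambda>t. 1 / wt m (t - c) ^ 2)
      \<le> integral {a..b} (\<lambda>t. \<tau> (t - c) + (\<tau> (t - (c + 2 * pi)) + \<tau> (t - (c - 2 * pi))))"
    by (intro integral_le iw integrable_add it) auto
  also have "\<dots> = integral {a..b} (\<lambda>t. \<tau> (t - c)) + (integral {a..b} (\<lambda>t. \<tau> (t - (c + 2 * pi))) + integral {a..b} (\<lambda>t. \<tau> (t - (c - 2 * pi))))"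
    by (simp only: integral_add it integrable_add)
  also have "\<dots> \<le> 4 * p + (4 * p + 4 * p)"
    unfolding \<tau>_def by (intro add_mono integral_inverse_square_le p0)
  finally show ?thesis by (simp add: p_def)
qed

context knots
begin

text \<open>The interpolation error is at most \<open>\<bar>PY\<bar> * err\<close> with a half-angle
  form \<open>err\<close>, so adding \<open>err\<close> to the interpolant gives the majorant and at
  most doubles the error bound. In the exponent, \<open>2 * (k + 1)\<close> comes from
  \<open>err\<close> and 1 from the growth of \<open>PY\<close> away from
  \<open>\<xi>\<close>.\<close>

lemma nonneg_majorant:
  assumes "B \<ge> 0"
  shows "\<exists>n C. 0 \<le> C \<and> (\<forall>D \<xi> h. admissible k B D \<longrightarrow> 0 < h \<longrightarrow>
     (\<exists>q. htrig (2 * n) q \<and> (\<forall>z. \<bar>D 0 z\<bar> \<le> \<bar>PY z\<bar> * q z) \<and>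
     (\<forall>z. \<bar>D 0 z - PY z * q z\<bar> \<le> C * h ^ Suc k * (1 + rho (z - \<xi>) / h) ^ (2 * k + 3))))"
proof -
  obtain n0 C0 where C0: "0 \<le> C0" and LI: "\<And>D \<xi>. admissible k B D \<Longrightarrow> \<exists>q. htrig (2 * n0) q \<and>
     (\<forall>z. \<bar>D 0 z - PY z * q z\<bar> \<le> C0 * rho (z - \<xi>) ^ Suc k) \<and>
     (\<forall>z. \<bar>D 0 z - PY z * q z\<bar> \<le> C0 * \<bar>PY z\<bar> * (rho (z - \<xi>) + \<bar>PY z\<bar>) ^ k)"
    using local_interpolation[OF assms, of k] by blast
  define L where "L = 6 * real s"
  have L1: "L \<ge> 1" using s1 by (simp add: L_def)
  define C1 where "C1 = C0 * (2 * L) ^ Suc k"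
  have C1: "0 \<le> C1" using C0 L1 by (simp add: C1_def)
  show ?thesis
  proof (intro exI[of _ "n0 + Suc k"] exI[of _ "2 * L * C1 * 2 ^ Suc k"] conjI allI impI)
    show "0 \<le> 2 * L * C1 * 2 ^ Suc k" using C1 L1 by simp
    fix D \<xi> and h :: real
    assume D: "admissible k B D" and h: "0 < h"
    then have cop: "\<forall>z. 0 \<le> D 0 z * PY z" by (simp add: admissible_def)
    obtain q0 where q0: "htrig (2 * n0) q0"
      "\<And>z. \<bar>D 0 z - PY z * q0 z\<bar> \<le> C0 * rho (z - \<xi>) ^ Suc k"
      "\<And>z. \<bar>D 0 z - PY z * q0 z\<bar> \<le> C0 * \<bar>PY z\<bar> * (rho (z - \<xi>) + \<bar>PY z\<bar>) ^ k"
      using LI[OF D] by blast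
    \<comment> \<open>The size of \<open>PY\<close> near \<open>\<xi>\<close>, with the floor
      \<open>h\<close> for centres close to a zero.\<close>
    define d where "d = max \<bar>PY \<xi>\<bar> h"
    have d0: "d > 0" "h \<le> d" "\<bar>PY \<xi>\<bar> \<le> d" using h by (auto simp: d_def)
    have lip: "\<bar>PY z\<bar> \<le> \<bar>PY \<xi>\<bar> + L * rho (z - \<xi>)" "\<bar>PY \<xi>\<bar> \<le> \<bar>PY z\<bar> + L * rho (z - \<xi>)" for z
      using PY_lipschitz_rho[of z \<xi>] unfolding L_def by linarith+
    \<comment> \<open>The bound involves \<open>h + r\<close> with
      \<open>r = rho (z - \<xi>)\<close>, which is no polynomial. It is replaced by the larger
      \<open>2 * (h^2 + r^2) / h\<close>, where \<open>r^2\<close> is a squared sine.\<close>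
    define err where "err = (\<lambda>z. C1 / d * (2 * ((h^2 + sin ((z - \<xi>)/2)^2) / h)) ^ Suc k)"
    have e0: "\<bar>D 0 z - PY z * q0 z\<bar> * d \<le> C1 * \<bar>PY z\<bar> * (h + rho (z - \<xi>)) ^ Suc k" for z
    proof -
      define r where "r = rho (z - \<xi>)"
      define p where "p = \<bar>PY z\<bar>"
      define E where "E = \<bar>D 0 z - PY z * q0 z\<bar>"
      have r0: "r \<ge> 0" and p0: "p \<ge> 0" and E0: "E \<ge> 0" by (auto simp: r_def p_def E_def)
      have E1: "E \<le> C0 * r ^ Suc k" and E2: "E \<le> C0 * p * (r + p) ^ k"
        using q0(2,3)[of z] by (auto simp: r_def p_def E_def)
      have pL: "p \<le> \<bar>PY \<xi>\<bar> + L * r" "\<bar>PY \<xi>\<bar> \<le> p + L * r"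
        using lip[of z] by (auto simp: r_def p_def)
      have rL: "r \<le> L * r" using L1 r0 by (simp add: mult_le_cancel_right1)
      have hL: "h \<le> L * h" using L1 h by (simp add: mult_le_cancel_right1)
      have G: "r ^ Suc k \<le> (h + r) ^ Suc k" using r0 h by (intro power_mono) auto
      have Ghr: "2 * L * (h + r) = 2 * (L * h) + 2 * (L * r)" by (simp add: algebra_simps)
      have gen: "E * d \<le> C1 * p * (h + r) ^ Suc k" if "r + p \<le> 2 * L * (h + r)" "d \<le> 2 * L * (h + r)"
      proof -
        have "E * d \<le> (C0 * p * (2 * L * (h + r)) ^ k) * (2 * L * (h + r))"
          using E2 E0 d0 that C0 p0 r0 L1 h
          by (intro mult_mono order.trans[OF E2] mult_left_mono power_mono) auto
        also have "\<dots> = C1 * p * (h + r) ^ Suc k"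
          by (simp only: C1_def power_Suc2 power_mult_distrib mult_ac)
        finally show ?thesis .
      qed
      \<comment> \<open>Where \<open>p\<close> is comparable with \<open>d\<close> the first
        interpolation bound suffices. Otherwise \<open>d\<close> and \<open>p\<close> are both
        controlled by \<open>h + r\<close>, and the second bound supplies the factor
        \<open>p\<close>.\<close>
      have "E * d \<le> C1 * p * (h + r) ^ Suc k"
      proof (cases "\<bar>PY \<xi>\<bar> \<ge> h")
        case True
        then have dd: "d = \<bar>PY \<xi>\<bar>" by (simp add: d_def)
        show ?thesis
        proof (cases "p \<ge> d / 2")
          case True
          have "E * d \<le> (C0 * (h + r) ^ Suc k) * (2 * p)"
            using E1 E0 G C0 True d0 h r0 by (intro mult_mono order.trans[OF E1] mult_left_mono) auto
          also have "\<dots> = (C0 * 2) * (p * (h + r) ^ Suc k)" by simp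
          also have "\<dots> \<le> C1 * (p * (h + r) ^ Suc k)"
          proof (intro mult_right_mono)
            have "2 \<le> 2 * L" using L1 by simp
            also have "\<dots> \<le> (2 * L) ^ Suc k" using L1 by (intro self_le_power) auto
            finally show "C0 * 2 \<le> C1" unfolding C1_def using C0 by (rule mult_left_mono)
          qed (use p0 h r0 in auto)
          finally show ?thesis by (simp add: mult.assoc)
        next
          case False
          have "d \<le> 2 * (L * r)" "p \<le> L * r" using False pL dd by linarith+
          then show ?thesis using rL hL h r0 by (intro gen) (unfold Ghr, linarith+)
        qed
      next
        case False
        then have dd: "d = h" "\<bar>PY \<xi>\<bar> < h" by (simp_all add: d_def)
        then show ?thesis using rL hL pL h r0 by (intro gen) (unfold Ghr, linarith+)
      qed
      then show ?thesis by (simp only: E_def p_def r_def)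
    qed
    have sq: "sin ((z - \<xi>)/2)^2 = rho (z - \<xi>)^2" for z by (simp add: rho_def)
    have e1: "\<bar>D 0 z - PY z * q0 z\<bar> \<le> \<bar>PY z\<bar> * err z" for z
    proof -
      define r where "r = rho (z - \<xi>)"
      have r0: "r \<ge> 0" by (simp add: r_def)
      have "(h + r) * h \<le> 2 * (h^2 + r^2)"
        using zero_le_power2[of "h - r"] zero_le_square[of r] zero_le_square[of h]
        unfolding power2_eq_square by (simp only: algebra_simps)
      then have "h + r \<le> 2 * ((h^2 + r^2) / h)" using h by (simp add: field_simps)
      then have "(h + r) ^ Suc k \<le> (2 * ((h^2 + r^2) / h)) ^ Suc k" using h r0 by (intro power_mono) auto
      then have "C1 * \<bar>PY z\<bar> * (h + r) ^ Suc k \<le> C1 * \<bar>PY z\<bar> * (2 * ((h^2 + r^2) / h)) ^ Suc k"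
        using C1 by (intro mult_left_mono) auto
      with e0[of z] have "\<bar>D 0 z - PY z * q0 z\<bar> * d \<le> C1 * \<bar>PY z\<bar> * (2 * ((h^2 + r^2) / h)) ^ Suc k"
        unfolding r_def by (rule order.trans)
      then have "\<bar>D 0 z - PY z * q0 z\<bar> \<le> C1 * \<bar>PY z\<bar> * (2 * ((h^2 + r^2) / h)) ^ Suc k / d"
        by (rule pos_le_divide_eq[OF d0(1), THEN iffD2])
      also have "\<dots> = \<bar>PY z\<bar> * (C1 / d * (2 * ((h^2 + r^2) / h)) ^ Suc k)"
        by (simp only: times_divide_eq_left times_divide_eq_right mult_ac)
      finally show ?thesis unfolding err_def sq r_def .
    qed
    have "htrig (2 * 1) (\<lambda>z. 2 / h * (h^2 + sin ((z - \<xi>)/2)^2))"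
      using htrig_power[OF htrig_sin_shift, of 2 \<xi>] htrig_const[of 1 "h^2"]
      by (intro htrig_cmult htrig_add) simp_all
    from htrig_power[OF this, of "Suc k"] have "htrig (2 * Suc k) err"
      unfolding err_def by (intro htrig_cmult) simp
    then have Herr: "htrig (2 * (n0 + Suc k)) err" by (rule htrig_mono_even) simp
    define q where "q = (\<lambda>z. q0 z + err z)"
    have maj: "\<bar>D 0 z\<bar> \<le> \<bar>PY z\<bar> * q z" for z
    proof (cases "PY z" "0 :: real" rule: linorder_cases)
      case less
      then have "D 0 z \<le> 0" using cop mult_pos_neg[of "D 0 z" "PY z"] by (metis linorder_not_le)
      then show ?thesis using e1[of z] less by (simp add: q_def algebra_simps abs_le_iff)
    next
      case equal
      then show ?thesis using e1[of z] by simp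
    next
      case greater
      then have "D 0 z \<ge> 0" using cop mult_neg_pos[of "D 0 z" "PY z"] by (metis linorder_not_le)
      then show ?thesis using e1[of z] greater by (simp add: q_def algebra_simps abs_le_iff)
    qed
    have bound: "\<bar>D 0 z - PY z * q z\<bar> \<le> 2 * L * C1 * 2 ^ Suc k * h ^ Suc k * (1 + rho (z - \<xi>) / h) ^ (2 * k + 3)" for z
    proof -
      define r where "r = rho (z - \<xi>)"
      define u where "u = r / h"
      have u0: "u \<ge> 0" "r = h * u" using h by (auto simp: u_def r_def)
      have err0: "err z \<ge> 0" unfolding err_def using C1 d0 h by (intro mult_nonneg_nonneg zero_le_power) (auto intro!: add_nonneg_nonneg divide_nonneg_nonneg)
      have "\<bar>D 0 z - PY z * q z\<bar> \<le> \<bar>D 0 z - PY z * q0 z\<bar> + \<bar>PY z * err z\<bar>"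
        unfolding q_def by (simp add: distrib_left)
      also have "\<dots> \<le> 2 * (\<bar>PY z\<bar> * err z)" using e1[of z] err0 by (simp add: abs_mult mult.commute)
      also have "\<dots> \<le> 2 * ((d * (L * (1 + u))) * (C1 / d * (2 * (h * (1 + u)^2)) ^ Suc k))"
      proof (intro mult_left_mono mult_mono)
        have "\<bar>PY z\<bar> \<le> d + L * (h * u)" using lip(1)[of z] d0(3) u0 unfolding r_def by simp
        also have "\<dots> \<le> d * L + d * (L * u)"
        proof (intro add_mono)
          show "d \<le> d * L" using L1 d0 by simp
          show "L * (h * u) \<le> d * (L * u)" using L1 d0 u0 mult_right_mono[of h d "L * u"] by (simp add: mult_ac)
        qed
        finally show "\<bar>PY z\<bar> \<le> d * (L * (1 + u))" by (simp add: algebra_simps)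
        have "(h^2 + r^2) / h = h * (1 + u^2)" using h u0 by (simp add: power2_eq_square field_simps)
        also have "\<dots> \<le> h * (1 + u)^2" using h u0 by (intro mult_left_mono) (auto simp: power2_sum)
        finally show "err z \<le> C1 / d * (2 * (h * (1 + u)^2)) ^ Suc k"
          unfolding err_def sq using C1 d0 h
          by (intro mult_left_mono power_mono) (auto simp: r_def add_nonneg_nonneg)
      qed (use err0 d0 L1 u0 in auto)
      also have "\<dots> = 2 * L * C1 * (1 + u) * (2 * (h * (1 + u)^2)) ^ Suc k"
        using d0 by simp
      also have "\<dots> = 2 * L * C1 * 2 ^ Suc k * h ^ Suc k * ((1 + u) * ((1 + u)^2) ^ Suc k)"
        by (simp only: power_mult_distrib mult_ac)
      also have "(1 + u) * ((1 + u)^2) ^ Suc k = (1 + u) ^ (2 * k + 3)"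
        by (simp only: power_mult[symmetric] power_Suc[symmetric]) (simp add: numeral_3_eq_3)
      finally show ?thesis by (simp only: u_def r_def)
    qed
    show "\<exists>q. htrig (2 * (n0 + Suc k)) q \<and> (\<forall>z. \<bar>D 0 z\<bar> \<le> \<bar>PY z\<bar> * q z) \<and>
     (\<forall>z. \<bar>D 0 z - PY z * q z\<bar> \<le> 2 * L * C1 * 2 ^ Suc k * h ^ Suc k * (1 + rho (z - \<xi>) / h) ^ (2 * k + 3))"
    proof (intro exI[of _ q] conjI allI maj bound)
      have "htrig (2 * (n0 + Suc k)) q0" using q0(1) by (rule htrig_mono_even) simp
      then show "htrig (2 * (n0 + Suc k)) q" unfolding q_def using Herr by (rule htrig_add)
    qed
  qed
qed

end

text \<open>Of the decay of order \<open>2 * L\<close>, a part \<open>e\<close> absorbs polynomial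
  growth and \<open>a\<close> powers remain for summation.\<close>

lemma jackson_decay:
  assumes "jackson L m F" "e + a \<le> 2 * L"
  shows "F z * wt m z ^ e \<le> 4 ^ L / wt m z ^ a"
proof -
  have u: "1 \<le> 1 + real m * rho z" by simp
  have "F z * wt m z ^ e * wt m z ^ a = F z * wt m z ^ (e + a)"
    by (simp add: power_add)
  also have "\<dots> \<le> F z * wt m z ^ (2 * L)"
    using assms u by (intro mult_left_mono power_increasing) (auto simp: jackson_def)
  also have "\<dots> \<le> 4 ^ L" using assms by (auto simp: jackson_def)
  finally show ?thesis
    using u by (subst pos_le_divide_eq[OF zero_less_power]) linarith+
qed

lemma jackson_continuous: "jackson L m F \<Longrightarrow> continuous_on S (\<lambda>z. F (z - c))"
  unfolding jackson_def
  by (intro continuous_on_compose2[OF htrig_continuous[of _ F UNIV]] continuous_intros) auto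

section \<open>Matching the local masses\<close>

context knots
begin

lemma admissible_continuous: "admissible k B D \<Longrightarrow> continuous_on S (D 0)"
proof (cases k)
  case 0
  assume "admissible k B D"
  then have "\<bar>D 0 x - D 0 z\<bar> \<le> \<bar>x - z\<bar>" for x z using 0 by (simp add: admissible_def)
  then have "1-lipschitz_on S (D 0)" by (intro lipschitz_onI) (auto simp: dist_real_def)
  then show ?thesis by (rule lipschitz_on_continuous_on)
next
  case (Suc k')
  assume "admissible k B D"
  then have "(D 0 has_real_derivative D (Suc 0) x) (at x)" for x using Suc by (simp add: admissible_def)
  then show ?thesis by (meson DERIV_isCont continuous_at_imp_continuous_on)
qed

lemma PY_continuous: "continuous_on S PY"
  by (rule htrig_continuous[OF PY_htrig])

text \<open>The half-width of the window is chosen by the Lipschitz constant \<open>s\<close> of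
  \<open>PY\<close>: inside it \<open>PY\<close> keeps its sign and at least half its size. The sign
  condition on \<open>q\<close> has the form that the majorant inequality delivers.\<close>

definition mass_matched :: "nat \<Rightarrow> nat \<Rightarrow> nat \<Rightarrow> real \<Rightarrow> nat \<Rightarrow> (real \<Rightarrow> real) \<Rightarrow> (real \<Rightarrow> real) \<Rightarrow> real \<Rightarrow> (real \<Rightarrow> real) \<Rightarrow> bool" where
  "mass_matched k n R C m F g \<xi> q \<longleftrightarrow> htrig (2 * n) q \<and> (\<forall>z. 0 \<le> \<bar>PY z\<bar> * q z) \<and>
     (\<forall>z. \<bar>g z - PY z * q z\<bar> \<le> C * (1 / real m) ^ Suc k * wt m (z - \<xi>) ^ R) \<and>
     (1 / real m \<le> \<bar>PY \<xi>\<bar> \<longrightarrow>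
       integral {\<xi> - \<bar>PY \<xi>\<bar> / (2 * real s)..\<xi> + \<bar>PY \<xi>\<bar> / (2 * real s)} (\<lambda>z. F (z - \<xi>) * (g z - PY z * q z)) = 0)"

text \<open>
  A majorant \<open>q\<close> of \<open>g / \<Pi>\<close> is multiplied by the ratio of the two masses, which lies in \<open>[0, 1]\<close>;
  \<open>htrig_L1_bound\<close> bounds the change of \<open>\<Pi> q\<close> by a constant times the error already present.
\<close>

lemma mass_matched_exists:
  assumes B: "B \<ge> 0"
  shows "\<exists>n R C. 0 \<le> C \<and> (\<forall>D \<xi> m F. admissible k B D \<longrightarrow> 1 \<le> m \<longrightarrow> jackson (R + 4) m F \<longrightarrow>
     (\<exists>q. mass_matched k n R C m F (D 0) \<xi> q))"
proof -
  obtain n C1 where C1: "0 \<le> C1" and MJ: "\<And>D \<xi> h. admissible k B D \<Longrightarrow> 0 < h \<Longrightarrow>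
     (\<exists>q. htrig (2 * n) q \<and> (\<forall>z. \<bar>D 0 z\<bar> \<le> \<bar>PY z\<bar> * q z) \<and>
     (\<forall>z. \<bar>D 0 z - PY z * q z\<bar> \<le> C1 * h ^ Suc k * (1 + rho (z - \<xi>) / h) ^ (2 * k + 3)))"
    using nonneg_majorant[OF B, of k] by blast
  obtain Cn where Cn: "Cn \<ge> 0" and NB: "\<And>q \<alpha> l x. htrig (2 * n) q \<Longrightarrow> 0 < l \<Longrightarrow> l \<le> 1 \<Longrightarrow>
     \<bar>q x\<bar> \<le> Cn * (1 + rho (x - \<alpha>) / l) ^ (2 * n) * (integral {\<alpha>..\<alpha> + l} (\<lambda>t. \<bar>q t\<bar>) / l)"
    using htrig_L1_bound[of "2 * n"] by blast
  \<comment> \<open>The growth of the original error plus \<open>2 * n + 1\<close>, which is the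
    growth of \<open>q1\<close> by \<open>htrig_L1_bound\<close> and of \<open>PY\<close>.\<close>
  define R where "R = 2 * k + 3 + (2 * n + 1)"
  define L where "L = R + 4"
  \<comment> \<open>In order: growth of \<open>PY\<close>; \<open>htrig_L1_bound\<close> on an
    interval of length \<open>h / (2 * s)\<close>; the lower bounds \<open>9^(-L)\<close> for the
    kernel and \<open>p/2\<close> for \<open>PY\<close>; and the reciprocal of that length.\<close>
  define K where "K = (6 * real s) * Cn * (2 * real s) ^ (2 * n) * 9 ^ L * 2 * (2 * real s)"
  have K0: "K \<ge> 0" using Cn by (simp add: K_def)
  define C where "C = C1 + K * (C1 * 4 ^ L * 72)"
  show ?thesis
  proof (rule exI[of _ n], rule exI[of _ R], rule exI[of _ C], intro conjI allI impI)
    show "0 \<le> C" using K0 C1 by (simp add: C_def)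
    fix D \<xi> F and m :: nat
    assume D: "admissible k B D" and m: "1 \<le> m" and "jackson (R + 4) m F"
      then have F: "jackson L m F" by (simp add: L_def)
    have cop: "0 \<le> D 0 z * PY z" for z using D by (simp add: admissible_def)
    define h where "h = 1 / real m"
    have h: "0 < h" "h \<le> 1" using m by (auto simp: h_def)
    have mh: "r / h = real m * r" for r by (simp add: h_def)
    obtain q1 where q1: "htrig (2 * n) q1" "\<And>z. \<bar>D 0 z\<bar> \<le> \<bar>PY z\<bar> * q1 z"
      "\<And>z. \<bar>D 0 z - PY z * q1 z\<bar> \<le> C1 * h ^ Suc k * wt m (z - \<xi>) ^ (2 * k + 3)"
      using MJ[OF D h(1), of \<xi>] unfolding mh by blast
    have u1: "1 \<le> 1 + real m * rho z" for z by simp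
    have pw: "wt m z ^ e \<le> wt m z ^ R" if "e \<le> R" for e z
      using that u1 by (rule power_increasing)
    have q1b: "\<bar>D 0 z - PY z * q1 z\<bar> \<le> C1 * h ^ Suc k * wt m (z - \<xi>) ^ R" for z
      using C1 h by (intro order.trans[OF q1(3)] mult_left_mono pw) (auto simp: R_def)
    show "\<exists>q. mass_matched k n R C m F (D 0) \<xi> q"
    proof (cases "h \<le> \<bar>PY \<xi>\<bar>")
      case False
      have "C1 * h ^ Suc k * wt m (z - \<xi>) ^ R
        \<le> C * h ^ Suc k * wt m (z - \<xi>) ^ R" for z
        using K0 C1 h unfolding C_def by (intro mult_right_mono) auto
      then show ?thesis unfolding mass_matched_def h_def[symmetric]
        using False q1(1) order.trans[OF q1b] order.trans[OF abs_ge_zero q1(2)] by blast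
    next
      case True
      define p where "p = \<bar>PY \<xi>\<bar>"
      have p: "h \<le> p" "0 < p" "p \<le> 1" using True h PY_le_one[of \<xi>] by (auto simp: p_def)
      define w where "w = p / (2 * real s)"
      have s0: "real s \<ge> 1" using s1 by simp
      have w: "0 < w" "w \<le> 1/2" using p s0 by (auto simp: w_def field_simps)
      define W where "W = {\<xi> - w..\<xi> + w}"
      define \<sigma> where "\<sigma> = sgn (PY \<xi>)"
      have \<sigma>: "\<sigma> * \<sigma> = 1" "\<bar>\<sigma>\<bar> = 1" "\<sigma> * PY \<xi> = p"
        using p by (auto simp: \<sigma>_def p_def sgn_real_def)
      have PW: "p / 2 \<le> \<sigma> * PY z" if "z \<in> W" for z
      proof -
        have "\<bar>PY z - PY \<xi>\<bar> \<le> real s * \<bar>z - \<xi>\<bar>" by (rule PY_lipschitz)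
        also have "\<dots> \<le> real s * w" using that by (intro mult_left_mono) (auto simp: W_def)
        also have "\<dots> = p / 2" using s0 by (simp add: w_def)
        finally have "\<bar>\<sigma> * (PY z - PY \<xi>)\<bar> \<le> p / 2" using \<sigma>(2) by (simp add: abs_mult)
        then have "- (p / 2) \<le> \<sigma> * (PY z - PY \<xi>)" by linarith
        then show ?thesis unfolding right_diff_distrib \<sigma>(3) by simp
      qed
      have aPY: "\<bar>PY z\<bar> = \<sigma> * PY z" if "z \<in> W" for z
      proof -
        have "\<bar>PY z\<bar> = \<bar>\<sigma> * PY z\<bar>" using \<sigma>(2) by (simp add: abs_mult)
        then show ?thesis using PW[OF that] p by simp
      qed
      have D0: "0 \<le> \<sigma> * D 0 z" "\<sigma> * D 0 z \<le> \<sigma> * PY z * q1 z" "0 \<le> q1 z" if "z \<in> W" for z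
      proof -
        have P: "0 < \<sigma> * PY z" using PW[OF that] p by simp
        have "0 \<le> (\<sigma> * \<sigma>) * (D 0 z * PY z)" unfolding \<sigma>(1) using cop by simp
        then have "0 \<le> (\<sigma> * D 0 z) * (\<sigma> * PY z)" by (simp only: mult_ac)
        then show 1: "0 \<le> \<sigma> * D 0 z" using P by (simp add: zero_le_mult_iff)
        then have "\<sigma> * D 0 z = \<bar>D 0 z\<bar>" using \<sigma>(2) abs_mult[of \<sigma> "D 0 z"] by simp
        then show 2: "\<sigma> * D 0 z \<le> \<sigma> * PY z * q1 z" using q1(2)[of z] aPY[OF that] by simp
        then show "0 \<le> q1 z" using 1 P by (metis order.trans zero_le_mult_iff not_less)
      qed
      have cont: "continuous_on S (\<lambda>z. F (z - \<xi>))" "continuous_on S (D 0)" "continuous_on S PY" "continuous_on S q1" for S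
        using jackson_continuous[OF F] admissible_continuous[OF D] PY_continuous htrig_continuous[OF q1(1)] by auto
      have F0: "0 \<le> F z" for z using F by (simp add: jackson_def)
      define M0 where "M0 = integral W (\<lambda>z. F (z - \<xi>) * (\<sigma> * D 0 z))"
      define M1 where "M1 = integral W (\<lambda>z. F (z - \<xi>) * (\<sigma> * PY z * q1 z))"
      have i0: "(\<lambda>z. F (z - \<xi>) * (\<sigma> * D 0 z)) integrable_on W"
        and i1: "(\<lambda>z. F (z - \<xi>) * (\<sigma> * PY z * q1 z)) integrable_on W"
        unfolding W_def by (intro integrable_continuous_real continuous_intros cont)+
      have M0: "0 \<le> M0" unfolding M0_def
        by (rule integral_nonneg[OF i0]) (rule mult_nonneg_nonneg[OF F0 D0(1)])
      have M01: "M0 \<le> M1" unfolding M0_def M1_def using F0 D0 by (intro integral_le i0 i1 mult_left_mono) auto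
      \<comment> \<open>The kernel concentrates an error of size \<open>h ^ Suc k\<close> on scale
        \<open>h\<close>, which yields the additional factor \<open>h\<close>.\<close>
      have Mdiff: "M1 - M0 \<le> C1 * h ^ Suc k * 4 ^ L * (72 * h)"
      proof -
        have "M1 - M0 = integral W (\<lambda>z. F (z - \<xi>) * (\<sigma> * PY z * q1 z) - F (z - \<xi>) * (\<sigma> * D 0 z))"
          unfolding M0_def M1_def by (rule integral_diff[symmetric, OF i1 i0])
        also have "\<dots> \<le> integral W (\<lambda>z. (C1 * h ^ Suc k * 4 ^ L) * (1 / wt m (z - \<xi>) ^ 2))"
        proof (rule integral_le)
          show "(\<lambda>z. F (z - \<xi>) * (\<sigma> * PY z * q1 z) - F (z - \<xi>) * (\<sigma> * D 0 z)) integrable_on W"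
            by (rule integrable_diff[OF i1 i0])
          show "(\<lambda>z. (C1 * h ^ Suc k * 4 ^ L) * (1 / wt m (z - \<xi>) ^ 2)) integrable_on W"
            unfolding W_def by (intro integrable_continuous_real continuous_on_mult_left rho_weight_continuous)
          fix z assume "z \<in> W"
          have "F (z - \<xi>) * (\<sigma> * PY z * q1 z) - F (z - \<xi>) * (\<sigma> * D 0 z) = F (z - \<xi>) * (\<sigma> * (PY z * q1 z - D 0 z))"
            by (simp add: algebra_simps)
          also have "\<dots> \<le> F (z - \<xi>) * \<bar>D 0 z - PY z * q1 z\<bar>"
          proof (rule mult_left_mono[OF _ F0])
            have "\<sigma> * (PY z * q1 z - D 0 z) \<le> \<bar>\<sigma> * (PY z * q1 z - D 0 z)\<bar>" by simp
            then show "\<sigma> * (PY z * q1 z - D 0 z) \<le> \<bar>D 0 z - PY z * q1 z\<bar>"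
              using \<sigma>(2) by (simp only: abs_mult mult_1 abs_minus_commute)
          qed
          also have "\<dots> \<le> F (z - \<xi>) * (C1 * h ^ Suc k * wt m (z - \<xi>) ^ (2 * k + 3))"
            by (rule mult_left_mono[OF q1(3) F0])
          also have "\<dots> = C1 * h ^ Suc k * (F (z - \<xi>) * wt m (z - \<xi>) ^ (2 * k + 3))"
            by (simp only: mult_ac)
          also have "\<dots> \<le> C1 * h ^ Suc k * (4 ^ L / wt m (z - \<xi>) ^ 2)"
            using C1 h by (intro mult_left_mono jackson_decay[OF F]) (auto simp: L_def R_def)
          finally show "F (z - \<xi>) * (\<sigma> * PY z * q1 z) - F (z - \<xi>) * (\<sigma> * D 0 z)
            \<le> (C1 * h ^ Suc k * 4 ^ L) * (1 / wt m (z - \<xi>) ^ 2)" by simp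
        qed
        also have "\<dots> = (C1 * h ^ Suc k * 4 ^ L) * integral W (\<lambda>z. 1 / wt m (z - \<xi>) ^ 2)"
          by (rule integral_mult_right)
        also have "\<dots> \<le> (C1 * h ^ Suc k * 4 ^ L) * (72 / real m)"
          unfolding W_def using C1 h w pi_gt3 by (intro mult_left_mono rho_weight_integral m) auto
        finally show ?thesis by (simp add: h_def)
      qed
      \<comment> \<open>On this short interval kernel and \<open>PY\<close> are bounded below, so
        the mass controls the integral of \<open>\<bar>q1\<bar>\<close>. The divisor puts the
        interval inside the window, as \<open>h \<le> p\<close>.\<close>
      define l where "l = h / (2 * real s)"
      have l: "0 < l" "l \<le> 1" "l \<le> h" "l \<le> w"
        using h p s0 by (auto simp: l_def w_def field_simps intro!: divide_right_mono)
      have iq: "(\<lambda>z. \<bar>q1 z\<bar>) integrable_on {\<xi>..\<xi> + l}"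
        by (intro integrable_continuous_real continuous_intros cont)
      have "(1/9) ^ L * (p/2) * integral {\<xi>..\<xi> + l} (\<lambda>z. \<bar>q1 z\<bar>) = integral {\<xi>..\<xi> + l} (\<lambda>z. (1/9) ^ L * (p/2) * \<bar>q1 z\<bar>)"
        by (rule integral_mult_right[symmetric])
      also have "\<dots> \<le> integral {\<xi>..\<xi> + l} (\<lambda>z. F (z - \<xi>) * (\<sigma> * PY z * q1 z))"
      proof (rule integral_le)
        show "(\<lambda>z. (1/9) ^ L * (p/2) * \<bar>q1 z\<bar>) integrable_on {\<xi>..\<xi> + l}"
          by (intro integrable_continuous_real continuous_intros cont)
        show "(\<lambda>z. F (z - \<xi>) * (\<sigma> * PY z * q1 z)) integrable_on {\<xi>..\<xi> + l}"
          by (intro integrable_continuous_real continuous_intros cont)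
        fix z assume z: "z \<in> {\<xi>..\<xi> + l}"
        then have zW: "z \<in> W" using l w by (auto simp: W_def)
        have "real m * (z - \<xi>) \<le> real m * h" using z l by (intro mult_left_mono) auto
        then have "(1/9) ^ L \<le> F (z - \<xi>)" using F z m by (auto simp: jackson_def h_def)
        then have "(1/9) ^ L * ((p/2) * q1 z) \<le> F (z - \<xi>) * (\<sigma> * PY z * q1 z)"
          using F0 PW[OF zW] D0[OF zW] p by (intro mult_mono mult_right_mono mult_nonneg_nonneg) auto
        then show "(1/9) ^ L * (p/2) * \<bar>q1 z\<bar> \<le> F (z - \<xi>) * (\<sigma> * PY z * q1 z)"
          using D0(3)[OF zW] by (simp add: mult.assoc)
      qed
      also have "\<dots> \<le> M1" unfolding M1_def
      proof (rule integral_subset_le[OF _ _ i1])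
        show "{\<xi>..\<xi> + l} \<subseteq> W" using l w by (auto simp: W_def)
        show "(\<lambda>z. F (z - \<xi>) * (\<sigma> * PY z * q1 z)) integrable_on {\<xi>..\<xi> + l}"
          by (intro integrable_continuous_real continuous_intros cont)
        show "\<forall>z\<in>W. 0 \<le> F (z - \<xi>) * (\<sigma> * PY z * q1 z)"
          using order.trans[OF D0(1,2)] by (intro ballI mult_nonneg_nonneg[OF F0]) blast
      qed
      finally have "(1/9) ^ L * (p/2) * integral {\<xi>..\<xi> + l} (\<lambda>z. \<bar>q1 z\<bar>) \<le> M1" .
      then have IQ: "integral {\<xi>..\<xi> + l} (\<lambda>z. \<bar>q1 z\<bar>) \<le> M1 * 9 ^ L * 2 / p"
        using p by (simp add: power_divide field_simps)
      \<comment> \<open>The factor \<open>p\<close> in the upper bound for \<open>PY\<close> cancels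
        \<open>1 / p\<close> in \<open>IQ\<close>, so \<open>K\<close> does not deteriorate as
        \<open>\<xi>\<close> approaches a zero.\<close>
      have big: "\<bar>PY z * q1 z\<bar> \<le> K * real m * wt m (z - \<xi>) ^ (2 * n + 1) * M1" for z
      proof -
        define u where "u = real m * rho (z - \<xi>)"
        have u0: "0 \<le> u" by (simp add: u_def)
        have "\<bar>PY z\<bar> \<le> p + 6 * real s * rho (z - \<xi>)"
          using PY_lipschitz_rho[of z \<xi>] unfolding p_def by linarith
        moreover have "6 * real s * rho (z - \<xi>) \<le> 6 * real s * (p * u)"
        proof (intro mult_left_mono)
          have "1 * rho (z - \<xi>) \<le> (p * real m) * rho (z - \<xi>)"
            using p(1) m by (intro mult_right_mono) (auto simp: h_def field_simps)
          then show "rho (z - \<xi>) \<le> p * u" by (simp add: u_def mult.assoc)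
        qed auto
        moreover have "p \<le> 6 * real s * p" using p s0 by simp
        ultimately have "\<bar>PY z\<bar> \<le> 6 * real s * p + 6 * real s * (p * u)" by linarith
        then have a: "\<bar>PY z\<bar> \<le> 6 * real s * p * (1 + u)" by (simp add: distrib_left mult.assoc)
        have "rho (z - \<xi>) / l = 2 * real s * u" using s0 by (simp add: l_def u_def h_def)
        then have b: "1 + rho (z - \<xi>) / l \<le> 2 * real s * (1 + u)" using s0 by (simp add: distrib_left)
        have "\<bar>q1 z\<bar> \<le> Cn * (1 + rho (z - \<xi>) / l) ^ (2 * n) * (integral {\<xi>..\<xi> + l} (\<lambda>t. \<bar>q1 t\<bar>) / l)"
          by (rule NB[OF q1(1) l(1,2)])
        also have "\<dots> \<le> Cn * (2 * real s * (1 + u)) ^ (2 * n) * (M1 * 9 ^ L * 2 / p / l)"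
          using Cn b l IQ u0 s0
          by (intro mult_mono power_mono divide_right_mono mult_nonneg_nonneg zero_le_power divide_nonneg_pos integral_nonneg iq)
            (auto intro!: add_nonneg_nonneg divide_nonneg_pos)
        finally have c: "\<bar>q1 z\<bar> \<le> Cn * (2 * real s * (1 + u)) ^ (2 * n) * (M1 * 9 ^ L * 2 / p / l)" .
        have "\<bar>PY z * q1 z\<bar> \<le> (6 * real s * p * (1 + u)) * (Cn * (2 * real s * (1 + u)) ^ (2 * n) * (M1 * 9 ^ L * 2 / p / l))"
          unfolding abs_mult using a c p s0 u0 by (intro mult_mono) auto
        also have "\<dots> = K * real m * ((1 + u) * (1 + u) ^ (2 * n)) * M1"
          unfolding K_def power_mult_distrib[of "2 * real s" "1 + u"] l_def h_def using p s0 m by simp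
        finally show ?thesis by (simp add: u_def)
      qed
      \<comment> \<open>If \<open>M1 = 0\<close>, then also \<open>M0 = 0\<close>, and the default
        \<open>\<theta> = 0\<close> still satisfies \<open>\<theta> * M1 = M0\<close>.\<close>
      define \<theta> where "\<theta> = M0 / M1"
      have \<theta>: "0 \<le> \<theta>" "\<theta> \<le> 1" "\<theta> * M1 = M0"
        using M0 M01 by (auto simp: \<theta>_def divide_le_eq_1)
      show ?thesis unfolding mass_matched_def h_def[symmetric]
      proof (intro exI[of _ "\<lambda>z. \<theta> * q1 z"] conjI allI impI htrig_cmult q1)
        fix z
        have "0 \<le> \<bar>PY z\<bar> * q1 z" using q1(2)[of z] by (rule order.trans[OF abs_ge_zero])
        then have "0 \<le> \<theta> * (\<bar>PY z\<bar> * q1 z)" using \<theta>(1) by (rule mult_nonneg_nonneg[rotated])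
        then show "0 \<le> \<bar>PY z\<bar> * (\<theta> * q1 z)" by (simp only: mult_ac)
        let ?U = "wt m (z - \<xi>) ^ R"
        \<comment> \<open>Here \<open>(1 - \<theta>) * M1 = M1 - M0\<close> is small by
          \<open>Mdiff\<close>, whose extra factor \<open>h\<close> cancels
          \<open>real m\<close>.\<close>
        have "(1 - \<theta>) * \<bar>PY z * q1 z\<bar> \<le> (1 - \<theta>) * (K * real m * wt m (z - \<xi>) ^ (2 * n + 1) * M1)"
          using big \<theta> by (intro mult_left_mono) auto
        also have "\<dots> = K * real m * wt m (z - \<xi>) ^ (2 * n + 1) * (M1 - \<theta> * M1)"
          by (simp add: algebra_simps)
        also have "\<dots> = K * real m * wt m (z - \<xi>) ^ (2 * n + 1) * (M1 - M0)"
          unfolding \<theta>(3) ..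
        also have "\<dots> \<le> K * real m * ?U * (C1 * h ^ Suc k * 4 ^ L * (72 * h))"
          using K0 M01 Mdiff by (intro mult_mono mult_left_mono pw mult_nonneg_nonneg) (auto simp: R_def)
        also have "\<dots> = K * (C1 * 4 ^ L * 72) * h ^ Suc k * ?U" using m by (simp add: h_def)
        finally have 1: "(1 - \<theta>) * \<bar>PY z * q1 z\<bar> \<le> K * (C1 * 4 ^ L * 72) * h ^ Suc k * ?U" .
        have "\<bar>D 0 z - PY z * (\<theta> * q1 z)\<bar> = \<bar>(D 0 z - PY z * q1 z) + (1 - \<theta>) * (PY z * q1 z)\<bar>"
          by (simp add: algebra_simps)
        also have "\<dots> \<le> \<bar>D 0 z - PY z * q1 z\<bar> + (1 - \<theta>) * \<bar>PY z * q1 z\<bar>"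
          using abs_triangle_ineq[of "D 0 z - PY z * q1 z" "(1 - \<theta>) * (PY z * q1 z)"] \<theta>
          by (simp add: abs_mult)
        also have "\<dots> \<le> C1 * h ^ Suc k * ?U + K * (C1 * 4 ^ L * 72) * h ^ Suc k * ?U"
          by (rule add_mono[OF q1b 1])
        finally show "\<bar>D 0 z - PY z * (\<theta> * q1 z)\<bar> \<le> C * h ^ Suc k * ?U"
          unfolding C_def by (simp only: distrib_right)
      next
        have "integral W (\<lambda>z. F (z - \<xi>) * (D 0 z - PY z * (\<theta> * q1 z)))
          = integral W (\<lambda>z. \<sigma> * (F (z - \<xi>) * (\<sigma> * D 0 z) - \<theta> * (F (z - \<xi>) * (\<sigma> * PY z * q1 z))))"
        proof (rule integral_cong)
          fix z
          have "F (z - \<xi>) * (D 0 z - PY z * (\<theta> * q1 z)) = (\<sigma> * \<sigma>) * (F (z - \<xi>) * (D 0 z - PY z * (\<theta> * q1 z)))"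
            unfolding \<sigma>(1) by simp
          then show "F (z - \<xi>) * (D 0 z - PY z * (\<theta> * q1 z)) = \<sigma> * (F (z - \<xi>) * (\<sigma> * D 0 z) - \<theta> * (F (z - \<xi>) * (\<sigma> * PY z * q1 z)))"
            by (simp add: algebra_simps)
        qed
        also have "\<dots> = \<sigma> * (M0 - \<theta> * M1)"
        proof -
          have "(\<lambda>z. \<theta> * (F (z - \<xi>) * (\<sigma> * PY z * q1 z))) integrable_on W"
            unfolding W_def by (intro integrable_continuous_real continuous_intros cont)
          from integral_diff[OF i0 this] show ?thesis
            unfolding M0_def M1_def by (simp only: integral_mult_right)
        qed
        finally show "integral {\<xi> - \<bar>PY \<xi>\<bar> / (2 * real s)..\<xi> + \<bar>PY \<xi>\<bar> / (2 * real s)}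
          (\<lambda>z. F (z - \<xi>) * (D 0 z - PY z * (\<theta> * q1 z))) = 0"
          using \<theta>(3) by (simp add: W_def w_def p_def)
      qed
    qed
  qed
qed

end

section \<open>Gluing the local approximations\<close>

text \<open>Multiplication by \<open>2 * sin (\<theta>/2)\<close>, nonzero as
  \<open>0 < k < N\<close>, makes the sum telescope over a whole number of periods.\<close>

lemma sum_cos_equidistant:
  assumes "1 \<le> k" "k < N"
  shows "(\<Sum>j<N. cos (a - real j * (2 * pi * real k / real N))) = 0"
proof -
  define \<theta> where "\<theta> = 2 * pi * real k / real N"
  define g where "g = (\<lambda>j::nat. sin (a + \<theta>/2 - real j * \<theta>))"
  have "0 < \<theta>/2" "\<theta>/2 < pi" using assms by (auto simp: \<theta>_def field_simps)
  from sin_gt_zero[OF this] have s: "sin (\<theta>/2) \<noteq> 0" by simp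
  have "2 * sin (\<theta>/2) * cos (a - real j * \<theta>) = g j - g (Suc j)" for j
  proof -
    have "g j = sin ((a - real j * \<theta>) + \<theta>/2)" by (simp add: g_def algebra_simps)
    moreover have "a + \<theta>/2 - real (Suc j) * \<theta> = (a - real j * \<theta>) - \<theta>/2" by (simp add: field_simps)
    then have "g (Suc j) = sin ((a - real j * \<theta>) - \<theta>/2)" by (simp only: g_def)
    ultimately show ?thesis by (simp only: sin_add sin_diff) simp
  qed
  then have "2 * sin (\<theta>/2) * (\<Sum>j<N. cos (a - real j * \<theta>)) = (\<Sum>j<N. g j - g (Suc j))"
    by (simp add: sum_distrib_left)
  also have "\<dots> = g 0 - g N" by (rule sum_lessThan_telescope')
  also have "g N = sin ((a + \<theta>/2) + 2 * pi * of_int (- int k))"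
    using assms by (simp add: g_def \<theta>_def)
  also have "\<dots> = g 0" by (subst periodic_int[of sin]) (simp_all add: g_def)
  finally show ?thesis using s by (simp add: \<theta>_def)
qed

text \<open>With more nodes than the order, every nonconstant harmonic averages out. This is the
  source of the partition of unity.\<close>

lemma trig_poly_sum_equidistant:
  assumes "trig_poly n F" "n < N"
  shows "\<exists>\<kappa>. \<forall>x. (\<Sum>j<N. F (x - 2 * pi * real j / real N)) = \<kappa>"
  using assms(1)
proof (induction rule: trig_poly_induct)
  case (const c)
  then show ?case by auto
next
  case (cos k)
  have "(\<Sum>j<N. cos (real k * (x - 2 * pi * real j / real N))) = 0" for x
    using sum_cos_equidistant[of k N "real k * x"] cos assms(2) by (simp add: algebra_simps)
  then show ?case by auto
next
  case (sin k)
  have "sin (real k * (x - 2 * pi * real j / real N)) = cos ((real k * x - pi/2) - real j * (2 * pi * real k / real N))" for x j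
  proof -
    have "(real k * x - pi/2) - real j * (2 * pi * real k / real N) = real k * (x - 2 * pi * real j / real N) - pi/2"
      by (simp add: algebra_simps)
    then show ?thesis by (simp only: cos_diff) simp
  qed
  then have "(\<Sum>j<N. sin (real k * (x - 2 * pi * real j / real N))) = 0" for x
    using sum_cos_equidistant[of k N "real k * x - pi/2"] sin assms(2) by simp
  then show ?case by auto
next
  case (add P Q)
  then show ?case by (auto simp: sum.distrib)
next
  case (cmult P c)
  then show ?case by (auto simp: sum_distrib_left[symmetric])
qed

lemma integral_sum_consecutive:
  fixes f :: "real \<Rightarrow> real"
  assumes "\<And>a b. f integrable_on {a..b}" "\<And>j. t j \<le> t (Suc j)"
  shows "(\<Sum>j<N. integral {t j..t (Suc j)} f) = integral {t 0..t N} f"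
proof (induction N)
  case (Suc N)
  have "t 0 \<le> t N" using assms(2) by (simp add: lift_Suc_mono_le)
  then show ?case using Suc Henstock_Kurzweil_Integration.integral_combine[where a="t 0" and c="t N" and b="t (Suc N)" and f=f] assms by simp
qed simp

text \<open>Comparison with the integral: from a node to the points of its cell the weight drops at
  most by the factor \<open>25\<close>, since \<open>m * d \<le> 7\<close>. With
  \<open>N \<le> (L + 1) * m\<close> and \<open>pi > 3\<close> this gives
  \<open>300 = 25 * 72 / (2 * 3)\<close>.\<close>

lemma rho_weight_sum:
  assumes m: "m \<ge> 1" and L: "L \<ge> 1" and N: "N = L * m + 1"
  shows "(\<Sum>j<N. 1 / (1 + real m * rho (x - (b + 2 * pi * real j / real N))) ^ 2) \<le> 300 * (real L + 1)"
proof -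
  define t where "t = (\<lambda>j. b + 2 * pi * real j / real N)"
  obtain l :: int where l: "\<bar>x - (b + pi) - 2 * pi * of_int l\<bar> \<le> pi" by (rule reduce_mod_2pi)
  define c where "c = x - 2 * pi * of_int l"
  have rc: "rho (x - t') = rho (c - t')" for t'
    using rho_periodic_int(2)[of "x - t'" l] by (simp add: c_def algebra_simps)
  have "N > 0" using N by simp
  then have N0: "real N > 0" by simp
  define d where "d = 2 * pi / real N"
  have d: "0 < d" using N0 by (simp add: d_def)
  have "real m * d \<le> 7"
  proof -
    have "m \<le> L * m" using L by simp
    then have "m \<le> N" unfolding N by linarith
    then have "real m \<le> real N" by simp
    then have "real m * (2 * pi) \<le> real N * (2 * pi)" by (intro mult_right_mono) auto
    also have "\<dots> \<le> real N * 7" using pi_approx by (intro mult_left_mono) auto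
    finally show ?thesis using N0 by (simp add: d_def field_simps)
  qed
  have tS: "t (Suc j) = t j + d" for j using N0 by (simp add: t_def d_def field_simps)
  let ?f = "\<lambda>u. 1 / wt m (u - c) ^ 2"
  have int: "?f integrable_on {u..v}" for u v
    by (rule integrable_continuous_real[OF rho_weight_continuous])
  have cell: "d * (1 / wt m (x - t j) ^ 2) \<le> 25 * integral {t j..t (Suc j)} ?f" for j
  proof -
    define W where "W = 1 + real m * rho (x - t j)"
    have W1: "W \<ge> 1" by (simp add: W_def)
    have "1 / W ^ 2 \<le> 25 * ?f u" if u: "u \<in> {t j..t (Suc j)}" for u
    proof -
      have "rho (u - c) \<le> rho (u - t j) + rho (t j - c)" by (rule rho_triangle)
      also have "rho (u - t j) \<le> d / 2" using rho_le_abs[of "u - t j"] u tS[of j] by auto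
      also have "rho (t j - c) = rho (x - t j)" unfolding rc by (rule rho_commute)
      finally have "real m * rho (u - c) \<le> real m * (d / 2 + rho (x - t j))" by (intro mult_left_mono) auto
      then have "1 + real m * rho (u - c) \<le> 5 * W"
        using \<open>real m * d \<le> 7\<close> mult_nonneg_nonneg[OF of_nat_0_le_iff[of m] rho_nonneg[of "x - t j"]]
        unfolding W_def distrib_left by linarith
      then have "wt m (u - c) ^ 2 \<le> (5 * W) ^ 2" by (intro power_mono) auto
      then have "1 / (5 * W) ^ 2 \<le> ?f u"
        by (intro divide_left_mono mult_pos_pos zero_less_power) (use W1 in \<open>auto intro!: add_pos_nonneg\<close>)
      then show ?thesis by (simp add: power_mult_distrib)
    qed
    then have "integral {t j..t (Suc j)} (\<lambda>u. 1 / W ^ 2) \<le> integral {t j..t (Suc j)} (\<lambda>u. 25 * ?f u)"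
      by (intro integral_le integrable_const_ivl integrable_continuous_real continuous_on_mult_left rho_weight_continuous)
    then show ?thesis using d unfolding W_def integral_mult_right by (simp add: tS)
  qed
  have "d * (\<Sum>j<N. 1 / wt m (x - t j) ^ 2) \<le> (\<Sum>j<N. 25 * integral {t j..t (Suc j)} ?f)"
    unfolding sum_distrib_left by (rule sum_mono) (rule cell)
  also have "\<dots> = 25 * integral {t 0..t N} ?f"
    unfolding sum_distrib_left[symmetric] using d tS by (subst integral_sum_consecutive) (auto intro: int)
  also have "\<dots> \<le> 25 * (72 / real m)"
  proof (intro mult_left_mono rho_weight_integral m)
    fix u assume "u \<in> {t 0..t N}"
    then have "b \<le> u" "u \<le> b + 2 * pi" using N0 by (auto simp: t_def)
    then show "\<bar>u - c\<bar> \<le> 2 * pi" using l unfolding c_def by linarith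
  qed auto
  finally have "d * (\<Sum>j<N. 1 / wt m (x - t j) ^ 2) \<le> 1800 / real m" by simp
  then have "(\<Sum>j<N. 1 / wt m (x - t j) ^ 2) \<le> 1800 / real m / d"
    by (subst pos_le_divide_eq[OF d]) (simp only: mult.commute)
  also have "\<dots> = 1800 * real N / (2 * pi * real m)" by (simp add: d_def)
  also have "\<dots> \<le> 1800 * ((real L + 1) * real m) / (2 * 3 * real m)"
  proof (intro frac_le mult_left_mono mult_right_mono)
    show "real N \<le> (real L + 1) * real m" using m by (simp add: N algebra_simps)
  qed (use m pi_gt3 in auto)
  also have "\<dots> = 300 * (real L + 1)" using m by simp
  finally show ?thesis by (simp add: t_def)
qed

context knots
begin

text \<open>By \<open>PY_near_zero\<close> the weight at a node is at most a multiple of the sum,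
  over all zeros, of the weights in the distance to the zero; each zero is then handled by
  \<open>rho_weight_sum\<close>.\<close>

lemma PY_weight_sum:
  "\<exists>S\<ge>0. \<forall>m L N b. m \<ge> 1 \<longrightarrow> L \<ge> 1 \<longrightarrow> N = L * m + 1 \<longrightarrow>
     (\<Sum>j<N. 1 / (1 + real m * \<bar>PY (b + 2 * pi * real j / real N)\<bar>) ^ 2) \<le> S * (real L + 1)"
proof -
  obtain A where A: "A \<ge> 1" "\<And>z. \<exists>i\<in>J. \<exists>l::int. \<bar>z - y i - 2 * pi * of_int l\<bar> \<le> pi \<and>
      \<bar>z - y i - 2 * pi * of_int l\<bar> \<le> A * \<bar>PY z\<bar>" using PY_near_zero by blast
  have "(\<Sum>j<N. 1 / (1 + real m * \<bar>PY (b + 2 * pi * real j / real N)\<bar>) ^ 2) \<le> A ^ 2 * (real (2 * s) * 300) * (real L + 1)"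
    if m: "m \<ge> 1" and L: "L \<ge> 1" and N: "N = L * m + 1" for m L N b
  proof -
    define t where "t = (\<lambda>j. b + 2 * pi * real j / real N)"
    have "1 / (1 + real m * \<bar>PY z\<bar>) ^ 2 \<le> (\<Sum>i\<in>J. A ^ 2 * (1 / wt m (y i - z) ^ 2))" for z
    proof -
      obtain i l where i: "i \<in> J" "\<bar>z - y i - 2 * pi * of_int l\<bar> \<le> A * \<bar>PY z\<bar>" using A(2) by blast
      have "rho (y i - z) = rho (z - y i - 2 * pi * of_int l)"
        unfolding rho_periodic_int by (rule rho_commute)
      also have "\<dots> \<le> \<bar>z - y i - 2 * pi * of_int l\<bar> / 2" by (rule rho_le_abs)
      also have "\<dots> \<le> \<bar>z - y i - 2 * pi * of_int l\<bar>" by simp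
      also note i(2)
      finally have "rho (y i - z) \<le> A * \<bar>PY z\<bar>" .
      then have "real m * rho (y i - z) \<le> real m * (A * \<bar>PY z\<bar>)" by (intro mult_left_mono) auto
      then have "1 + real m * rho (y i - z) \<le> A * (1 + real m * \<bar>PY z\<bar>)" using A(1) by (simp add: algebra_simps)
      then have "wt m (y i - z) ^ 2 \<le> (A * (1 + real m * \<bar>PY z\<bar>)) ^ 2" by (intro power_mono) auto
      then have "1 / (A * (1 + real m * \<bar>PY z\<bar>)) ^ 2 \<le> 1 / wt m (y i - z) ^ 2"
        by (intro divide_left_mono mult_pos_pos zero_less_power) (use A(1) in \<open>auto intro!: add_pos_nonneg mult_pos_pos\<close>)
      then have "A ^ 2 * (1 / (A * (1 + real m * \<bar>PY z\<bar>)) ^ 2) \<le> A ^ 2 * (1 / wt m (y i - z) ^ 2)"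
        by (intro mult_left_mono) auto
      then have "1 / (1 + real m * \<bar>PY z\<bar>) ^ 2 \<le> A ^ 2 * (1 / wt m (y i - z) ^ 2)"
        using A(1) by (simp add: power_mult_distrib)
      also have "\<dots> \<le> (\<Sum>i\<in>J. A ^ 2 * (1 / wt m (y i - z) ^ 2))"
        by (rule member_le_sum[OF i(1)]) auto
      finally show ?thesis .
    qed
    then have "(\<Sum>j<N. 1 / (1 + real m * \<bar>PY (t j)\<bar>) ^ 2) \<le> (\<Sum>j<N. \<Sum>i\<in>J. A ^ 2 * (1 / wt m (y i - t j) ^ 2))"
      by (rule sum_mono)
    also have "\<dots> = A ^ 2 * (\<Sum>i\<in>J. \<Sum>j<N. 1 / wt m (y i - t j) ^ 2)"
      unfolding sum_distrib_left by (rule sum.swap)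
    also have "\<dots> \<le> A ^ 2 * (\<Sum>i\<in>J. 300 * (real L + 1))"
      unfolding t_def by (intro mult_left_mono sum_mono rho_weight_sum m L N) auto
    finally show ?thesis by (simp add: t_def algebra_simps)
  qed
  moreover have "0 \<le> A ^ 2 * (real (2 * s) * 300)" by simp
  ultimately show ?thesis by blast
qed

text \<open>
  The weights \<open>(1 + m rho (x - c))^(-2)\<close> and \<open>(1 + m \<bar>\<Pi> c\<bar>)^(-2)\<close> are summable over the grid of centres \<open>c\<close>;
  without the vanishing integral over the window the errors of all centres left of \<open>x\<close> would add up.
\<close>

lemma local_error_integral:
  assumes m: "1 \<le> m" and K: "0 \<le> K" and c: "c \<in> per" and x: "x \<in> per"
    and E: "continuous_on UNIV E" "\<And>t. \<bar>E t\<bar> \<le> K / wt m (t - c) ^ 4"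
    and mass: "1 / real m \<le> \<bar>PY c\<bar> \<Longrightarrow> integral {c - \<bar>PY c\<bar> / (2 * real s)..c + \<bar>PY c\<bar> / (2 * real s)} E = 0"
  shows "\<bar>integral {y 1..x} E\<bar> \<le> 31104 * real s ^ 2 * (K / real m) *
     (1 / wt m (x - c) ^ 2 + 1 / (1 + real m * \<bar>PY c\<bar>) ^ 2)"
proof -
  define p where "p = \<bar>PY c\<bar>"
  define w where "w = p / (2 * real s)"
  define e where "e = y 1 + 2 * pi"
  have s0: "real s \<ge> 1" using s1 by simp
  have m0: "real m \<ge> 1" using m by simp
  have p0: "0 \<le> p" by (simp add: p_def)
  have PYe: "PY (y 1) = 0" "PY e = 0"
    using PY_zero[OF one_in_J] PY_periodic[of "y 1"] by (auto simp: e_def)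
  \<comment> \<open>\<open>PY\<close> vanishes at both ends of \<open>per\<close> and is
    \<open>s\<close>-Lipschitz, so the window stays well inside.\<close>
  have wc: "2 * w \<le> c - y 1" "2 * w \<le> e - c"
  proof -
    have "p \<le> real s * \<bar>c - y 1\<bar>" using PY_lipschitz[of c "y 1"] PYe by (simp add: p_def)
    then show "2 * w \<le> c - y 1" using c s0 by (simp add: w_def field_simps)
    have "p \<le> real s * \<bar>c - e\<bar>" using PY_lipschitz[of c e] PYe by (simp add: p_def)
    then show "2 * w \<le> e - c" using c s0 by (simp add: w_def e_def field_simps)
  qed
  have w0: "0 \<le> w" using p0 s0 by (simp add: w_def)
  have int: "E integrable_on {a..b}" for a b
    by (rule integrable_continuous_real[OF continuous_on_subset[OF E(1)]]) simp
  \<comment> \<open>Bound for the integral at distance \<open>\<delta>\<close> from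
    \<open>c\<close>: two of the four powers of the weight are integrated, two are evaluated at
    \<open>\<delta>\<close>.\<close>
  define \<tau> where "\<tau> = (\<lambda>\<delta>. K * (72 / real m) / (1 + real m * \<delta> / 6) ^ 2)"
  have tail: "\<bar>integral {a..b} E\<bar> \<le> \<tau> \<delta>"
    if ab: "y 1 \<le> a" "b \<le> e" and \<delta>: "0 \<le> \<delta>" "\<delta> \<le> w" and far: "\<And>t. t \<in> {a..b} \<Longrightarrow> \<delta> \<le> \<bar>t - c\<bar>" for a b \<delta>
  proof -
    have pt: "\<bar>E t\<bar> \<le> K / (1 + real m * \<delta> / 6) ^ 2 * (1 / wt m (t - c) ^ 2)" if t: "t \<in> {a..b}" for t
    proof -
      have "\<delta> \<le> 6 * rho (t - c)"
      proof -
        have tt: "y 1 \<le> t" "t \<le> e" using t ab by auto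
        \<comment> \<open>If \<open>t\<close> is more than \<open>pi\<close> away, the nearest
          translate of \<open>c\<close> lies outside \<open>per\<close>, at distance at least
          \<open>2 * w\<close> from \<open>t\<close> by \<open>wc\<close>.\<close>
        consider "\<bar>t - c\<bar> \<le> pi" | "t - c > pi" | "t - c < - pi" by linarith
        then show ?thesis
        proof cases
          case 1
          then show ?thesis using abs_le_rho[OF 1] far[OF t] by linarith
        next
          case 2
          have "\<bar>t - c - 2 * pi\<bar> \<le> 6 * rho (t - c - 2 * pi)"
            by (rule abs_le_rho) (use 2 tt c in \<open>auto simp: e_def\<close>)
          also have "rho (t - c - 2 * pi) = rho (t - c)" using rho_periodic[of "t - c - 2 * pi"] by simp
          finally show ?thesis using tt wc w0 \<delta> by (simp add: e_def)
        next
          case 3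
          have "\<bar>t - c + 2 * pi\<bar> \<le> 6 * rho (t - c + 2 * pi)"
            by (rule abs_le_rho) (use 3 tt c in \<open>auto simp: e_def\<close>)
          also have "rho (t - c + 2 * pi) = rho (t - c)" by (rule rho_periodic)
          finally show ?thesis using tt wc w0 \<delta> by (simp add: e_def)
        qed
      qed
      then have "real m * \<delta> \<le> real m * (6 * rho (t - c))" by (intro mult_left_mono) auto
      then have d: "1 + real m * \<delta> / 6 \<le> 1 + real m * rho (t - c)" by simp
      have d0: "0 < 1 + real m * \<delta> / 6" using \<delta> by (intro add_pos_nonneg) auto
      have "\<bar>E t\<bar> \<le> K / wt m (t - c) ^ 4" by (rule E(2))
      also have "\<dots> = K / (wt m (t - c) ^ 2 * wt m (t - c) ^ 2)"
        by (simp only: power_add[symmetric]) simp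
      also have "\<dots> \<le> K / ((1 + real m * \<delta> / 6) ^ 2 * wt m (t - c) ^ 2)"
        using d d0 K by (intro divide_left_mono mult_right_mono power_mono mult_pos_pos zero_less_power) auto
      finally show ?thesis by simp
    qed
    have "norm (integral {a..b} E) \<le> integral {a..b} (\<lambda>t. K / (1 + real m * \<delta> / 6) ^ 2 * (1 / wt m (t - c) ^ 2))"
    proof (rule integral_norm_bound_integral[OF int])
      show "(\<lambda>t. K / (1 + real m * \<delta> / 6) ^ 2 * (1 / wt m (t - c) ^ 2)) integrable_on {a..b}"
        by (intro integrable_continuous_real continuous_on_mult_left rho_weight_continuous)
    qed (use pt in \<open>simp only: real_norm_def\<close>)
    also have "\<dots> = K / (1 + real m * \<delta> / 6) ^ 2 * integral {a..b} (\<lambda>t. 1 / wt m (t - c) ^ 2)"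
      by (rule integral_mult_right)
    also have "\<dots> \<le> K / (1 + real m * \<delta> / 6) ^ 2 * (72 / real m)"
      using K c ab by (intro mult_left_mono rho_weight_integral m) (auto simp: e_def)
    finally show ?thesis by (simp add: \<tau>_def mult_ac)
  qed
  define X where "X = 1 / wt m (x - c) ^ 2"
  define Y where "Y = 1 / (1 + real m * p) ^ 2"
  have XY: "0 \<le> X" "0 \<le> Y" by (auto simp: X_def Y_def)
  have Km: "0 \<le> K * (72 / real m)" using K by simp
  \<comment> \<open>Three tails, the factor \<open>12^2\<close> of \<open>comp\<close> and the
    \<open>72\<close> of \<open>rho_weight_integral\<close> make up \<open>31104\<close>.\<close>
  have main: "\<bar>integral {y 1..x} E\<bar> \<le> 3 * (144 * real s ^ 2 * (K * (72 / real m)) * (X + Y))"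
  proof (cases "1 / real m \<le> p")
    case False
    have "\<bar>integral {y 1..x} E\<bar> \<le> \<tau> 0" using x w0 by (intro tail) (auto simp: e_def)
    also have "\<dots> = K * (72 / real m) * 1" by (simp add: \<tau>_def)
    also have "\<dots> \<le> K * (72 / real m) * (4 * Y)"
    proof (rule mult_left_mono[OF _ Km])
      have "real m * p \<le> 1" using False m0 by (simp add: field_simps)
      then have "(1 + real m * p) ^ 2 \<le> 2 ^ 2" using p0 by (intro power_mono) auto
      moreover have "0 < (1 + real m * p) ^ 2" using p0 by (intro zero_less_power add_pos_nonneg) auto
      ultimately show "1 \<le> 4 * Y" by (simp add: Y_def field_simps)
    qed
    also have "\<dots> \<le> K * (72 / real m) * (432 * real s ^ 2 * (X + Y))"
    proof (rule mult_left_mono[OF _ Km])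
      have "4 * Y \<le> 432 * 1 * (X + Y)" using XY by simp
      also have "\<dots> \<le> 432 * real s ^ 2 * (X + Y)" using XY s0 by (intro mult_right_mono mult_left_mono) auto
      finally show "4 * Y \<le> 432 * real s ^ 2 * (X + Y)" .
    qed
    finally show ?thesis by (simp add: mult_ac)
  next
    case True
    define \<delta> where "\<delta> = min w \<bar>x - c\<bar>"
    have \<delta>: "0 \<le> \<delta>" "\<delta> \<le> w" "\<delta> \<le> \<bar>x - c\<bar>" using w0 by (auto simp: \<delta>_def)
    have \<tau>0: "0 \<le> \<tau> \<delta>" using K \<delta> by (simp add: \<tau>_def)
    have xe: "y 1 \<le> x" "x \<le> e" using x by (auto simp: e_def)
    have "\<bar>integral {y 1..x} E\<bar> \<le> 3 * \<tau> \<delta>"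
    proof (cases "x \<le> c")
      case True
      have "\<bar>integral {y 1..x} E\<bar> \<le> \<tau> \<delta>"
        by (rule tail) (use True \<delta> xe in auto)
      then show ?thesis using \<tau>0 by simp
    next
      case False
      \<comment> \<open>The integral up to \<open>x\<close> is the whole one minus the part beyond
        \<open>x\<close>. The window contributes nothing to the whole, so three tails
        remain.\<close>
      have "\<bar>integral {x..e} E\<bar> \<le> \<tau> \<delta>"
        by (rule tail) (use False \<delta> xe in auto)
      moreover have "\<bar>integral {y 1..c - w} E\<bar> \<le> \<tau> \<delta>"
        by (rule tail) (use \<delta> wc w0 in auto)
      moreover have "\<bar>integral {c + w..e} E\<bar> \<le> \<tau> \<delta>"
        by (rule tail) (use \<delta> wc w0 in auto)
      moreover have "integral {c - w..c + w} E = 0"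
        using mass True by (simp add: w_def p_def)
      moreover have "integral {y 1..x} E + integral {x..e} E = integral {y 1..e} E"
        by (rule Henstock_Kurzweil_Integration.integral_combine) (use xe int in auto)
      moreover have "integral {y 1..c - w} E + integral {c - w..e} E = integral {y 1..e} E"
        by (rule Henstock_Kurzweil_Integration.integral_combine) (use wc w0 int in auto)
      moreover have "integral {c - w..c + w} E + integral {c + w..e} E = integral {c - w..e} E"
        by (rule Henstock_Kurzweil_Integration.integral_combine) (use wc w0 int in auto)
      ultimately show ?thesis by linarith
    qed
    also have "\<tau> \<delta> \<le> 144 * real s ^ 2 * (K * (72 / real m)) * (X + Y)"
    proof -
      \<comment> \<open>The factor \<open>12 * real s\<close> undoes
        \<open>w = p / (2 * real s)\<close> and the \<open>6\<close>: for
        \<open>\<delta> = w\<close> the condition on \<open>V\<close> reads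
        \<open>V \<le> 12 * s + m * p\<close>.\<close>
      have comp: "\<tau> \<delta> \<le> 144 * real s ^ 2 * (K * (72 / real m)) * (1 / V ^ 2)"
        if V: "1 \<le> V" "V \<le> 12 * real s * (1 + real m * \<delta> / 6)" for V
      proof -
        have u0: "0 < 1 + real m * \<delta> / 6" using \<delta> by (intro add_pos_nonneg) auto
        have "V ^ 2 \<le> (12 * real s * (1 + real m * \<delta> / 6)) ^ 2" using V by (intro power_mono) auto
        then have "1 / (12 * real s * (1 + real m * \<delta> / 6)) ^ 2 \<le> 1 / V ^ 2"
          using V u0 s0 by (intro divide_left_mono mult_pos_pos zero_less_power) auto
        then have "144 * real s ^ 2 * (1 / (12 * real s * (1 + real m * \<delta> / 6)) ^ 2) \<le> 144 * real s ^ 2 * (1 / V ^ 2)"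
          by (intro mult_left_mono) auto
        moreover have "144 * real s ^ 2 * (1 / (12 * real s * (1 + real m * \<delta> / 6)) ^ 2) = 1 / (1 + real m * \<delta> / 6) ^ 2"
          using s0 by (simp add: power_mult_distrib)
        ultimately have "1 / (1 + real m * \<delta> / 6) ^ 2 \<le> 144 * real s ^ 2 * (1 / V ^ 2)" by simp
        then have "K * (72 / real m) * (1 / (1 + real m * \<delta> / 6) ^ 2) \<le> K * (72 / real m) * (144 * real s ^ 2 * (1 / V ^ 2))"
          using Km by (rule mult_left_mono)
        then show ?thesis by (simp add: \<tau>_def mult_ac)
      qed
      have pos: "0 \<le> 144 * real s ^ 2 * (K * (72 / real m))" by (rule mult_nonneg_nonneg[OF _ Km]) simp
      show ?thesis
      proof (cases "w \<le> \<bar>x - c\<bar>")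
        case True
        then have "\<delta> = w" by (simp add: \<delta>_def)
        then have "12 * real s * (1 + real m * \<delta> / 6) = 12 * real s + real m * p"
          using s0 by (simp add: w_def field_simps)
        then have "\<tau> \<delta> \<le> 144 * real s ^ 2 * (K * (72 / real m)) * Y"
          unfolding Y_def using p0 s0 by (intro comp) auto
        also have "\<dots> \<le> 144 * real s ^ 2 * (K * (72 / real m)) * (X + Y)"
          using XY pos by (intro mult_left_mono) auto
        finally show ?thesis .
      next
        case False
        then have d: "\<delta> = \<bar>x - c\<bar>" by (simp add: \<delta>_def)
        have "real m * rho (x - c) \<le> real m * \<delta>"
          using rho_le_abs[of "x - c"] by (intro mult_left_mono) (auto simp: d)
        also have "\<dots> \<le> real s * (2 * (real m * \<delta>))"
          using s0 \<delta> mult_mono[of 1 "real s" "real m * \<delta>" "2 * (real m * \<delta>)"] by simp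
        finally have "1 + real m * rho (x - c) \<le> 12 * real s * (1 + real m * \<delta> / 6)"
          using s0 by (simp add: algebra_simps)
        then have "\<tau> \<delta> \<le> 144 * real s ^ 2 * (K * (72 / real m)) * X"
          unfolding X_def by (intro comp) auto
        also have "\<dots> \<le> 144 * real s ^ 2 * (K * (72 / real m)) * (X + Y)"
          using XY pos by (intro mult_left_mono) auto
        finally show ?thesis .
      qed
    qed
    finally show ?thesis by simp
  qed
  also have "\<dots> = 31104 * real s ^ 2 * (K / real m) * (X + Y)" by simp
  finally show ?thesis by (simp only: X_def Y_def p_def)
qed

text \<open>Each centre contributes order \<open>(1 / m) ^ (k + 2)\<close> times weights whose sums
  over the grid are bounded uniformly in \<open>m\<close>. Only the kernel's degree grows with
  \<open>m\<close>. The mean itself is not yet zero, but \<open>x = y 1 + 2 * pi\<close> shows that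
  it is small.\<close>

lemma copositive_mean_approximation:
  assumes B: "B \<ge> 0"
  shows "\<exists>n L C. 1 \<le> L \<and> 0 \<le> C \<and> (\<forall>D m. admissible k B D \<longrightarrow> 1 \<le> m \<longrightarrow>
     (\<exists>T. htrig (2 * (L * (m - 1) + n)) T \<and> (\<forall>x. T x * PY x \<ge> 0) \<and>
       (\<forall>x\<in>per. \<bar>integral {y 1..x} (\<lambda>t. D 0 t - T t)\<bar> \<le> C * (1 / real m) ^ (k + 2))))"
proof -
  obtain n R C where C: "0 \<le> C" and MC: "\<And>D \<xi> m F. admissible k B D \<Longrightarrow> 1 \<le> m \<Longrightarrow> jackson (R + 4) m F \<Longrightarrow>
     (\<exists>q. mass_matched k n R C m F (D 0) \<xi> q)"
    using mass_matched_exists[OF B, of k] by blast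
  define L where "L = R + 4"
  have L1: "1 \<le> L" by (simp add: L_def)
  obtain S where S0: "0 \<le> S" and S: "\<And>m L N b. m \<ge> 1 \<Longrightarrow> L \<ge> 1 \<Longrightarrow> N = L * m + 1 \<Longrightarrow>
     (\<Sum>j<N. 1 / (1 + real m * \<bar>PY (b + 2 * pi * real j / real N)\<bar>) ^ 2) \<le> S * (real L + 1)"
    using PY_weight_sum by blast
  define C' where "C' = 31104 * real s ^ 2 * (C * 4 ^ L) * (300 * (real L + 1) + S * (real L + 1))"
  have main: "\<exists>T. htrig (2 * (L * (m - 1) + (n + s))) T \<and> (\<forall>x. T x * PY x \<ge> 0) \<and>
       (\<forall>x\<in>per. \<bar>integral {y 1..x} (\<lambda>t. D 0 t - T t)\<bar> \<le> C' * (1 / real m) ^ (k + 2))"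
    if D: "admissible k B D" and m: "1 \<le> m" for D m
  proof -
    obtain F where F: "jackson L m F" using jackson_exists[OF m] by blast
    have F0: "0 \<le> F z" for z using F by (simp add: jackson_def)
    have FH: "htrig (2 * (L * (m - 1))) F" using F by (simp add: jackson_def)
    define h where "h = 1 / real m"
    have h: "0 < h" using m by (simp add: h_def)
    \<comment> \<open>More nodes than the order of the kernel, so that the translates sum to a
      constant.\<close>
    define N where "N = L * m + 1"
    have N: "L * (m - 1) < N" "0 < N" by (auto simp: N_def intro!: le_less_trans[of _ "L * m"])
    define t where "t = (\<lambda>j. y 1 + 2 * pi * real j / real N)"
    obtain \<kappa> where \<kappa>: "\<And>x. (\<Sum>j<N. F (x - 2 * pi * real j / real N)) = \<kappa>"
      using trig_poly_sum_equidistant[OF trig_poly_if_htrig[OF FH] N(1)] by blast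
    have Fsum: "(\<Sum>j<N. F (x - t j)) = \<kappa>" for x
      using \<kappa>[of "x - y 1"] by (simp add: t_def diff_diff_eq)
    \<comment> \<open>One of the translates equals \<open>F 0 = 1\<close> at 0; hence dividing by
      \<open>\<kappa>\<close> enlarges nothing.\<close>
    have "F 0 \<le> (\<Sum>j<N. F (0 - 2 * pi * real j / real N))"
      using member_le_sum[of 0 "{..<N}" "\<lambda>j. F (0 - 2 * pi * real j / real N)"] F0 N by auto
    then have \<kappa>1: "1 \<le> \<kappa>" using \<kappa>[of 0] F by (simp add: jackson_def)
    have "\<forall>j. \<exists>q. mass_matched k n R C m F (D 0) (t j) q" using MC[OF D m] F unfolding L_def by blast
    then obtain q where q: "\<And>j. mass_matched k n R C m F (D 0) (t j) (q j)" by metis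
    define E where "E = (\<lambda>j x. F (x - t j) * (D 0 x - PY x * q j x))"
    define T where "T = (\<lambda>x. 1 / \<kappa> * (\<Sum>j<N. F (x - t j) * (PY x * q j x)))"
    have "htrig (2 * (L * (m - 1)) + (2 * s + 2 * n)) T"
      unfolding T_def using q
      by (intro htrig_cmult htrig_sum htrig_mult htrig_shift FH PY_htrig) (auto simp: mass_matched_def h_def)
    moreover have "2 * (L * (m - 1)) + (2 * s + 2 * n) = 2 * (L * (m - 1) + (n + s))" by simp
    ultimately have HT: "htrig (2 * (L * (m - 1) + (n + s))) T" by metis
    have Tsign: "T x * PY x \<ge> 0" for x
    proof -
      have "0 \<le> F (x - t j) * (PY x * q j x) * PY x" for j
      proof -
        have "0 \<le> \<bar>PY x\<bar> * q j x" using q[of j] by (simp add: mass_matched_def h_def)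
        then have "0 \<le> F (x - t j) * (\<bar>PY x\<bar> * (\<bar>PY x\<bar> * q j x))" 
          by (rule mult_nonneg_nonneg[OF F0 mult_nonneg_nonneg[OF abs_ge_zero]])
        also have "\<dots> = F (x - t j) * ((\<bar>PY x\<bar> * \<bar>PY x\<bar>) * q j x)" by (simp only: mult_ac)
        finally show ?thesis by (simp add: mult_ac)
      qed
      then have "0 \<le> (\<Sum>j<N. F (x - t j) * (PY x * q j x) * PY x)" by (rule sum_nonneg)
      then have "0 \<le> 1 / \<kappa> * (\<Sum>j<N. F (x - t j) * (PY x * q j x) * PY x)"
        using \<kappa>1 by (intro mult_nonneg_nonneg[of "1 / \<kappa>"]) auto
      then show ?thesis by (simp add: T_def sum_distrib_right mult.assoc)
    qed
    have DT: "D 0 x - T x = 1 / \<kappa> * (\<Sum>j<N. E j x)" for x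
    proof -
      have "1 / \<kappa> * (\<Sum>j<N. E j x) = 1 / \<kappa> * ((\<Sum>j<N. F (x - t j)) * D 0 x) - T x"
        unfolding E_def T_def right_diff_distrib sum_subtractf sum_distrib_right ..
      also have "1 / \<kappa> * ((\<Sum>j<N. F (x - t j)) * D 0 x) = D 0 x" using \<kappa>1 by (simp add: Fsum)
      finally show ?thesis by simp
    qed
    have Econt: "continuous_on A (E j)" for A j
      unfolding E_def using q[of j] jackson_continuous[OF F] admissible_continuous[OF D]
      by (intro continuous_intros PY_continuous) (auto simp: mass_matched_def h_def intro: htrig_continuous)
    have Ebound: "\<bar>E j x\<bar> \<le> C * h ^ Suc k * 4 ^ L / wt m (x - t j) ^ 4" for j x
    proof -
      have "\<bar>E j x\<bar> = F (x - t j) * \<bar>D 0 x - PY x * q j x\<bar>" using F0 by (simp add: E_def abs_mult)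
      also have "\<dots> \<le> F (x - t j) * (C * h ^ Suc k * wt m (x - t j) ^ R)"
        using q[of j] by (intro mult_left_mono F0) (auto simp: mass_matched_def h_def)
      also have "\<dots> = C * h ^ Suc k * (F (x - t j) * wt m (x - t j) ^ R)" by (simp only: mult_ac)
      also have "\<dots> \<le> C * h ^ Suc k * (4 ^ L / wt m (x - t j) ^ 4)"
        using C h by (intro mult_left_mono jackson_decay[OF F]) (auto simp: L_def)
      finally show ?thesis by simp
    qed
    have bound: "\<bar>integral {y 1..x} (\<lambda>u. D 0 u - T u)\<bar> \<le> C' * h ^ (k + 2)" if x: "x \<in> per" for x
    proof -
      define K where "K = C * h ^ Suc k * 4 ^ L"
      have K0: "0 \<le> K" using C h by (simp add: K_def)
      have Ej: "\<bar>integral {y 1..x} (E j)\<bar> \<le> 31104 * real s ^ 2 * (K / real m) *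
         (1 / wt m (x - t j) ^ 2 + 1 / (1 + real m * \<bar>PY (t j)\<bar>) ^ 2)" if "j < N" for j
      proof (rule local_error_integral[OF m K0 _ x])
        show "t j \<in> per" using that by (auto simp: t_def field_simps)
        show "integral {t j - \<bar>PY (t j)\<bar> / (2 * real s)..t j + \<bar>PY (t j)\<bar> / (2 * real s)} (E j) = 0"
          if "1 / real m \<le> \<bar>PY (t j)\<bar>" using q[of j] that unfolding mass_matched_def h_def E_def by blast
      qed (use Econt Ebound in \<open>auto simp: K_def\<close>)
      have eq: "integral {y 1..x} (\<lambda>u. D 0 u - T u) = 1 / \<kappa> * (\<Sum>j<N. integral {y 1..x} (E j))"
        unfolding DT integral_mult_right
        by (subst integral_sum) (auto intro!: integrable_continuous_real Econt)
      have "\<bar>integral {y 1..x} (\<lambda>u. D 0 u - T u)\<bar> \<le> 1 * (\<Sum>j<N. 31104 * real s ^ 2 * (K / real m) *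
         (1 / wt m (x - t j) ^ 2 + 1 / (1 + real m * \<bar>PY (t j)\<bar>) ^ 2))"
        unfolding eq abs_mult using \<kappa>1 Ej by (intro mult_mono order.trans[OF sum_abs] sum_mono) auto
      also have "\<dots> = 31104 * real s ^ 2 * (K / real m) *
         ((\<Sum>j<N. 1 / wt m (x - t j) ^ 2) + (\<Sum>j<N. 1 / (1 + real m * \<bar>PY (t j)\<bar>) ^ 2))"
        by (simp only: sum_distrib_left[symmetric] sum.distrib mult_1)
      also have "\<dots> \<le> 31104 * real s ^ 2 * (K / real m) * (300 * (real L + 1) + S * (real L + 1))"
        unfolding t_def using K0 rho_weight_sum[OF m L1 N_def] S[OF m L1 N_def]
        by (intro mult_left_mono add_mono) auto
      also have "\<dots> = C' * h ^ (k + 2)" by (simp add: C'_def K_def h_def)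
      finally show ?thesis .
    qed
    show ?thesis using HT Tsign bound unfolding h_def by blast
  qed
  have "0 \<le> C'" using C S0 by (simp add: C'_def)
  then show ?thesis using L1 main by blast
qed

text \<open>Otherwise the constant \<open>- \<sigma>\<close> would be copositive and hence vanish at
  \<open>y 1\<close> by \<open>copositive_zero\<close>.\<close>

lemma PY_takes_sign:
  assumes "\<bar>\<sigma>\<bar> = 1"
  shows "\<exists>x\<in>per. 0 < \<sigma> * PY x"
proof -
  have "\<exists>x. 0 < \<sigma> * PY x"
  proof (rule ccontr)
    assume "\<not> ?thesis"
    then have "- \<sigma> * PY x \<ge> 0" for x by (simp add: not_less)
    then have "- \<sigma> = 0" using copositive_zero[of "\<lambda>x. - \<sigma>", OF _ _ one_in_J] by (simp add: continuous_on_const)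
    then show False using assms by simp
  qed
  then obtain x where x: "0 < \<sigma> * PY x" by blast
  obtain l :: int where l: "\<bar>x - (y 1 + pi) - 2 * pi * of_int l\<bar> \<le> pi" by (rule reduce_mod_2pi)
  have "PY (x + 2 * pi * of_int (- l)) = PY x" by (rule periodic_int[of PY, OF PY_periodic])
  then show ?thesis using l x by (intro bexI[of _ "x + 2 * pi * of_int (- l)"]) (auto simp: abs_le_iff)
qed

text \<open>
  With \<open>v = \<sigma> \<Pi>\<close> the function \<open>v (1 + v/2)^(2a)\<close> stays above \<open>-1\<close> but grows geometrically in \<open>a\<close> where
  \<open>v\<close> is positive, so its mean is eventually positive.
\<close>

lemma signed_correction:
  assumes \<sigma>: "\<bar>\<sigma>\<bar> = 1"
  shows "\<exists>M P. htrig (2 * M) P \<and> (\<forall>x. P x * PY x \<ge> 0) \<and> integral per P = \<sigma>"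
proof -
  define v where "v = (\<lambda>x. \<sigma> * PY x)"
  define I where "I = per"
  have v1: "\<bar>v x\<bar> \<le> 1" for x using PY_le_one[of x] \<sigma> by (simp add: v_def abs_mult)
  have vlip: "\<bar>v a - v b\<bar> \<le> real s * \<bar>a - b\<bar>" for a b
    using PY_lipschitz[of a b] \<sigma> by (simp add: v_def abs_mult flip: right_diff_distrib)
  obtain x0 where x0: "x0 \<in> I" "0 < v x0" using PY_takes_sign[OF \<sigma>] by (auto simp: v_def I_def)
  define d where "d = v x0 / 2"
  have d: "0 < d" using x0 by (simp add: d_def)
  define \<eta> where "\<eta> = d / real s"
  have \<eta>: "0 < \<eta>" using d s1 by (simp add: \<eta>_def)
  have near: "d \<le> v x" if "\<bar>x - x0\<bar> \<le> \<eta>" for x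
  proof -
    have "\<bar>v x - v x0\<bar> \<le> real s * \<bar>x - x0\<bar>" by (rule vlip)
    also have "\<dots> \<le> real s * \<eta>" using that by (intro mult_left_mono) auto
    also have "\<dots> = d" using s1 by (simp add: \<eta>_def)
    finally show ?thesis unfolding d_def by linarith
  qed
  have v_ends: "v (y 1) = 0" "v (y 1 + 2 * pi) = 0"
    using PY_zero[OF one_in_J] PY_periodic[of "y 1"] by (auto simp: v_def)
  \<comment> \<open>\<open>v\<close> is 0 at both ends of \<open>per\<close> but at least
    \<open>d\<close> on this interval, which therefore cannot reach them.\<close>
  have sub: "{x0 - \<eta>..x0 + \<eta>} \<subseteq> I"
  proof -
    have "\<not> \<bar>y 1 - x0\<bar> \<le> \<eta>" "\<not> \<bar>y 1 + 2 * pi - x0\<bar> \<le> \<eta>"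
      using near[of "y 1"] near[of "y 1 + 2 * pi"] v_ends d by auto
    then show ?thesis using x0(1) by (auto simp: I_def)
  qed
  \<comment> \<open>The gain on the interval around \<open>x0\<close> has to exceed
    \<open>2 * pi\<close>, the most that the lower bound \<open>- 1\<close> can cost on a
    period.\<close>
  obtain a :: nat where a: "2 * pi / (2 * \<eta> * d) < (1 + d/2) ^ a"
    using real_arch_pow[of "1 + d/2"] d by auto
  define g where "g = (\<lambda>x. v x * (1 + v x / 2) ^ (2 * a))"
  have vh: "htrig (2 * s) v" unfolding v_def by (intro htrig_cmult PY_htrig)
  have "htrig (2 * s + 2 * s * (2 * a)) g" unfolding g_def
    using vh htrig_const[of s 1] htrig_cmult[OF vh, of "1/2"]
    by (intro htrig_mult htrig_power htrig_add) auto
  then have gh: "htrig (2 * (s + s * (2 * a))) g" by (simp add: algebra_simps)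
  have g_lower: "- 1 \<le> g x" for x
  proof (cases "0 \<le> v x")
    case True
    then have "0 \<le> g x" by (simp add: g_def)
    then show ?thesis by simp
  next
    case False
    have b: "\<bar>1 + v x / 2\<bar> \<le> 1" using False v1[of x] by (simp add: abs_le_iff)
    have "\<bar>g x\<bar> = \<bar>v x\<bar> * \<bar>1 + v x / 2\<bar> ^ (2 * a)" by (simp add: g_def abs_mult power_abs)
    also have "\<dots> \<le> 1 * 1" by (rule mult_mono[OF v1 power_le_one[OF abs_ge_zero b]]) simp_all
    finally show ?thesis by (simp add: abs_le_iff)
  qed
  have gc: "continuous_on A g" for A by (rule htrig_continuous[OF gh])
  have gi: "g integrable_on {u..w}" for u w by (rule integrable_continuous_real[OF gc])
  have "2 * pi < (2 * \<eta> * d) * (1 + d/2) ^ a"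
    using a d \<eta> by (simp add: divide_less_eq mult_ac)
  also have "\<dots> \<le> (2 * \<eta> * d) * (1 + d/2) ^ (2 * a)"
    using d \<eta> by (intro mult_left_mono power_increasing) auto
  also have "\<dots> = integral {x0 - \<eta>..x0 + \<eta>} (\<lambda>x. d * (1 + d/2) ^ (2 * a))" using \<eta> by simp
  also have "\<dots> \<le> integral {x0 - \<eta>..x0 + \<eta>} (\<lambda>x. g x + 1)"
  proof (rule integral_le)
    fix x assume "x \<in> {x0 - \<eta>..x0 + \<eta>}"
    then have "d \<le> v x" by (intro near) (auto simp: abs_le_iff)
    then have "d * (1 + d/2) ^ (2 * a) \<le> g x" unfolding g_def using d by (intro mult_mono power_mono) auto
    then show "d * (1 + d/2) ^ (2 * a) \<le> g x + 1" by simp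
  qed (auto intro!: integrable_add gi)
  also have "\<dots> \<le> integral I (\<lambda>x. g x + 1)"
  proof (rule integral_subset_le[OF sub])
    show "\<forall>x\<in>I. 0 \<le> g x + 1" using g_lower by (metis add.commute neg_le_iff_le le_minus_iff add_increasing2 diff_ge_0_iff_ge diff_minus_eq_add)
  qed (auto simp: I_def intro!: integrable_add gi)
  also have "\<dots> = integral I g + 2 * pi"
    unfolding I_def by (subst integral_add) (auto intro: gi)
  finally have pos: "0 < integral I g" by simp
  define P where "P = (\<lambda>x. \<sigma> / integral I g * g x)"
  have "htrig (2 * (s + s * (2 * a))) P" unfolding P_def by (rule htrig_cmult[OF gh])
  moreover have "0 \<le> P x * PY x" for x
  proof -
    have "\<sigma> * \<sigma> = 1" using \<sigma> by (metis abs_mult_self_eq mult_1)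
    then have "P x * PY x = 1 / integral I g * (v x * v x) * (1 + v x / 2) ^ (2 * a)"
      by (simp add: P_def g_def v_def algebra_simps)
    then show ?thesis using pos by simp
  qed
  moreover have "integral per P = \<sigma>"
    unfolding P_def integral_mult_right using pos by (simp add: I_def)
  ultimately show ?thesis by blast
qed

end

section \<open>From the derivative to comonotone approximation\<close>

lemma unorm_le: "(\<And>x. \<bar>g x\<bar> \<le> E) \<Longrightarrow> unorm g \<le> E"
  unfolding unorm_def by (rule cSUP_least) auto

text \<open>Real infima and suprema call for boundedness. The given \<open>\<tau>\<close> makes
  \<open>f\<close> bounded, so every \<open>unorm\<close> involved is a genuine supremum and 0 is a
  lower bound of the set.\<close>

lemma En1_le:
  assumes \<tau>: "Delta1 s y \<tau>" "trig_poly n \<tau>" and E: "\<And>x. \<bar>f x - \<tau> x\<bar> \<le> E"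
  shows "En1 n s y f \<le> E"
proof -
  have "0 \<le> unorm (\<lambda>x. f x - \<tau>' x)" if t': "trig_poly n \<tau>'" for \<tau>'
  proof -
    obtain U where U: "\<And>x. \<bar>\<tau> x\<bar> \<le> U" using htrig_lipschitz[OF htrig_if_trig_poly[OF \<tau>(2)]] by blast
    obtain U' where U': "\<And>x. \<bar>\<tau>' x\<bar> \<le> U'" using htrig_lipschitz[OF htrig_if_trig_poly[OF t']] by blast
    have "\<bar>f x - \<tau>' x\<bar> \<le> E + U + U'" for x
      using E[of x] U[of x] U'[of x] by (simp add: abs_le_iff)
    then have "bdd_above (range (\<lambda>x. \<bar>f x - \<tau>' x\<bar>))" by (intro bdd_aboveI2[where M="E + U + U'"]) auto
    then have "\<bar>f 0 - \<tau>' 0\<bar> \<le> unorm (\<lambda>x. f x - \<tau>' x)" unfolding unorm_def by (intro cSUP_upper) auto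
    then show ?thesis by linarith
  qed
  then have "bdd_below ((\<lambda>\<tau>. unorm (\<lambda>x. f x - \<tau> x)) ` {\<tau>. Delta1 s y \<tau> \<and> trig_poly n \<tau>})"
    by (intro bdd_belowI2[of _ 0]) auto
  then have "En1 n s y f \<le> unorm (\<lambda>x. f x - \<tau> x)"
    unfolding En1_def using \<tau> by (intro cINF_lower) auto
  also have "\<dots> \<le> E" by (rule unorm_le) (rule E)
  finally show ?thesis .
qed

context knots
begin

text \<open>Zero mean makes the antiderivative of \<open>T\<close> a trigonometric polynomial.
  Adjusted to agree with \<open>f\<close> at \<open>y 1\<close>, its error is the integral from
  \<open>y 1\<close>, and periodicity restricts attention to \<open>per\<close>.\<close>

lemma antiderivative_comonotone:
  assumes T: "htrig (2 * n) T" "\<And>x. T x * PY x \<ge> 0" "integral per T = 0"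
    and f: "\<And>x. (f has_real_derivative g x) (at x)" "\<And>x. f (x + 2 * pi) = f x"
    and E: "\<And>x. x \<in> per \<Longrightarrow> \<bar>integral {y 1..x} (\<lambda>t. g t - T t)\<bar> \<le> E"
  shows "En1 n s y f \<le> E"
proof -
  obtain a0 Q where Q: "trig_poly n Q" "\<And>x. (Q has_real_derivative T x - a0) (at x)"
    using trig_poly_antiderivative[OF trig_poly_if_htrig[OF T(1)]] by blast
  have Qper: "Q (x + 2 * pi) = Q x" for x by (rule htrig_periodic[OF htrig_if_trig_poly[OF Q(1)]])
  have ftc: "((\<lambda>t. F' t) has_integral F x - F (y 1)) {y 1..x}"
    if "\<And>x. (F has_real_derivative F' x) (at x)" "y 1 \<le> x" for F F' :: "real \<Rightarrow> real" and x
  proof (rule fundamental_theorem_of_calculus[OF that(2)])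
    show "(F has_vector_derivative F' t) (at t within {y 1..x})" for t
      using that(1)[of t] unfolding has_real_derivative_iff_has_vector_derivative
      by (rule has_vector_derivative_at_within)
  qed

  have Tint: "T integrable_on per"
    by (rule integrable_continuous_real[OF htrig_continuous[OF T(1)]])
  have "((\<lambda>t. T t - a0) has_integral 0) per"
    using ftc[OF Q(2), of "y 1 + 2 * pi"] Qper[of "y 1"] by simp
  then have "integral per (\<lambda>t. T t - a0) = 0" by (rule integral_unique)
  moreover have "integral per (\<lambda>t. T t - a0) = 0 - 2 * pi * a0"
    using integral_diff[OF Tint integrable_const_ivl[of a0]] T(3) by simp
  ultimately have "a0 = 0" by simp
  then have QT: "(Q has_real_derivative T x) (at x)" for x using Q(2)[of x] by simp
  define \<tau> where "\<tau> = (\<lambda>x. Q x + (f (y 1) - Q (y 1)))"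
  have d\<tau>: "(\<tau> has_real_derivative T x) (at x)" for x
    unfolding \<tau>_def using DERIV_add[OF QT[of x] DERIV_const] by simp
  have "Delta1 s y \<tau>" unfolding Delta1_def
    using d\<tau> T(2) htrig_continuous[OF T(1)] by blast
  moreover have t\<tau>: "trig_poly n \<tau>" unfolding \<tau>_def by (intro trig_poly_add Q trig_poly_const)
  moreover have "\<bar>f x - \<tau> x\<bar> \<le> E" for x
  proof -
    obtain l :: int where l: "\<bar>x - (y 1 + pi) - 2 * pi * of_int l\<bar> \<le> pi" by (rule reduce_mod_2pi)
    define x' where "x' = x + 2 * pi * of_int (- l)"
    have x': "x' \<in> per" using l by (auto simp: x'_def abs_le_iff)
    have per: "f (x + 2 * pi) - \<tau> (x + 2 * pi) = f x - \<tau> x" for x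
      using f(2) Qper by (simp add: \<tau>_def)
    have "((\<lambda>t. g t - T t) has_integral (f x' - \<tau> x') - (f (y 1) - \<tau> (y 1))) {y 1..x'}"
      using x' by (intro ftc DERIV_diff f d\<tau>) auto
    then have "integral {y 1..x'} (\<lambda>t. g t - T t) = f x' - \<tau> x'"
      by (simp add: integral_unique \<tau>_def)
    moreover have "f x' - \<tau> x' = f x - \<tau> x"
      unfolding x'_def by (rule periodic_int[of "\<lambda>x. f x - \<tau> x", OF per])
    ultimately show ?thesis using E[OF x'] by simp
  qed
  ultimately show ?thesis by (intro En1_le)
qed

lemma comonotone_jackson:
  assumes B: "B \<ge> 0"
  shows "\<exists>c. \<forall>f D n. admissible k B D \<and> (\<forall>x. (f has_real_derivative D 0 x) (at x)) \<and>
     (\<forall>x. f (x + 2 * pi) = f x) \<and> 1 \<le> n \<longrightarrow> En1 n s y f \<le> c / real n ^ (k + 2)"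
proof -
  obtain n0 L C where L: "1 \<le> L" and C: "0 \<le> C" and core: "\<And>D m. admissible k B D \<Longrightarrow> 1 \<le> m \<Longrightarrow>
     (\<exists>T. htrig (2 * (L * (m - 1) + n0)) T \<and> (\<forall>x. T x * PY x \<ge> 0) \<and>
       (\<forall>x\<in>per. \<bar>integral {y 1..x} (\<lambda>t. D 0 t - T t)\<bar> \<le> C * (1 / real m) ^ (k + 2)))"
    using copositive_mean_approximation[OF B, of k] by blast
  obtain M1 P1 where P1: "htrig (2 * M1) P1" "\<And>x. P1 x * PY x \<ge> 0" "integral per P1 = 1"
    using signed_correction[of 1] by auto
  obtain M2 P2 where P2: "htrig (2 * M2) P2" "\<And>x. P2 x * PY x \<ge> 0" "integral per P2 = -1"
    using signed_correction[of "-1"] by auto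
  obtain U1 where U1: "\<And>x. \<bar>P1 x\<bar> \<le> U1" using htrig_lipschitz[OF P1(1)] by blast
  obtain U2 where U2: "\<And>x. \<bar>P2 x\<bar> \<le> U2" using htrig_lipschitz[OF P2(1)] by blast
  define U where "U = max U1 U2"
  have U0: "0 \<le> U" using U1[of 0] by (auto simp: U_def)
  define K where "K = n0 + M1 + M2"
  \<comment> \<open>For \<open>n \<ge> N1\<close> half of \<open>n\<close> covers
    \<open>L * m\<close> and half the fixed degrees \<open>K\<close>; the summand
    \<open>2 * L\<close> ensures \<open>m \<ge> 1\<close>.\<close>
  define N1 where "N1 = 2 * L + 2 * K"
  define c1 where "c1 = 2 * pi * B * real N1 ^ (k + 2)"
  define c2 where "c2 = C * (1 + 2 * pi * U) * (4 * real L) ^ (k + 2)"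
  have "En1 n s y f \<le> max c1 c2 / real n ^ (k + 2)"
    if D: "admissible k B D" and f: "\<And>x. (f has_real_derivative D 0 x) (at x)"
      "\<And>x. f (x + 2 * pi) = f x" and n: "1 \<le> n" for f D n
  proof (cases "N1 \<le> n")
    case False
    \<comment> \<open>For small \<open>n\<close> a constant approximant, obtained from
      \<open>T = 0\<close>, is good enough.\<close>
    have "En1 n s y f \<le> 2 * pi * B"
    proof (rule antiderivative_comonotone[OF _ _ _ f])
      show "htrig (2 * n) (\<lambda>x. 0)" by (rule htrig_zero)
      fix x assume x: "x \<in> per"
      have "norm (integral {y 1..x} (D 0)) \<le> integral {y 1..x} (\<lambda>t. B)"
        using D by (intro integral_norm_bound_integral integrable_continuous_real admissible_continuous[OF D])
          (auto simp: admissible_def)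
      also have "\<dots> \<le> 2 * pi * B" using x B by (simp add: mult_right_mono)
      finally show "\<bar>integral {y 1..x} (\<lambda>t. D 0 t - 0)\<bar> \<le> 2 * pi * B" by simp
    qed simp_all
    also have "\<dots> = 2 * pi * B * 1" by simp
    also have "\<dots> \<le> 2 * pi * B * (real N1 / real n) ^ (k + 2)"
      using False n B by (intro mult_left_mono one_le_power) auto
    also have "\<dots> = c1 / real n ^ (k + 2)" by (simp add: c1_def power_divide)
    also have "\<dots> \<le> max c1 c2 / real n ^ (k + 2)" by (intro divide_right_mono) auto
    finally show ?thesis .
  next
    case True
    define m where "m = n div (2 * L)"
    have m1: "1 \<le> m" using True L by (simp add: m_def N1_def div_greater_zero_iff Suc_le_eq)
    have "2 * L * m \<le> n" by (simp add: m_def)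
    then have deg: "L * (m - 1) + K \<le> n" using True by (simp add: N1_def right_diff_distrib' algebra_simps)
    have nm: "real n \<le> 4 * real L * real m"
    proof -
      have "n < 2 * L * (m + 1)" unfolding m_def using L
        by (metis Suc_eq_plus1 dividend_less_times_div mult.commute mult_pos_pos pos2 zero_less_one order_less_le_trans mult_Suc_right add.commute)
      also have "\<dots> \<le> 2 * L * (2 * m)" using m1 by (intro mult_left_mono) auto
      finally have "n \<le> 4 * L * m" by simp
      then have "real n \<le> real (4 * L * m)" by (simp only: of_nat_le_iff)
      then show ?thesis by simp
    qed
    define \<epsilon> where "\<epsilon> = C * (1 / real m) ^ (k + 2)"
    have \<epsilon>0: "0 \<le> \<epsilon>" using C by (simp add: \<epsilon>_def)
    obtain T where T: "htrig (2 * (L * (m - 1) + n0)) T" "\<And>x. T x * PY x \<ge> 0"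
      "\<And>x. x \<in> per \<Longrightarrow> \<bar>integral {y 1..x} (\<lambda>t. D 0 t - T t)\<bar> \<le> \<epsilon>"
      using core[OF D m1] unfolding \<epsilon>_def by blast
    define e where "e = integral per (\<lambda>t. D 0 t - T t)"
    have e: "\<bar>e\<bar> \<le> \<epsilon>" unfolding e_def by (rule T(3)) simp
    \<comment> \<open>The integral of \<open>T\<close> is \<open>- e\<close>. Adding
      \<open>\<bar>e\<bar> * P\<close>, with the mean of \<open>P\<close> signed like
      \<open>e\<close>, cancels it without losing copositivity.\<close>
    obtain P where P: "htrig (2 * (M1 + M2)) P" "\<And>x. P x * PY x \<ge> 0" "\<bar>e\<bar> * integral per P = e"
      "\<And>x. \<bar>P x\<bar> \<le> U"
    proof (cases "0 \<le> e")
      case True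
      show ?thesis
      proof (rule that[of P1])
        show "htrig (2 * (M1 + M2)) P1" by (rule htrig_mono_even[OF P1(1)]) simp
        show "\<bar>P1 x\<bar> \<le> U" for x using U1[of x] by (simp add: U_def)
      qed (use True P1 in auto)
    next
      case False
      show ?thesis
      proof (rule that[of P2])
        show "htrig (2 * (M1 + M2)) P2" by (rule htrig_mono_even[OF P2(1)]) simp
        show "\<bar>P2 x\<bar> \<le> U" for x using U2[of x] by (simp add: U_def)
      qed (use False P2 in auto)
    qed
    define T' where "T' = (\<lambda>x. T x + \<bar>e\<bar> * P x)"
    have ci: "T integrable_on {a..b}" "P integrable_on {a..b}" "D 0 integrable_on {a..b}" for a b
      using htrig_continuous[OF T(1)] htrig_continuous[OF P(1)] admissible_continuous[OF D]
      by (auto intro: integrable_continuous_real)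
    have ePi: "(\<lambda>x. \<bar>e\<bar> * P x) integrable_on {a..b}" for a b
      using htrig_continuous[OF htrig_cmult[OF P(1)]] by (rule integrable_continuous_real)
    have "En1 n s y f \<le> \<epsilon> * (1 + 2 * pi * U)"
    proof (rule antiderivative_comonotone[OF _ _ _ f])
      have "htrig (2 * n) T" by (rule htrig_mono_even[OF T(1)]) (use deg in \<open>simp add: K_def\<close>)
      moreover have "htrig (2 * n) P" by (rule htrig_mono_even[OF P(1)]) (use deg in \<open>simp add: K_def\<close>)
      ultimately show "htrig (2 * n) T'" unfolding T'_def by (intro htrig_add htrig_cmult)
      show "0 \<le> T' x * PY x" for x
        using T(2)[of x] P(2)[of x] by (simp add: T'_def distrib_right mult.assoc)
      have "(D 0 has_integral f (y 1 + 2 * pi) - f (y 1)) per"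
      proof (rule fundamental_theorem_of_calculus)
        show "(f has_vector_derivative D 0 t) (at t within per)" for t
          using f(1)[of t] unfolding has_real_derivative_iff_has_vector_derivative
          by (rule has_vector_derivative_at_within)
      qed simp
      then have "integral per (D 0) = 0" using f(2) by (simp add: integral_unique)
      then have "e = - integral per T"
        unfolding e_def by (subst integral_diff) (auto intro: ci)
      moreover have "integral per T' = integral per T + \<bar>e\<bar> * integral per P"
        unfolding T'_def by (subst integral_add) (auto intro: ci ePi)
      ultimately show "integral per T' = 0" using P(3) by simp
      fix x assume x: "x \<in> per"
      have "integral {y 1..x} (\<lambda>t. D 0 t - T' t) = integral {y 1..x} (\<lambda>t. (D 0 t - T t) - \<bar>e\<bar> * P t)"
        by (simp add: T'_def algebra_simps)
      also have "\<dots> = integral {y 1..x} (\<lambda>t. D 0 t - T t) - integral {y 1..x} (\<lambda>t. \<bar>e\<bar> * P t)"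
        by (rule integral_diff[OF integrable_diff[OF ci(3) ci(1)] ePi])
      finally have 1: "\<bar>integral {y 1..x} (\<lambda>t. D 0 t - T' t)\<bar> \<le> \<epsilon> + \<bar>integral {y 1..x} (\<lambda>t. \<bar>e\<bar> * P t)\<bar>"
        using T(3)[OF x] by linarith
      have "norm (integral {y 1..x} (\<lambda>t. \<bar>e\<bar> * P t)) \<le> integral {y 1..x} (\<lambda>t. \<epsilon> * U)"
        using e P(4) \<epsilon>0 by (intro integral_norm_bound_integral ePi) (auto simp: abs_mult intro!: mult_mono)
      also have "\<dots> = (x - y 1) * (\<epsilon> * U)" using x by simp
      also have "\<dots> \<le> 2 * pi * (\<epsilon> * U)" using x \<epsilon>0 U0 by (intro mult_right_mono) auto
      finally show "\<bar>integral {y 1..x} (\<lambda>t. D 0 t - T' t)\<bar> \<le> \<epsilon> * (1 + 2 * pi * U)"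
        using 1 by (simp add: algebra_simps)
    qed
    also have "\<dots> \<le> c2 / real n ^ (k + 2)"
    proof -
      have "1 / real m \<le> 4 * real L / real n" using nm m1 n by (simp add: field_simps)
      then have "(1 / real m) ^ (k + 2) \<le> (4 * real L / real n) ^ (k + 2)" by (intro power_mono) auto
      then have "C * (1 + 2 * pi * U) * (1 / real m) ^ (k + 2) \<le> C * (1 + 2 * pi * U) * (4 * real L / real n) ^ (k + 2)"
        using C U0 by (intro mult_left_mono) auto
      then show ?thesis by (simp add: \<epsilon>_def c2_def power_divide mult_ac)
    qed
    also have "\<dots> \<le> max c1 c2 / real n ^ (k + 2)" by (intro divide_right_mono) auto
    finally show ?thesis .
  qed
  then show ?thesis by blast
qed

end

theorem theorem1:
  fixes s r :: nat and y :: "nat \<Rightarrow> real"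
  assumes "s \<ge> 1"
    and "-pi \<le> y (2 * s)" and "y 1 < pi"
    and "\<And>i. 1 \<le> i \<Longrightarrow> i < 2 * s \<Longrightarrow> y (i + 1) < y i"
    and "r \<ge> 2"
  shows "\<exists>c::real. \<forall>f (n::nat). Delta1 s y f \<and> Wr r f \<and> n \<ge> 1 \<longrightarrow>
           En1 n s y f \<le> c / real n ^ r"
proof -
  interpret knots s y by unfold_locales (use assms in auto)
  obtain k where k: "r = k + 2" using assms(5) by (metis add.commute le_Suc_ex)
  define B where "B = (2 * pi) ^ r"
  have "B \<ge> 0" by (simp add: B_def)
  then obtain c where c: "\<And>f D n. admissible k B D \<Longrightarrow> 
     \<forall>x. (f has_real_derivative D 0 x) (at x) \<Longrightarrow> \<forall>x. f (x + 2 * pi) = f x \<Longrightarrow> 1 \<le> n \<Longrightarrow>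
     En1 n s y f \<le> c / real n ^ (k + 2)"
    using comonotone_jackson[of B k] by blast
  have "En1 n s y f \<le> c / real n ^ r" if f: "Delta1 s y f" "Wr r f" and n: "n \<ge> 1" for f n
  proof -
    obtain D where per: "\<And>x. f (x + 2 * pi) = f x" and D0: "D 0 = f"
      and ch: "\<And>j x. j + 1 < r \<Longrightarrow> (D j has_real_derivative D (j + 1) x) (at x)"
      and ac: "abs_cont (D (r - 1))"
      and ae: "AE x in lborel. \<exists>d. (D (r - 1) has_real_derivative d) (at x) \<and> \<bar>d\<bar> \<le> 1"
      using f(2) unfolding Wr_def by blast
    have lip: "\<bar>D (r - 1) x - D (r - 1) z\<bar> \<le> \<bar>x - z\<bar>" for x z
      by (rule abs_cont_imp_lipschitz[OF ac ae])
    have perD: "D 0 (x + 2 * pi) = D 0 x" for x using per D0 by simp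
    note W = Wr_chain_bounds[of D r, OF perD ch lip assms(5)]
    \<comment> \<open>The chain is shifted by one, because the approximation is carried out for
      \<open>f'\<close>.\<close>
    define G where "G = (\<lambda>j. D (Suc j))"
    have df: "(f has_real_derivative G 0 x) (at x)" for x
      using ch[of 0 x] assms(5) by (simp add: G_def D0)
    obtain f' where f': "\<And>x. (f has_real_derivative f' x) (at x)" "continuous_on UNIV f'" "\<And>x. f' x * PY x \<ge> 0"
      using f(1) unfolding Delta1_def by blast
    \<comment> \<open>\<open>Delta1\<close> and \<open>Wr\<close> each bring their own derivative;
      uniqueness transfers the sign condition to the chain.\<close>
    have "f' x = G 0 x" for x by (rule DERIV_unique[OF f'(1) df])
    then have "f' = G 0" by (rule ext)
    then have cop: "\<And>z. G 0 z * PY z \<ge> 0" and cont: "continuous_on UNIV (G 0)" using f' by auto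
    have "admissible k B G" unfolding admissible_def
    proof (intro conjI allI impI ballI)
      show "(G i has_real_derivative G (Suc i) x) (at x)" if "i < k" for i x
        using ch[of "Suc i" x] that by (simp add: G_def k)
      show "\<bar>G k x - G k z\<bar> \<le> \<bar>x - z\<bar>" for x z using lip[of x z] by (simp add: G_def k)
      show "\<bar>G i x\<bar> \<le> B" if "i \<le> k" for i x using W(2)[of "Suc i" x] that by (simp add: G_def k B_def)
      show "G 0 (x + 2 * pi) = G 0 x" for x using W(1)[of 1 x] by (simp add: G_def k)
      show "G 0 (y i) = 0" if "i \<in> J" for i by (rule copositive_zero[OF cont cop that])
      show "G 0 x * PY x \<ge> 0" for x by (rule cop)
    qed
    from c[OF this] df per n show ?thesis unfolding k by blast
  qed
  then show ?thesis by blast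
qed

end
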